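(* Let $G=(V,E)$ be a finite connected planar graph with set of faces $U$, dual graph $G^*=(U,E^* )$, inverse temperature $\beta$ and coupling constants $J_e>0$, and let $\beta^*J^*_{e^*}$ be the dual parameters defined by $\exp(-2\beta^*J^*_{e^*})=\tanh(\beta J_e)$. One can couple the following objects: (i) a double random current $\mathbf n$ with free boundary conditions on $G$ (parameters $\beta J$), together with i.i.d. uniform $\pm1$-valued spins $(\tau_{\mathcal C})$ associated to the clusters $\mathcal C$ of $\mathbf n$; (ii) the dual double random current $\mathbf n^\dagger$ with free boundary conditions on the full dual graph $G^*$ (referred to as wired boundary conditions on the weak dual graph $G^\dagger$) with parameters $\beta^*J^*$, together with i.i.d. uniform $\pm1$-valued spins $(\tau^\dagger_{\mathcal C})$ associated to the clusters $\mathcal C$ of $\mathbf n^\dagger$; (iii) a height function $H$ defined on $V\cup U$; in such a way that the following properties hold: 1. $\mathbf n$ and $\mathbf n^\dagger$ are disjoint: $\mathbf n_e>0$ implies $\mathbf n^\dagger_{e^*}=0$, and $\mathbf n^\dagger_{e^*}>0$ implies $\mathbf n_e=0$, where $e^*$ is the dual edge of $e$. 2. The odd part (set of edges with odd values) of $\mathbf n$ equals the collection of interfaces of $\tau^\dagger$ (the set of primal edges separating dual clusters with $\tau^\dagger$-spins $+1$ and $-1$), and the odd part of $\mathbf n^\dagger$ equals the collection of interfaces of $\tau$ (the set of dual edges separating primal clusters with $\tau$-spins $+1$ and $-1$). 3. For a face $u\in U$ and a vertex $v\in V$ incident on $u$, $H(u)-H(v)=\tfrac12\tau^\dagger_u\tau_v$,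 where $\tau_v$ (resp. $\tau^\dagger_u$) is the spin of the cluster containing $v$ (resp. $u$). Moreover $H$ restricted to the faces of $G$ (resp. of $G^*$) has the law of the nesting field of $\mathbf n$ with free boundary conditions (resp. of $\mathbf n^\dagger$ with wired boundary conditions). 4. When exploring a cluster of $\mathbf n$ from the outside, inside each of its holes the dual current $\mathbf n^\dagger$ has wired boundary conditions, where each inner boundary of the hole is identified as a single dual vertex. More precisely, let $\tilde G$ be a connected component (that is not the component of the boundary) of the graph obtained from $G$ by removing a cluster $\mathcal C$ of $\mathbf n$ and all its adjacent edges. Then, given this exploration, $\mathbf n^\dagger$ restricted to $\tilde G^*$ is a double random current with wired boundary conditions, i.e. a double random current on the full dual graph $\tilde G^*$ (disregarding the state of $\mathbf n^\dagger$ on edges dual to a primal edge adjacent to $\mathcal C$). The same holds with the roles of $\mathbf n$ and $\mathbf n^\dagger$ exchanged.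
   Context: **Currents.** A current on a finite graph $G=(V,E)$ is a function $\mathbf n:E\to\{0,1,2,\dots\}$; it is sourceless if the sum of $\mathbf n$ over edges incident to each vertex is even. The random current with parameters $\beta J$ and free boundary conditions is the random sourceless current with probability proportional to $\prod_e(\beta J_e)^{\mathbf n_e}/\mathbf n_e!$; the double random current is the sum of two independent such currents. Clusters of $\mathbf n$ are the connected components (including isolated vertices) of $(V,\{e:\mathbf n_e>0\})$; $\mathbf n_{\rm odd}$ is the set of edges with odd value. **Duals.** $U$ includes the unbounded face, whose dual vertex is $\mathfrak g$. The weak dual $G^\dagger$ is $G^*$ with $\mathfrak g$ removed. Faces of $G^*$ are identified with the vertices of $G$. **Inner boundaries.** The boundary loops of a cluster $\mathcal C$ consist of the dual edges $e^*$ with $e=\{v,v'\}$, $v\in\mathcal C$, $v'\notin\mathcal C$; the loops around the bounded connected components of the complement of $\mathcal C$ are the inner boundaries. A single hole of $\mathcal C$ (face of the drawn cluster) may contain several inner boundaries, since inner boundaries do not cross primal edges with both endpoints in $\mathcal C$. **Nesting fields.** For a cluster $\mathscr C$, the even subgraph $\mathscr C\cap\mathbf n_{\rm odd}$ defines $\pm1$ spins on faces, equal to $+1$ on the unbounded face and changing sign across each edge of $\mathscr C\cap\mathbf n_{\rm odd}$; $\mathscr C$ is odd around a face if its spin is $-1$. With i.i.d. uniform $\pm1$ labels $\epsilon_{\mathscr C}$ independent of the current, the nesting field of $\mathbf n$ with free boundary conditions at a face $u$ of $G$ is $\sum_{\mathscr C}\mathbf 1\{\mathscr C\text{ odd around }u\}\epsilon_{\mathscr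 C}$, and the nesting field of $\mathbf n^\dagger$ with wired boundary conditions at a face $v$ of $G^*$ is $(\mathbf 1\{\mathscr C_{\mathfrak g}\text{ odd around }v\}-\tfrac12)\epsilon_{\mathscr C_{\mathfrak g}}+\sum_{\mathscr C\ne\mathscr C_{\mathfrak g}}\mathbf 1\{\mathscr C\text{ odd around }v\}\epsilon_{\mathscr C}$, sums over clusters of $\mathbf n^\dagger$, $\mathscr C_{\mathfrak g}$ being the cluster of $\mathfrak g$ (its law does not depend on the planar embedding of $G^*$). *)

theory Defs
  imports "HOL-Probability.Probability" "Graph_Theory.Graph_Theory" "HOL-Combinatorics.Orbits"
begin

section \<open>Plane graphs and their duals\<close>

text \<open>
  Graphs are finite undirected multigraphs: the dual of a simple graph may have parallel edges and
  loops. They are rendered as pre_digraph in which every undirected edge is one arc; the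
  orientation of an arc is an arbitrary reference orientation and no notion below depends on it.
  An edge and its dual edge are the same arc, so a current on the dual graph has the same index
  set as a current on the graph.

  An embedding in the sphere is given by a rotation system. A dart is a pair (edge, flag): the dart
  (e, True) runs along e from tail to head, (e, False) runs backwards.
\<close>

definition dart_rev :: "'e \<times> bool \<Rightarrow> 'e \<times> bool" where
  "dart_rev d = (fst d, \<not> snd d)"

definition dart_origin :: "('v, 'e) pre_digraph \<Rightarrow> 'e \<times> bool \<Rightarrow> 'v" where
  "dart_origin G d = (if snd d then tail G (fst d) else head G (fst d))"

text \<open>
  In the dual graph, tail is the face on the left of the edge and head the face on its right. Thus
  dart_origin of the dual graph is the face on the left of a dart. The rotation rot sends a dart
  to the next one in counterclockwise order around its origin; the next dart along the face on
  the left of d is obtained by turning clockwise from the reversal of d. The faces are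
  exactly the cycles of this face permutation, and Euler's formula says that the genus is zero.
  The case without edges (one vertex, one face, no darts) is included.
\<close>

locale plane_graph =
  fixes G :: "('v, 'e) pre_digraph"
    and Gd :: "('f, 'e) pre_digraph"
    and rot :: "'e \<times> bool \<Rightarrow> 'e \<times> bool"
  assumes fin_G: "fin_digraph G"
    and fin_Gd: "fin_digraph Gd"
    and conn_G: "connected G"
    and arcs_Gd: "arcs Gd = arcs G"
    and rot_permutes: "rot permutes (arcs G \<times> UNIV)"
    and vertex_cycles: "\<lbrakk>arcs G \<noteq> {}; v \<in> verts G\<rbrakk> \<Longrightarrow>
      cyclic_on rot {d \<in> arcs G \<times> UNIV. dart_origin G d = v}"
    and face_cycles: "\<lbrakk>arcs G \<noteq> {}; u \<in> verts Gd\<rbrakk> \<Longrightarrow>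
      cyclic_on (inv rot \<circ> dart_rev) {d \<in> arcs G \<times> UNIV. dart_origin Gd d = u}"
    and euler: "card (verts G) + card (verts Gd) = card (arcs G) + 2"

text \<open>
  A vertex lies on the boundary of a face iff it is an endpoint of an edge one of whose sides is
  that face, except in the graph without edges.
\<close>

definition incident :: "('v, 'e) pre_digraph \<Rightarrow> ('f, 'e) pre_digraph \<Rightarrow> 'v \<Rightarrow> 'f \<Rightarrow> bool" where
  "incident G Gd v u \<longleftrightarrow> v \<in> verts G \<and> u \<in> verts Gd \<and>
     (arcs G = {} \<or> (\<exists>e\<in>arcs G. v \<in> {tail G e, head G e} \<and> u \<in> {tail Gd e, head Gd e}))"

definition components :: "('v, 'e) pre_digraph \<Rightarrow> 'v set set" where
  "components G = pre_digraph.sccs_verts (with_proj (mk_symmetric G))"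

definition spanning_subgraph :: "('v, 'e) pre_digraph \<Rightarrow> 'e set \<Rightarrow> ('v, 'e) pre_digraph" where
  "spanning_subgraph G A = \<lparr>verts = verts G, arcs = arcs G \<inter> A, tail = tail G, head = head G\<rparr>"

definition component_of :: "('v, 'e) pre_digraph \<Rightarrow> 'v \<Rightarrow> 'v set" where
  "component_of G v = (THE C. C \<in> components G \<and> v \<in> C)"

text \<open>
  Full dual graph of the connected subgraph of G with edge set A and the inherited embedding. Two
  faces of G lie in the same face of the subgraph iff one can pass from one to the other by crossing
  deleted edges only, so a face of the subgraph is a set of faces of G: in the dual, the duals of
  the deleted edges are contracted. When a cluster and its adjacent edges are deleted, the faces along
  each inner boundary of the cluster are thereby identified to one dual vertex.
\<close>

definition subgraph_dual :: "('f, 'e) pre_digraph \<Rightarrow> 'e set \<Rightarrow> ('f set, 'e) pre_digraph" where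
  "subgraph_dual Gd A =
     (let R = spanning_subgraph Gd (- A)
      in \<lparr>verts = components R, arcs = arcs Gd \<inter> A,
          tail = (\<lambda>e. component_of R (tail Gd e)), head = (\<lambda>e. component_of R (head Gd e))\<rparr>)"


section \<open>Currents\<close>

text \<open>A loop is incident twice to its endpoint, hence never contributes to the sources.\<close>

definition sourceless_currents :: "('v, 'e) pre_digraph \<Rightarrow> ('e \<Rightarrow> nat) set" where
  "sourceless_currents G = {n. (\<forall>e. e \<notin> arcs G \<longrightarrow> n e = 0) \<and>
     (\<forall>v\<in>verts G. even ((\<Sum>e\<in>out_arcs G v. n e) + (\<Sum>e\<in>in_arcs G v. n e)))}"

definition current_weight :: "('v, 'e) pre_digraph \<Rightarrow> ('e \<Rightarrow> real) \<Rightarrow> ('e \<Rightarrow> nat) \<Rightarrow> real" where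
  "current_weight G K n = (\<Prod>e\<in>arcs G. K e ^ n e / fact (n e))"

definition random_current :: "('v, 'e) pre_digraph \<Rightarrow> ('e \<Rightarrow> real) \<Rightarrow> ('e \<Rightarrow> nat) pmf" where
  "random_current G K = embed_pmf (\<lambda>n. if n \<in> sourceless_currents G
     then current_weight G K n / (\<Sum>\<^sub>\<infinity>m\<in>sourceless_currents G. current_weight G K m) else 0)"

text \<open>The weights are summable, so the normalisation above is meaningful.\<close>

lemma pmf_random_current:
  fixes K :: "'e \<Rightarrow> real"
  assumes G: "fin_digraph G" and K: "\<And>e. e \<in> arcs G \<Longrightarrow> K e > 0"
  shows "current_weight G K summable_on sourceless_currents G"
    and "(\<Sum>\<^sub>\<infinity>m\<in>sourceless_currents G. current_weight G K m) > 0"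
    and "pmf (random_current G K) n = (if n \<in> sourceless_currents G
      then current_weight G K n / (\<Sum>\<^sub>\<infinity>m\<in>sourceless_currents G. current_weight G K m) else 0)"
proof -
  interpret fin_digraph G by (rule G)
  define S where "S = sourceless_currents G"
  define q where "q = Pi_pmf (arcs G) 0 (\<lambda>e. poisson_pmf (K e))"
  define c where "c = (\<Prod>e\<in>arcs G. exp (K e))"
  have c: "c > 0" unfolding c_def by (intro prod_pos) auto
  have w: "current_weight G K m = c * pmf q m" if "m \<in> S" for m
  proof -
    have "pmf q m = (\<Prod>e\<in>arcs G. pmf (poisson_pmf (K e)) (m e))"
      unfolding q_def using that by (intro pmf_Pi') (auto simp: S_def sourceless_currents_def)
    also have "\<dots> = (\<Prod>e\<in>arcs G. K e ^ m e / fact (m e) * exp (- K e))"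
      by (intro prod.cong refl pmf_poisson K)
    finally have "c * pmf q m = (\<Prod>e\<in>arcs G. exp (K e) * (K e ^ m e / fact (m e) * exp (- K e)))"
      by (simp only: c_def prod.distrib)
    also have "\<dots> = current_weight G K m"
      unfolding current_weight_def by (intro prod.cong refl) (simp add: exp_minus)
    finally show ?thesis by simp
  qed
  have zero: "(\<lambda>_. 0) \<in> S" by (auto simp: S_def sourceless_currents_def)
  have "current_weight G K (\<lambda>_. 0) > 0" by (simp add: current_weight_def)
  with w[OF zero] c have "pmf q (\<lambda>_. 0) > 0" by (simp add: zero_less_mult_iff)
  hence zero_q: "(\<lambda>_. 0) \<in> set_pmf q" by (simp add: set_pmf_iff)
  hence ne: "set_pmf q \<inter> S \<noteq> {}" using zero by auto
  have pos: "measure_pmf.prob q S > 0"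
    using zero_q zero by (auto intro: measure_pmf_posI)
  have sm: "pmf q summable_on S"
    using abs_summable_equivalent[THEN iffD2, OF pmf_abs_summable[of q S]] by simp
  have isum: "infsum (pmf q) S = measure_pmf.prob q S"
    by (simp add: measure_pmf_conv_infsetsum infsetsum_infsum[OF pmf_abs_summable])
  show "current_weight G K summable_on sourceless_currents G"
    using summable_on_cmult_right[OF sm, of c] w
    by (subst summable_on_cong[of _ _ "\<lambda>m. c * pmf q m"]) (auto simp: S_def)
  have Z: "(\<Sum>\<^sub>\<infinity>m\<in>S. current_weight G K m) = c * measure_pmf.prob q S"
    by (subst infsum_cong[of _ _ "\<lambda>m. c * pmf q m"]) (auto simp: w infsum_cmult_right' isum)
  show "(\<Sum>\<^sub>\<infinity>m\<in>sourceless_currents G. current_weight G K m) > 0"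
    using Z c pos by (simp add: S_def)
  have eq: "(\<lambda>n. if n \<in> S then current_weight G K n / (\<Sum>\<^sub>\<infinity>m\<in>S. current_weight G K m) else 0)
      = pmf (cond_pmf q S)"
    using c by (intro ext) (simp add: pmf_cond[OF ne] Z w)
  have "random_current G K = cond_pmf q S"
    unfolding random_current_def S_def[symmetric] eq
    by (rule type_definition.Rep_inverse[OF td_pmf_embed_pmf])
  thus "pmf (random_current G K) n = (if n \<in> sourceless_currents G
      then current_weight G K n / (\<Sum>\<^sub>\<infinity>m\<in>sourceless_currents G. current_weight G K m) else 0)"
    using fun_cong[OF eq, of n] unfolding S_def[symmetric] by simp
qed

definition double_random_current :: "('v, 'e) pre_digraph \<Rightarrow> ('e \<Rightarrow> real) \<Rightarrow> ('e \<Rightarrow> nat) pmf" where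
  "double_random_current G K =
     map_pmf (\<lambda>(n1, n2) e. n1 e + n2 e) (pair_pmf (random_current G K) (random_current G K))"

definition clusters :: "('v, 'e) pre_digraph \<Rightarrow> ('e \<Rightarrow> nat) \<Rightarrow> 'v set set" where
  "clusters G n = components (spanning_subgraph G {e. n e > 0})"

definition cluster_of :: "('v, 'e) pre_digraph \<Rightarrow> ('e \<Rightarrow> nat) \<Rightarrow> 'v \<Rightarrow> 'v set" where
  "cluster_of G n v = component_of (spanning_subgraph G {e. n e > 0}) v"

definition odd_part :: "('v, 'e) pre_digraph \<Rightarrow> ('e \<Rightarrow> nat) \<Rightarrow> 'e set" where
  "odd_part G n = {e \<in> arcs G. odd (n e)}"

text \<open>I.i.d. uniform signs on the clusters of a current; the value outside the clusters is 0.\<close>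

definition cluster_signs :: "('v, 'e) pre_digraph \<Rightarrow> ('e \<Rightarrow> nat) \<Rightarrow> ('v set \<Rightarrow> real) pmf" where
  "cluster_signs G n = Pi_pmf (clusters G n) 0 (\<lambda>_. pmf_of_set {-1, 1})"

definition signed_double_random_current ::
  "('v, 'e) pre_digraph \<Rightarrow> ('e \<Rightarrow> real) \<Rightarrow> (('e \<Rightarrow> nat) \<times> ('v set \<Rightarrow> real)) pmf" where
  "signed_double_random_current G K =
     do {n \<leftarrow> double_random_current G K; s \<leftarrow> cluster_signs G n; return_pmf (n, s)}"

text \<open>Edges of G whose two sides belong to clusters of nd with different spins.\<close>

definition interfaces :: "('f, 'e) pre_digraph \<Rightarrow> ('e \<Rightarrow> nat) \<Rightarrow> ('f set \<Rightarrow> real) \<Rightarrow> 'e set" where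
  "interfaces Gd nd s =
     {e \<in> arcs Gd. s (cluster_of Gd nd (tail Gd e)) \<noteq> s (cluster_of Gd nd (head Gd e))}"


section \<open>Nesting fields\<close>

text \<open>
  The notions below apply to a current on G whose faces are the vertices of Gd, u0 being the
  unbounded face. They are used for (G, Gd) and, with the faces of the dual graph identified with
  the vertices of G, for (Gd, G). In the second case the dual is drawn together with G: its vertex
  g lies in the unbounded face of G, so the unbounded face of the dual is a vertex of G
  on the boundary of g. Which one depends on the drawing.
\<close>

definition face_spins :: "('f, 'e) pre_digraph \<Rightarrow> 'f \<Rightarrow> 'e set \<Rightarrow> 'f \<Rightarrow> real" where
  "face_spins Gd u0 A = (THE s. s \<in> verts Gd \<rightarrow>\<^sub>E {-1, 1} \<and> s u0 = 1 \<and>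
     (\<forall>e\<in>arcs Gd. s (head Gd e) = (if e \<in> A then - s (tail Gd e) else s (tail Gd e))))"

definition odd_around ::
  "('v, 'e) pre_digraph \<Rightarrow> ('f, 'e) pre_digraph \<Rightarrow> 'f \<Rightarrow> ('e \<Rightarrow> nat) \<Rightarrow> 'v set \<Rightarrow> 'f \<Rightarrow> bool" where
  "odd_around G Gd u0 n C u \<longleftrightarrow>
     face_spins Gd u0 {e \<in> odd_part G n. tail G e \<in> C \<and> head G e \<in> C} u = -1"

definition free_nesting_field ::
  "('v, 'e) pre_digraph \<Rightarrow> ('f, 'e) pre_digraph \<Rightarrow> 'f \<Rightarrow> ('e \<Rightarrow> nat) \<Rightarrow> ('v set \<Rightarrow> real) \<Rightarrow> 'f \<Rightarrow> real"
  where
  "free_nesting_field G Gd u0 n eps u = (\<Sum>C\<in>clusters G n. of_bool (odd_around G Gd u0 n C u) * eps C)"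

definition wired_nesting_field ::
  "('v, 'e) pre_digraph \<Rightarrow> ('f, 'e) pre_digraph \<Rightarrow> 'v \<Rightarrow> 'f \<Rightarrow> ('e \<Rightarrow> nat) \<Rightarrow> ('v set \<Rightarrow> real) \<Rightarrow> 'f \<Rightarrow> real"
  where
  "wired_nesting_field G Gd g u0 n eps u =
     (let Cg = cluster_of G n g in
       (of_bool (odd_around G Gd u0 n Cg u) - 1/2) * eps Cg +
       (\<Sum>C\<in>clusters G n - {Cg}. of_bool (odd_around G Gd u0 n C u) * eps C))"

definition free_nesting_law ::
  "('v, 'e) pre_digraph \<Rightarrow> ('f, 'e) pre_digraph \<Rightarrow> 'f \<Rightarrow> ('e \<Rightarrow> real) \<Rightarrow> ('f \<Rightarrow> real) pmf" where
  "free_nesting_law G Gd u0 K = map_pmf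
     (\<lambda>(n, eps). restrict (free_nesting_field G Gd u0 n eps) (verts Gd))
     (signed_double_random_current G K)"

definition wired_nesting_law ::
  "('v, 'e) pre_digraph \<Rightarrow> ('f, 'e) pre_digraph \<Rightarrow> 'v \<Rightarrow> 'f \<Rightarrow> ('e \<Rightarrow> real) \<Rightarrow> ('f \<Rightarrow> real) pmf" where
  "wired_nesting_law G Gd g u0 K = map_pmf
     (\<lambda>(n, eps). restrict (wired_nesting_field G Gd g u0 n eps) (verts Gd))
     (signed_double_random_current G K)"


section \<open>Exploration of a cluster\<close>

text \<open>
  Let q be the joint law of a current n on G and a current nd on the dual graph. The exploration of
  a cluster C of n reveals n on a set F of edges containing all edges adjacent to C and no edge of
  the component W of the complement of C; the conclusion is asserted for every such F, so it
  does not depend on what else was explored outside W. Currents are discrete, so conditioning is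
  on the possible outcomes of the exploration. The component of the boundary is the one
  containing the set B of all boundary vertices.
\<close>

definition wired_in_holes ::
  "('v, 'e) pre_digraph \<Rightarrow> ('f, 'e) pre_digraph \<Rightarrow> 'v set \<Rightarrow> ('e \<Rightarrow> real) \<Rightarrow>
   (('e \<Rightarrow> nat) \<times> ('e \<Rightarrow> nat)) pmf \<Rightarrow> bool" where
  "wired_in_holes G Gd B Kd q \<longleftrightarrow>
     (\<forall>C W F m. let A = {(n, nd). C \<in> clusters G n \<and> (\<forall>e\<in>F. n e = m e)}; E = arcs (G \<restriction> W) in
        W \<in> components (G \<restriction> (verts G - C)) \<longrightarrow> \<not> B \<subseteq> W \<longrightarrow>
        {e \<in> arcs G. tail G e \<in> C \<or> head G e \<in> C} \<subseteq> F \<longrightarrow> F \<subseteq> arcs G - E \<longrightarrow>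
        set_pmf q \<inter> A \<noteq> {} \<longrightarrow>
        map_pmf (\<lambda>(n, nd) e. if e \<in> E then nd e else 0) (cond_pmf q A) =
          double_random_current (subgraph_dual Gd E) Kd)"

end

theory Submission
  imports Defs
begin

text \<open>
  The coupling is local. Record the spins of the clusters of a current \<open>n\<close> by the set \<open>X\<close> of vertices
  with spin -1; this is a set of vertices whose cut avoids the support of \<open>n\<close>. A double random current
  with independent uniform cluster spins then has density proportional to the product over the edges
  of \<open>(2 K e) ^ n e / fact (n e)\<close>, restricted to the pairs in which \<open>n\<close> is sourceless and vanishes on the
  cut of \<open>X\<close> (\<open>pmf_region_law\<close>). Indeed the number of ways to split \<open>n\<close> into two sourceless currents is,
  after expanding the constraint into the characters \<open>A \<mapsto> (-1) ^ card (A \<inter> edge_cut G X)\<close>, a sum over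
  \<open>X\<close> in which only the sets cut by no edge of \<open>n\<close> survive, each with weight \<open>2 ^ (\<Sum> n e)\<close>.

  In a plane graph the sourceless currents are those whose odd part is a cut of the dual graph, that
  is, the interface of a dual spin configuration, which is unique up to a global flip. This is the
  content of the locale \<open>dual_pair\<close>; the inclusion of cuts in the cycle space is read off from the
  rotation system, and equality follows by counting with Euler's formula. So one may look for a joint
  law of \<open>(n, X)\<close> on the graph and \<open>(nd, Y)\<close> on the dual in which the odd part of \<open>n\<close> is the cut of \<open>Y\<close>,
  the odd part of \<open>nd\<close> is the cut of \<open>X\<close>, and everything else is a product of the edge weights
  \<open>pair_weight\<close>. These weights vanish unless one of \<open>n e\<close>, \<open>nd e\<close> is zero, and the duality relation
  \<open>sinh (2 K) * sinh (2 Kd) = 1\<close> with its companions makes them symmetric up to a constant and gives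
  total weight one to the values of \<open>nd e\<close> of prescribed parity when \<open>n e = 0\<close>. The
  law is constructed by sampling \<open>nd\<close> edge by edge given \<open>(n, X)\<close>, so that its first marginal is right by
  definition; the density computed in \<open>pmf_master_law\<close> is symmetric, so the construction started from
  the dual graph yields the same law (\<open>master_law_dual\<close>) and the second marginal is right as well.

  The same mechanism explains the spatial Markov property. If \<open>C\<close> is a cluster of \<open>n\<close> and \<open>W\<close> a component
  of its complement, \<open>n\<close> vanishes on the edges between \<open>C\<close> and \<open>W\<close>, where the weight of \<open>(n, X)\<close> is one
  whatever \<open>X\<close> is. Hence \<open>(n, X)\<close> inside \<open>W\<close> is independent of the outside and distributed as for the
  graph induced on \<open>W\<close> (\<open>region_law_restricted\<close>). This graph and the contracted dual again form
  a dual pair, so sampling the dual edges inside \<open>W\<close> produces the dual double random current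
  (\<open>wired_in_holes_master_law\<close>).

  For the heights, give the cluster \<open>C\<close> the label \<open>- tau_C * taud_u * s_C u\<close>, where \<open>s_C\<close> is the spin on
  faces whose interface is the odd part of \<open>n\<close> in \<open>C\<close>, and \<open>u\<close> is a face touching \<open>C\<close>. Along the faces that
  touch \<open>C\<close>, both \<open>taud\<close> and \<open>s_C\<close> flip exactly across the odd edges of \<open>C\<close>, so the label does not depend
  on \<open>u\<close>; and it arises from the independent fair sign \<open>tau_C\<close> by multiplication with a sign that depends
  on \<open>n\<close> and \<open>Y\<close> only, so the labels are again independent fair signs. Across an odd edge the
  nesting field with these labels changes by exactly \<open>1/2 * tau_v * (taud_u' - taud_u)\<close>
  (\<open>nesting_gradient\<close>), which is the prescribed gradient of the height function. Applied to the dual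
  pair, the same computation identifies the heights on the vertices with the wired nesting field.
\<close>


section \<open>Cuts, components and even edge sets\<close>

definition edge_cut :: "('v, 'e) pre_digraph \<Rightarrow> 'v set \<Rightarrow> 'e set" where
  "edge_cut G X = {e \<in> arcs G. (tail G e \<in> X) \<noteq> (head G e \<in> X)}"

lemma edge_cut_empty [simp]: "edge_cut G {} = {}"
  by (simp add: edge_cut_def)

lemma edge_cut_subset: "edge_cut G X \<subseteq> arcs G"
  by (auto simp: edge_cut_def)

lemma finite_edge_cut: "fin_digraph G \<Longrightarrow> finite (edge_cut G X)"
  by (rule finite_subset[OF edge_cut_subset fin_digraph.finite_arcs])

lemma edge_cut_sym_diff: "edge_cut G (sym_diff X Y) = sym_diff (edge_cut G X) (edge_cut G Y)"
  by (auto simp: edge_cut_def)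

lemma edge_cut_compl: "fin_digraph G \<Longrightarrow> edge_cut G (verts G - X) = edge_cut G X"
proof -
  assume "fin_digraph G"
  then interpret fin_digraph G .
  show ?thesis by (auto simp: edge_cut_def)
qed

lemma edge_cut_verts [simp]: "fin_digraph G \<Longrightarrow> edge_cut G (verts G) = {}"
  using edge_cut_compl[of G "{}"] by simp

lemma edge_cut_Int_verts: "fin_digraph G \<Longrightarrow> edge_cut G (X \<inter> verts G) = edge_cut G X"
proof -
  assume "fin_digraph G"
  then interpret fin_digraph G .
  show ?thesis by (auto simp: edge_cut_def)
qed

context fin_digraph
begin

interpretation S: pair_fin_digraph "mk_symmetric G" ..

lemma edge_cut_component:
  assumes C: "C \<in> components G" shows "edge_cut G C = {}"
proof -
  have "head G e \<in> C \<longleftrightarrow> tail G e \<in> C" if e: "e \<in> arcs G" for e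
  proof -
    have "tail G e \<rightarrow>\<^sup>*\<^bsub>with_proj (mk_symmetric G)\<^esub> head G e"
         "head G e \<rightarrow>\<^sup>*\<^bsub>with_proj (mk_symmetric G)\<^esub> tail G e"
      using e by (auto intro!: S.reachable_adjI simp: parcs_mk_symmetric)
    thus ?thesis using C unfolding components_def S.in_sccs_verts_conv_reachable by blast
  qed
  thus ?thesis by (auto simp: edge_cut_def)
qed

text \<open>
  Components are the atoms among the vertex sets with empty cut. Everything below uses components
  through this description, which is insensitive to the choice of walks.
\<close>

lemma component_subset_closed:
  assumes C: "C \<in> components G" and X: "edge_cut G X = {}" and x: "x \<in> C" "x \<in> X"
  shows "C \<subseteq> X"
proof
  fix y assume "y \<in> C"
  hence "x \<rightarrow>\<^sup>*\<^bsub>with_proj (mk_symmetric G)\<^esub> y"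
    using C x unfolding components_def S.in_sccs_verts_conv_reachable by blast
  thus "y \<in> X" using \<open>x \<in> X\<close>
  proof (induction rule: S.reachable_induct)
    case (step u v)
    thus ?case using X by (auto simp: parcs_mk_symmetric edge_cut_def)
  qed auto
qed

lemma component_nonempty: "C \<in> components G \<Longrightarrow> C \<noteq> {}"
  unfolding components_def S.in_sccs_verts_conv_reachable by blast

lemma component_subset: "C \<in> components G \<Longrightarrow> C \<subseteq> verts G"
  unfolding components_def using S.sccs_verts_subsets by auto

lemma finite_components: "finite (components G)"
  unfolding components_def using S.finite_sccs_verts by simp

lemma component_exists:
  assumes "v \<in> verts G" obtains C where "C \<in> components G" "v \<in> C"
proof
  show "S.scc_of v \<in> components G"
    unfolding components_def using assms by (intro S.scc_of_in_sccs_verts) simp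
  show "v \<in> S.scc_of v" using assms by (auto simp: S.scc_of_def)
qed

lemma component_unique:
  assumes "C \<in> components G" "D \<in> components G" "v \<in> C" "v \<in> D" shows "C = D"
  using component_subset_closed[OF assms(1) edge_cut_component[OF assms(2)]]
    component_subset_closed[OF assms(2) edge_cut_component[OF assms(1)]] assms by blast

lemma componentsI:
  assumes "C \<noteq> {}" "C \<subseteq> verts G" "edge_cut G C = {}"
    "\<And>X. X \<subseteq> C \<Longrightarrow> X \<noteq> {} \<Longrightarrow> edge_cut G X = {} \<Longrightarrow> X = C"
  shows "C \<in> components G"
proof -
  obtain v where v: "v \<in> C" using assms by auto
  then obtain D where D: "D \<in> components G" "v \<in> D"
    using component_exists assms(2) by blast
  have "D = C" using component_subset_closed[OF D(1) assms(3) D(2) v] D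
    by (intro assms(4) component_nonempty edge_cut_component)
  thus ?thesis using D by simp
qed

lemma component_of_eq: "C \<in> components G \<Longrightarrow> v \<in> C \<Longrightarrow> component_of G v = C"
  unfolding component_of_def using component_unique by (intro the_equality) auto

lemma component_of_component: "v \<in> verts G \<Longrightarrow> component_of G v \<in> components G"
  and component_of_self: "v \<in> verts G \<Longrightarrow> v \<in> component_of G v"
  using component_exists component_of_eq by metis+

lemma closed_eq_Union:
  assumes "X \<subseteq> verts G" "edge_cut G X = {}"
  shows "\<Union>{C \<in> components G. C \<subseteq> X} = X"
proof
  show "X \<subseteq> \<Union>{C \<in> components G. C \<subseteq> X}"
  proof
    fix v assume v: "v \<in> X"
    with assms(1) obtain C where C: "C \<in> components G" "v \<in> C" using component_exists by blast
    thus "v \<in> \<Union>{C \<in> components G. C \<subseteq> X}"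
      using component_subset_closed[OF C(1) assms(2) C(2) v] by auto
  qed
qed auto

lemma component_subset_Union_iff:
  assumes "Z \<subseteq> components G" "C \<in> components G"
  shows "C \<subseteq> \<Union>Z \<longleftrightarrow> C \<in> Z"
proof
  assume "C \<subseteq> \<Union>Z"
  moreover obtain v where v: "v \<in> C" using component_nonempty assms(2) by blast
  ultimately obtain D where "D \<in> Z" "v \<in> D" by auto
  thus "C \<in> Z" using component_unique[OF assms(2) _ v] assms(1) by blast
qed auto

lemma edge_cut_Union_components:
  assumes "Z \<subseteq> components G" shows "edge_cut G (\<Union>Z) = {}"
proof -
  have "head G e \<in> C \<longleftrightarrow> tail G e \<in> C" if "e \<in> arcs G" "C \<in> Z" for e C
    using edge_cut_component[of C] that assms by (auto simp: edge_cut_def)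
  thus ?thesis by (auto simp: edge_cut_def)
qed

lemma connected_closed:
  assumes "connected G" "X \<subseteq> verts G" "edge_cut G X = {}"
  shows "X = {} \<or> X = verts G"
proof -
  have "verts G \<in> components G"
    using assms(1) unfolding components_def S.in_sccs_verts_conv_reachable connected_def
      strongly_connected_def
    by (auto dest: S.reachable_in_verts)
  thus ?thesis using component_subset_closed[of "verts G" X] assms by blast
qed

end

lemma (in fin_digraph) connectedI:
  assumes "verts G \<noteq> {}" and "\<And>X. X \<subseteq> verts G \<Longrightarrow> edge_cut G X = {} \<Longrightarrow> X \<noteq> {} \<Longrightarrow> X = verts G"
  shows "connected G"
proof -
  have "verts G \<in> components G"
    using assms by (intro componentsI) (auto simp: fin_digraph_axioms)
  thus ?thesis
    unfolding components_def connected_def strongly_connected_def pre_digraph.sccs_verts_def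
    by auto
qed

lemma connected_verts_nonempty: "connected G \<Longrightarrow> verts G \<noteq> {}"
  by (auto simp: connected_def strongly_connected_def)

text \<open>
  The cycle space of the graph over the field with two elements, written as the orthogonal complement
  of the cut space. In this form the condition has a Fourier expansion over the vertex sets
  (\<open>sum_cut_signs\<close>).
\<close>

definition even_set :: "('v, 'e) pre_digraph \<Rightarrow> 'e set \<Rightarrow> bool" where
  "even_set G A \<longleftrightarrow> (\<forall>X\<subseteq>verts G. even (card (A \<inter> edge_cut G X)))"

lemma even_card_sym_diff:
  assumes "finite A" "finite B"
  shows "even (card (sym_diff A B)) \<longleftrightarrow> (even (card A) \<longleftrightarrow> even (card B))"
proof -
  have "card (sym_diff A B) = card (A - B) + card (B - A)"
    using assms by (intro card_Un_disjoint) auto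
  moreover have "card A = card (A \<inter> B) + card (A - B)" "card B = card (A \<inter> B) + card (B - A)"
    using card_Int_Diff[OF assms(1), of B] card_Int_Diff[OF assms(2), of A] by (simp_all add: Int_commute)
  ultimately show ?thesis by (simp only: even_add) blast
qed

lemma even_card_Int_edge_cut_sym_diff:
  assumes "finite A"
  shows "even (card (A \<inter> edge_cut G (sym_diff X Y))) \<longleftrightarrow>
    (even (card (A \<inter> edge_cut G X)) \<longleftrightarrow> even (card (A \<inter> edge_cut G Y)))"
proof -
  have "A \<inter> edge_cut G (sym_diff X Y) = sym_diff (A \<inter> edge_cut G X) (A \<inter> edge_cut G Y)"
    by (auto simp: edge_cut_sym_diff)
  thus ?thesis using assms by (simp add: even_card_sym_diff)
qed

text \<open>
  The cut of a set is the symmetric difference of the stars of its elements, so orthogonality to the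
  stars suffices.
\<close>

lemma even_set_iff_stars:
  assumes G: "fin_digraph G" and A: "finite A"
  shows "even_set G A \<longleftrightarrow> (\<forall>v\<in>verts G. even (card (A \<inter> edge_cut G {v})))"
proof
  assume stars: "\<forall>v\<in>verts G. even (card (A \<inter> edge_cut G {v}))"
  show "even_set G A"
    unfolding even_set_def
  proof (intro allI impI)
    fix X assume "X \<subseteq> verts G"
    hence "finite X" using fin_digraph.finite_verts[OF G] finite_subset by blast
    thus "even (card (A \<inter> edge_cut G X))" using \<open>X \<subseteq> verts G\<close>
    proof (induction X)
      case (insert v X)
      have "insert v X = sym_diff X {v}" using insert.hyps by auto
      thus ?case using insert stars by (simp only: even_card_Int_edge_cut_sym_diff[OF A]) auto
    qed simp
  qed
qed (auto simp: even_set_def)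

lemma even_set_sym_diff:
  assumes "finite A" "finite B" "even_set G A" "even_set G B"
  shows "even_set G (sym_diff A B)"
  unfolding even_set_def
proof (intro allI impI)
  fix X assume "X \<subseteq> verts G"
  moreover have "sym_diff A B \<inter> edge_cut G X = sym_diff (A \<inter> edge_cut G X) (B \<inter> edge_cut G X)"
    by auto
  ultimately show "even (card (sym_diff A B \<inter> edge_cut G X))"
    using assms by (simp add: even_card_sym_diff even_set_def)
qed

text \<open>
  Orthogonality of characters: \<open>X \<mapsto> (-1) ^ card (A \<inter> edge_cut G X)\<close> is multiplicative for the symmetric
  difference, and a nontrivial character sums to zero because translating by a set where it is -1
  reverses the sign of the sum.
\<close>

lemma sum_cut_signs:
  assumes G: "fin_digraph G" and A: "finite A"
  shows "(\<Sum>X\<in>Pow (verts G). (-1) ^ card (A \<inter> edge_cut G X)) =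
    (if even_set G A then 2 ^ card (verts G) else (0::real))"
proof (cases "even_set G A")
  case True
  thus ?thesis using fin_digraph.finite_verts[OF G]
    by (simp add: even_set_def card_Pow)
next
  case False
  then obtain Y where Y: "Y \<subseteq> verts G" "odd (card (A \<inter> edge_cut G Y))"
    by (auto simp: even_set_def)
  let ?f = "\<lambda>X. (-1) ^ card (A \<inter> edge_cut G X) :: real"
  have "?f (sym_diff X Y) = - ?f X" for X
    using Y even_card_Int_edge_cut_sym_diff[OF A, of G X Y]
    by (cases "even (card (A \<inter> edge_cut G X))") auto
  moreover have "sym_diff (sym_diff X Y) Y = X" for X by auto
  moreover have "(\<Sum>X\<in>Pow (verts G). ?f X) = (\<Sum>X\<in>Pow (verts G). ?f (sym_diff X Y))"
    using Y(1) calculation(2)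
    by (intro sum.reindex_bij_witness[of _ "\<lambda>X. sym_diff X Y" "\<lambda>X. sym_diff X Y"]) auto
  ultimately show ?thesis using False by (simp add: sum_negf)
qed

lemma closed_sets_connected:
  assumes "fin_digraph G" "connected G"
  shows "{X. X \<subseteq> verts G \<and> edge_cut G X = {}} = {{}, verts G}"
  using fin_digraph.connected_closed[OF assms] assms(1) by auto

lemma sourceless_iff_even:
  assumes G: "fin_digraph G"
  shows "n \<in> sourceless_currents G \<longleftrightarrow>
    (\<forall>e. e \<notin> arcs G \<longrightarrow> n e = 0) \<and> even_set G (odd_part G n)"
proof -
  interpret fin_digraph G by (rule G)
  have "even ((\<Sum>e\<in>out_arcs G v. n e) + (\<Sum>e\<in>in_arcs G v. n e)) \<longleftrightarrow>
    even (card (odd_part G n \<inter> edge_cut G {v}))" for v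
  proof -
    let ?O = "{e \<in> out_arcs G v. odd (n e)}" and ?I = "{e \<in> in_arcs G v. odd (n e)}"
    have fin: "finite (out_arcs G v)" "finite (in_arcs G v)"
      by (auto intro: finite_subset[OF _ finite_arcs])
    have "odd_part G n \<inter> edge_cut G {v} = sym_diff ?O ?I"
      by (auto simp: odd_part_def edge_cut_def)
    thus ?thesis using fin by (simp add: even_card_sym_diff even_sum_iff)
  qed
  moreover have "finite (odd_part G n)" by (simp add: odd_part_def)
  ultimately show ?thesis
    by (simp add: sourceless_currents_def even_set_iff_stars[OF G])
qed

lemma prod_cut_signs:
  assumes "fin_digraph G"
  shows "(\<Prod>e\<in>arcs G. (if e \<in> edge_cut G X then -1 else 1) ^ n e) =
    ((-1) ^ card (odd_part G n \<inter> edge_cut G X) :: real)"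
proof -
  interpret fin_digraph G by (rule assms)
  have "(\<Prod>e\<in>arcs G. (if e \<in> edge_cut G X then -1 else 1) ^ n e) =
    (\<Prod>e\<in>arcs G. if e \<in> odd_part G n \<inter> edge_cut G X then -1 else (1::real))"
    by (intro prod.cong) (auto simp: odd_part_def)
  also have "\<dots> = (\<Prod>e\<in>odd_part G n \<inter> edge_cut G X. -1)"
    by (rule prod.mono_neutral_cong_right) (auto simp: edge_cut_def)
  finally show ?thesis by simp
qed


section \<open>The density of a double random current with cluster spins\<close>

lemma sum_PiE_dflt_prod:
  fixes f :: "'a \<Rightarrow> 'b \<Rightarrow> real"
  assumes "finite A" "\<And>x. x \<in> A \<Longrightarrow> finite (B x)"
  shows "(\<Sum>g\<in>PiE_dflt A d B. \<Prod>x\<in>A. f x (g x)) = (\<Prod>x\<in>A. \<Sum>y\<in>B x. f x y)"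
proof -
  have "(\<Sum>g\<in>PiE_dflt A d B. \<Prod>x\<in>A. f x (g x)) = (\<Sum>g\<in>PiE A B. \<Prod>x\<in>A. f x (g x))"
    by (rule sum.reindex_bij_witness[of _ "\<lambda>g x. if x \<in> A then g x else d" "\<lambda>g. restrict g A"])
       (auto simp: PiE_dflt_def fun_eq_iff PiE_def extensional_def intro!: prod.cong)
  thus ?thesis using assms by (simp add: prod_sum_PiE)
qed

text \<open>
  The factor 2 is the total weight of the two ways to assign one unit of current on an edge to one
  of the two summands.
\<close>

definition double_weight :: "('v, 'e) pre_digraph \<Rightarrow> ('e \<Rightarrow> real) \<Rightarrow> ('e \<Rightarrow> nat) \<Rightarrow> real" where
  "double_weight G K n = (\<Prod>e\<in>arcs G. (2 * K e) ^ n e / fact (n e))"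

text \<open>
  The unions of clusters of \<open>n\<close>. Assigning a spin to every cluster amounts to choosing such a union,
  the set of vertices with spin -1.
\<close>

definition cluster_regions :: "('v, 'e) pre_digraph \<Rightarrow> ('e \<Rightarrow> nat) \<Rightarrow> 'v set set" where
  "cluster_regions G n = {X. X \<subseteq> verts G \<and> (\<forall>e\<in>edge_cut G X. n e = 0)}"

text \<open>
  Given the sum \<open>n\<close>, the product of the two weights is that of \<open>n\<close> times binomial coefficients. Once the
  constraint on the first summand is expanded into characters, the sum over splittings factorises over
  the edges by the binomial theorem: an edge contributes \<open>2 ^ n e\<close> if it does not cross the cut of \<open>X\<close>,
  and \<open>0 ^ n e\<close> if it does.
\<close>

lemma sum_splittings:
  assumes G: "fin_digraph G" and n: "\<And>e. e \<notin> arcs G \<Longrightarrow> n e = 0"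
  shows "(\<Sum>n1\<in>PiE_dflt (arcs G) 0 (\<lambda>e. {..n e}). of_bool (even_set G (odd_part G n1)) *
      (current_weight G K n1 * current_weight G K (\<lambda>e. n e - n1 e))) =
    double_weight G K n * card (cluster_regions G n) / 2 ^ card (verts G)"
proof -
  interpret fin_digraph G by (rule G)
  let ?D = "PiE_dflt (arcs G) 0 (\<lambda>e. {..n e})"
  let ?s = "\<lambda>X e. if e \<in> edge_cut G X then -1 else (1::real)"
  let ?w = "\<Prod>e\<in>arcs G. K e ^ n e / fact (n e)"
  have binom: "current_weight G K n1 * current_weight G K (\<lambda>e. n e - n1 e) =
      ?w * (\<Prod>e\<in>arcs G. real (n e choose n1 e))" if "n1 \<in> ?D" for n1
    unfolding current_weight_def prod.distrib[symmetric]
  proof (intro prod.cong refl)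
    fix e assume e: "e \<in> arcs G"
    hence le: "n1 e \<le> n e" using that by (auto simp: PiE_dflt_def)
    have "K e ^ n e = K e ^ n1 e * K e ^ (n e - n1 e)"
      using le by (simp flip: power_add)
    thus "K e ^ n1 e / fact (n1 e) * (K e ^ (n e - n1 e) / fact (n e - n1 e)) =
        K e ^ n e / fact (n e) * real (n e choose n1 e)"
      using le by (simp add: binomial_fact)
  qed
  have ind: "of_bool (even_set G (odd_part G n1)) =
      (\<Sum>X\<in>Pow (verts G). \<Prod>e\<in>arcs G. ?s X e ^ n1 e) / 2 ^ card (verts G)" for n1
    by (simp add: prod_cut_signs[OF G] sum_cut_signs[OF G] odd_part_def)
  have total: "(\<Sum>n1\<in>?D. \<Prod>e\<in>arcs G. ?s X e ^ n1 e * real (n e choose n1 e)) =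
      2 ^ (\<Sum>e\<in>arcs G. n e) * of_bool (X \<in> cluster_regions G n)" if XV: "X \<subseteq> verts G" for X
  proof -
    have "(\<Sum>n1\<in>?D. \<Prod>e\<in>arcs G. ?s X e ^ n1 e * real (n e choose n1 e)) =
        (\<Prod>e\<in>arcs G. \<Sum>k\<le>n e. ?s X e ^ k * real (n e choose k))"
      by (rule sum_PiE_dflt_prod) auto
    also have "\<dots> = (\<Prod>e\<in>arcs G. (?s X e + 1) ^ n e)"
      by (intro prod.cong refl) (simp add: binomial_ring mult.commute)
    also have "\<dots> = (\<Prod>e\<in>arcs G. 2 ^ n e * of_bool (e \<in> edge_cut G X \<longrightarrow> n e = 0))"
      by (intro prod.cong refl) auto
    also have "\<dots> = 2 ^ (\<Sum>e\<in>arcs G. n e) * (\<Prod>e\<in>arcs G. of_bool (e \<in> edge_cut G X \<longrightarrow> n e = 0))"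
      by (simp add: prod.distrib power_sum)
    also have "(\<Prod>e\<in>arcs G. of_bool (e \<in> edge_cut G X \<longrightarrow> n e = 0) :: real) =
        of_bool (X \<in> cluster_regions G n)"
    proof (cases "X \<in> cluster_regions G n")
      case False
      then obtain e where "e \<in> edge_cut G X" "n e \<noteq> 0" "e \<in> arcs G"
        using XV edge_cut_subset[of G X] by (auto simp: cluster_regions_def)
      hence "(\<Prod>e\<in>arcs G. of_bool (e \<in> edge_cut G X \<longrightarrow> n e = 0) :: real) = 0"
        by (intro prod_zero) auto
      thus ?thesis using False by simp
    qed (auto simp: cluster_regions_def)
    finally show ?thesis .
  qed
  have dw: "double_weight G K n = ?w * 2 ^ (\<Sum>e\<in>arcs G. n e)"
    by (simp add: double_weight_def power_sum power_mult_distrib mult.commute flip: prod.distrib)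
  have "(\<Sum>n1\<in>?D. of_bool (even_set G (odd_part G n1)) *
        (current_weight G K n1 * current_weight G K (\<lambda>e. n e - n1 e))) =
      (\<Sum>n1\<in>?D. \<Sum>X\<in>Pow (verts G).
        ?w / 2 ^ card (verts G) * (\<Prod>e\<in>arcs G. ?s X e ^ n1 e * real (n e choose n1 e)))"
    by (intro sum.cong refl)
       (simp add: binom ind prod.distrib sum_distrib_left sum_distrib_right mult_ac sum_divide_distrib
          divide_inverse)
  also have "\<dots> = (\<Sum>X\<in>Pow (verts G). ?w / 2 ^ card (verts G) *
      (\<Sum>n1\<in>?D. \<Prod>e\<in>arcs G. ?s X e ^ n1 e * real (n e choose n1 e)))"
    by (subst sum.swap) (simp add: sum_distrib_left)
  also have "\<dots> = (\<Sum>X\<in>Pow (verts G). double_weight G K n / 2 ^ card (verts G) *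
      of_bool (X \<in> cluster_regions G n))"
    by (intro sum.cong refl) (simp add: total dw)
  also have "\<dots> = double_weight G K n / 2 ^ card (verts G) *
      (\<Sum>X\<in>Pow (verts G). of_bool (X \<in> cluster_regions G n))"
    by (rule sum_distrib_left[symmetric])
  also have "(\<Sum>X\<in>Pow (verts G). of_bool (X \<in> cluster_regions G n) :: real) = card (cluster_regions G n)"
    by (subst sum_of_bool_eq) (auto simp: cluster_regions_def intro!: arg_cong[of _ _ card])
  finally show ?thesis by simp
qed

text \<open>
  A sum of two sourceless currents is sourceless, and if the sum and one summand are sourceless, so is
  the other. Hence only the constraint on the first summand remains, which \<open>sum_splittings\<close> evaluates.
\<close>

lemma pmf_double_random_current:
  assumes G: "fin_digraph G" and K: "\<And>e. e \<in> arcs G \<Longrightarrow> K e > 0"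
  obtains c where "c > 0" and "\<And>n. pmf (double_random_current G K) n =
    c * (of_bool (n \<in> sourceless_currents G) * double_weight G K n * card (cluster_regions G n))"
proof
  interpret fin_digraph G by (rule G)
  define Z where "Z = (\<Sum>\<^sub>\<infinity>m\<in>sourceless_currents G. current_weight G K m)"
  have Z: "Z > 0" unfolding Z_def by (rule pmf_random_current(2)[OF G K])
  have r: "pmf (random_current G K) n =
      of_bool (n \<in> sourceless_currents G) * current_weight G K n / Z" for n
    by (simp add: pmf_random_current(3)[OF G K] Z_def)
  \<comment> \<open>two normalising constants and the number of characters\<close>
  show "1 / (Z\<^sup>2 * 2 ^ card (verts G)) > 0" using Z by simp
  show "pmf (double_random_current G K) n = 1 / (Z\<^sup>2 * 2 ^ card (verts G)) *
    (of_bool (n \<in> sourceless_currents G) * double_weight G K n * card (cluster_regions G n))" for n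
  proof -
    let ?q = "pair_pmf (random_current G K) (random_current G K)"
    let ?f = "\<lambda>(n1, n2) e. n1 e + n2 e :: nat"
    have supp: "set_pmf (random_current G K) \<subseteq> sourceless_currents G"
      by (auto simp: set_pmf_iff r)
    have add: "(\<lambda>e. n1 e + n2 e) \<in> sourceless_currents G"
      if "n1 \<in> sourceless_currents G" "n2 \<in> sourceless_currents G" for n1 n2
    proof -
      have "odd_part G (\<lambda>e. n1 e + n2 e) = sym_diff (odd_part G n1) (odd_part G n2)"
        by (auto simp: odd_part_def)
      moreover have "finite (odd_part G n1)" "finite (odd_part G n2)" by (auto simp: odd_part_def)
      ultimately show ?thesis
        using that by (simp add: sourceless_iff_even[OF G] even_set_sym_diff)
    qed
    show ?thesis
    proof (cases "n \<in> sourceless_currents G")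
      case False
      hence "n \<notin> set_pmf (double_random_current G K)"
        using supp add by (auto simp: double_random_current_def)
      thus ?thesis using False by (simp add: set_pmf_iff)
    next
      case True
      let ?D = "PiE_dflt (arcs G) 0 (\<lambda>e. {..n e})"
      let ?T = "(\<lambda>n1. (n1, \<lambda>e. n e - n1 e)) ` ?D"
      have D: "n1 \<in> ?D \<longleftrightarrow> (\<forall>e. n1 e \<le> n e)" for n1
        using True by (auto simp: PiE_dflt_def sourceless_currents_def) (metis le_0_eq)+
      have T: "?f -` {n} = ?T"
      proof (intro equalityI subsetI)
        fix q assume "q \<in> ?f -` {n}"
        then obtain n1 n2 where q: "q = (n1, n2)" "n = (\<lambda>e. n1 e + n2 e)" by (cases q) auto
        hence "q = (n1, \<lambda>e. n e - n1 e)" by simp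
        moreover have "n1 \<in> ?D" unfolding D by (simp add: q(2))
        ultimately show "q \<in> ?T" by blast
      qed (auto simp: D fun_eq_iff)
      have "finite ?T" by (intro finite_imageI finite_PiE_dflt) auto
      \<comment> \<open>the second summand inherits sourcelessness from the sum and the first one\<close>
      have sub: "(\<lambda>e. n e - n1 e) \<in> sourceless_currents G \<longleftrightarrow> n1 \<in> sourceless_currents G"
        if "n1 \<in> ?D" for n1
      proof -
        have le: "n1 e \<le> n e" for e using that D by auto
        have par: "odd (n e - n1 e) \<longleftrightarrow> odd (n e) \<noteq> odd (n1 e)" for e
          using le[of e] by (auto simp: not_less[symmetric])
        have "odd_part G (\<lambda>e. n e - n1 e) = sym_diff (odd_part G n) (odd_part G n1)"
          "odd_part G n1 = sym_diff (odd_part G n) (odd_part G (\<lambda>e. n e - n1 e))"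
          by (auto simp: odd_part_def par simp del: even_diff_nat)
        moreover have "finite (odd_part G m)" for m by (auto simp: odd_part_def)
        moreover have "n1 e = 0" "n e = 0" if "e \<notin> arcs G" for e
          using that True le[of e] by (auto simp: sourceless_currents_def)
        ultimately show ?thesis
          using True by (auto simp: sourceless_iff_even[OF G] intro: even_set_sym_diff)
            (metis even_set_sym_diff)+
      qed
      have "pmf (double_random_current G K) n = measure_pmf.prob ?q ?T"
        by (simp add: double_random_current_def pmf_map T)
      also have "\<dots> = sum (pmf ?q) ?T" by (rule measure_measure_pmf_finite) fact
      also have "\<dots> = (\<Sum>n1\<in>?D. pmf ?q (n1, \<lambda>e. n e - n1 e))"
        by (subst sum.reindex) (auto simp: inj_on_def)
      also have "\<dots> = (\<Sum>n1\<in>?D. 1 / Z\<^sup>2 * (of_bool (even_set G (odd_part G n1)) *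
          (current_weight G K n1 * current_weight G K (\<lambda>e. n e - n1 e))))"
      proof (intro sum.cong refl)
        fix n1 assume n1: "n1 \<in> ?D"
        have "n1 e = 0" if "e \<notin> arcs G" for e
          using n1 that by (auto simp: PiE_dflt_def)
        hence "n1 \<in> sourceless_currents G \<longleftrightarrow> even_set G (odd_part G n1)"
          by (simp add: sourceless_iff_even[OF G])
        thus "pmf ?q (n1, \<lambda>e. n e - n1 e) = 1 / Z\<^sup>2 * (of_bool (even_set G (odd_part G n1)) *
            (current_weight G K n1 * current_weight G K (\<lambda>e. n e - n1 e)))"
          by (simp add: pmf_pair r sub[OF n1] power2_eq_square)
      qed
      also have "\<dots> = 1 / Z\<^sup>2 * (double_weight G K n * card (cluster_regions G n) / 2 ^ card (verts G))"
        unfolding sum_distrib_left[symmetric]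
        using True by (subst sum_splittings[OF G]) (auto simp: sourceless_currents_def)
      finally show ?thesis using True by simp
    qed
  qed
qed

lemma edge_cut_spanning_subgraph: "edge_cut (spanning_subgraph G A) X = edge_cut G X \<inter> A"
  by (auto simp: edge_cut_def spanning_subgraph_def)

lemma verts_spanning_subgraph [simp]: "verts (spanning_subgraph G A) = verts G"
  by (simp add: spanning_subgraph_def)

lemma fin_digraph_spanning_subgraph:
  assumes "fin_digraph G" shows "fin_digraph (spanning_subgraph G A)"
proof -
  interpret fin_digraph G by (rule assms)
  show ?thesis by unfold_locales (auto simp: spanning_subgraph_def)
qed

lemma cluster_regions_eq: "cluster_regions G n =
    {X. X \<subseteq> verts G \<and> edge_cut (spanning_subgraph G {e. n e > 0}) X = {}}"
  by (auto simp: cluster_regions_def edge_cut_spanning_subgraph)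

definition region_signs :: "('v, 'e) pre_digraph \<Rightarrow> ('e \<Rightarrow> nat) \<Rightarrow> 'v set \<Rightarrow> 'v set \<Rightarrow> real" where
  "region_signs G n X C = (if C \<in> clusters G n then if C \<subseteq> X then -1 else 1 else 0)"

lemma finite_cluster_regions: "fin_digraph G \<Longrightarrow> finite (cluster_regions G n)"
  by (rule finite_subset[of _ "Pow (verts G)"])
     (auto simp: cluster_regions_def fin_digraph.finite_verts)

lemma cluster_regions_nonempty: "cluster_regions G n \<noteq> {}"
  by (auto simp: cluster_regions_def intro!: exI[of _ "{}"])

lemma finite_clusters: "fin_digraph G \<Longrightarrow> finite (clusters G n)"
  unfolding clusters_def by (intro fin_digraph.finite_components fin_digraph_spanning_subgraph)

lemma cluster_signs_eq:
  assumes G: "fin_digraph G"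
  shows "cluster_signs G n = pmf_of_set (PiE_dflt (clusters G n) 0 (\<lambda>_. {-1, 1}))"
  unfolding cluster_signs_def by (intro Pi_pmf_of_set finite_clusters G) auto

text \<open>
  A vertex set with empty cut is the union of the components that it contains, so a union of clusters
  and the set of clusters with sign -1 determine each other.
\<close>

lemma bij_betw_region_signs:
  assumes G: "fin_digraph G"
  shows "bij_betw (region_signs G n) (cluster_regions G n)
    (PiE_dflt (clusters G n) 0 (\<lambda>_. {-1, 1}))"
proof -
  interpret H: fin_digraph "spanning_subgraph G {e. n e > 0}"
    by (rule fin_digraph_spanning_subgraph[OF G])
  show ?thesis
  proof (rule bij_betw_byWitness[where f' = "\<lambda>s. \<Union>{C \<in> clusters G n. s C = -1}"])
    show "\<forall>X\<in>cluster_regions G n. \<Union>{C \<in> clusters G n. region_signs G n X C = -1} = X"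
    proof
      fix X assume X: "X \<in> cluster_regions G n"
      have "{C \<in> clusters G n. region_signs G n X C = -1} = {C \<in> clusters G n. C \<subseteq> X}"
        by (auto simp: region_signs_def)
      thus "\<Union>{C \<in> clusters G n. region_signs G n X C = -1} = X"
        using X H.closed_eq_Union[of X] by (simp add: cluster_regions_eq clusters_def)
    qed
    show "\<forall>s\<in>PiE_dflt (clusters G n) 0 (\<lambda>_. {-1, 1}).
        region_signs G n (\<Union>{C \<in> clusters G n. s C = -1}) = s"
    proof
      fix s :: "'a set \<Rightarrow> real" assume s: "s \<in> PiE_dflt (clusters G n) 0 (\<lambda>_. {-1, 1})"
      show "region_signs G n (\<Union>{C \<in> clusters G n. s C = -1}) = s"
      proof
        fix C
        show "region_signs G n (\<Union>{C \<in> clusters G n. s C = -1}) C = s C"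
        proof (cases "C \<in> clusters G n")
          case True
          hence "C \<subseteq> \<Union>{C \<in> clusters G n. s C = -1} \<longleftrightarrow> s C = -1"
            using H.component_subset_Union_iff[of "{C \<in> clusters G n. s C = -1}" C]
            by (auto simp: clusters_def)
          moreover have "s C = -1 \<or> s C = 1" using True s by (auto simp: PiE_dflt_def)
          ultimately show ?thesis using True by (auto simp: region_signs_def)
        next
          case False
          thus ?thesis using s by (simp add: region_signs_def PiE_dflt_def)
        qed
      qed
    qed
    show "region_signs G n ` cluster_regions G n \<subseteq> PiE_dflt (clusters G n) 0 (\<lambda>_. {-1, 1})"
      by (auto simp: PiE_dflt_def region_signs_def split: if_splits)
    show "(\<lambda>s. \<Union>{C \<in> clusters G n. s C = -1}) ` PiE_dflt (clusters G n) 0 (\<lambda>_. {-1, 1})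
        \<subseteq> cluster_regions G n"
      using H.edge_cut_Union_components H.component_subset
      by (auto simp: cluster_regions_eq clusters_def)
  qed
qed

lemma map_region_signs:
  assumes "fin_digraph G"
  shows "map_pmf (region_signs G n) (pmf_of_set (cluster_regions G n)) = cluster_signs G n"
  unfolding cluster_signs_eq[OF assms]
  by (intro map_pmf_of_set_bij_betw bij_betw_region_signs finite_cluster_regions
      cluster_regions_nonempty assms)

definition region_law :: "('v, 'e) pre_digraph \<Rightarrow> ('e \<Rightarrow> real) \<Rightarrow> (('e \<Rightarrow> nat) \<times> 'v set) pmf" where
  "region_law G K =
     do {n \<leftarrow> double_random_current G K; X \<leftarrow> pmf_of_set (cluster_regions G n); return_pmf (n, X)}"

lemma signed_double_random_current_eq:
  assumes "fin_digraph G"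
  shows "signed_double_random_current G K = map_pmf (\<lambda>(n, X). (n, region_signs G n X)) (region_law G K)"
  unfolding signed_double_random_current_def region_law_def map_region_signs[OF assms, symmetric]
  by (simp add: map_bind_pmf bind_map_pmf map_pmf_def bind_assoc_pmf bind_return_pmf)

lemma pmf_bind_Pair: "pmf (do {x \<leftarrow> p; y \<leftarrow> q x; return_pmf (x, y)}) (a, b) = pmf p a * pmf (q a) b"
proof -
  have eq: "pmf (do {y \<leftarrow> q x; return_pmf (x, y)}) (a, b) = indicator {a} x * pmf (q a) b" for x
  proof (cases "x = a")
    case True
    have "pmf (map_pmf (Pair a) (q a)) (a, b) = pmf (q a) b"
      by (rule pmf_map_inj') (auto simp: inj_on_def)
    thus ?thesis using True by (simp add: map_pmf_def)
  next
    case False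
    have "(a, b) \<notin> set_pmf (do {y \<leftarrow> q x; return_pmf (x, y)})" using False by auto
    hence "pmf (do {y \<leftarrow> q x; return_pmf (x, y)}) (a, b) = 0"
      by (rule pmf_eq_0_set_pmf[THEN iffD2])
    thus ?thesis using False by simp
  qed
  show ?thesis
    by (subst pmf_bind) (simp only: eq, simp add: measure_pmf_single)
qed

text \<open>
  The number of choices of spins, which appears in the density of the double random current, is
  cancelled by the uniform choice of the spins. What remains is a product of edge weights.
\<close>

lemma pmf_region_law:
  assumes G: "fin_digraph G" and K: "\<And>e. e \<in> arcs G \<Longrightarrow> K e > 0"
  obtains c where "c > 0" and "\<And>n X. pmf (region_law G K) (n, X) =
    c * (of_bool (n \<in> sourceless_currents G \<and> X \<in> cluster_regions G n) * double_weight G K n)"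
proof -
  obtain c where c: "c > 0" "\<And>n. pmf (double_random_current G K) n =
      c * (of_bool (n \<in> sourceless_currents G) * double_weight G K n * card (cluster_regions G n))"
    using pmf_double_random_current[of G K] G K by metis
  have "card (cluster_regions G n) > 0" for n
    by (simp add: card_gt_0_iff cluster_regions_nonempty finite_cluster_regions[OF G])
  hence "pmf (region_law G K) (n, X) =
      c * (of_bool (n \<in> sourceless_currents G \<and> X \<in> cluster_regions G n) * double_weight G K n)" for n X
    unfolding region_law_def pmf_bind_Pair
    by (subst pmf_of_set)
       (auto simp: c cluster_regions_nonempty finite_cluster_regions[OF G] indicator_def
          intro: less_imp_neq[symmetric])
  thus thesis using c(1) that by blast
qed

text \<open>
  Normalising constants never have to be computed: they agree because both densities sum to one.
\<close>

lemma pmf_eq_if_proportional: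
  assumes "\<And>x. pmf p x = c * f x" "\<And>x. pmf q x = d * f x"
  shows "p = q"
proof -
  have "c \<noteq> 0" "d \<noteq> 0" using assms set_pmf_not_empty[of p] set_pmf_not_empty[of q] by (auto simp: set_pmf_eq)
  hence eq: "pmf p x = c / d * pmf q x" for x using assms by simp
  have "(\<Sum>\<^sub>\<infinity>x. pmf p x) = c / d * (\<Sum>\<^sub>\<infinity>x. pmf q x)"
    unfolding eq by (rule infsum_cmult_right')
  moreover have "(\<Sum>\<^sub>\<infinity>x. pmf r x) = 1" for r :: "'a pmf"
    using measure_pmf_conv_infsetsum[of r UNIV] infsetsum_infsum[OF pmf_abs_summable, of r UNIV]
      measure_pmf.prob_space[of r] by simp
  ultimately have "c / d = 1" by simp
  thus ?thesis using eq by (intro pmf_eqI) (metis mult_1)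
qed

section \<open>Dual coupling constants\<close>

definition dual_couplings :: "real \<Rightarrow> real \<Rightarrow> bool" where
  "dual_couplings k kd \<longleftrightarrow> k > 0 \<and> kd > 0 \<and> exp (- 2 * kd) = tanh k"

text \<open>
  The relation between \<open>exp (- 2 * k)\<close> and \<open>exp (- 2 * kd)\<close> is symmetric, although its definition by the
  hyperbolic tangent does not show it.
\<close>

lemma dual_couplings_iff:
  "dual_couplings k kd \<longleftrightarrow> k > 0 \<and> kd > 0 \<and> exp (- 2 * k) + exp (- 2 * kd) + exp (- 2 * k) * exp (- 2 * kd) = 1"
proof -
  have "1 + exp (- 2 * k) > 0" by (simp add: add_pos_pos)
  thus ?thesis
    unfolding dual_couplings_def tanh_real_altdef by (auto simp: field_simps)
qed

lemma dual_couplings_sym: "dual_couplings k kd \<Longrightarrow> dual_couplings kd k"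
  by (simp add: dual_couplings_iff algebra_simps)

lemma dual_couplings_parametrised:
  assumes "dual_couplings k kd"
  obtains x where "0 < x" "x < 1" "exp (- (2 * k)) = x" "exp (2 * k) = 1 / x"
    "exp (- (2 * kd)) = (1 - x) / (1 + x)" "exp (2 * kd) = (1 + x) / (1 - x)"
proof
  let ?x = "exp (- (2 * k))"
  show "0 < ?x" "?x < 1" using assms by (auto simp: dual_couplings_def)
  show y: "exp (- (2 * kd)) = (1 - ?x) / (1 + ?x)"
    using assms by (simp add: dual_couplings_def tanh_real_altdef)
  show "exp (2 * k) = 1 / ?x" by (simp add: exp_minus field_simps)
  have "exp (2 * kd) = 1 / exp (- (2 * kd))" by (simp add: exp_minus field_simps)
  thus "exp (2 * kd) = (1 + ?x) / (1 - ?x)" unfolding y by simp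
qed simp

lemma
  assumes "dual_couplings k kd"
  shows dual_couplings_sinh_sinh: "sinh (2 * k) * sinh (2 * kd) = 1"
    and dual_couplings_sinh_cosh: "sinh (2 * k) * cosh (2 * kd) = cosh (2 * k)"
    and dual_couplings_one_minus_exp: "sinh (2 * k) * (1 - exp (- (2 * kd))) = 1 - exp (- (2 * k))"
proof -
  obtain x where x: "0 < x" "x < 1" "exp (- (2 * k)) = x" "exp (2 * k) = 1 / x"
    "exp (- (2 * kd)) = (1 - x) / (1 + x)" "exp (2 * kd) = (1 + x) / (1 - x)"
    using dual_couplings_parametrised[OF assms] .
  have pos: "1 + x > 0" "1 - x > 0" "x > 0" using x by auto
  \<comment> \<open>all quantities are rational in \<open>x = exp (- 2 * k)\<close>\<close>
  have s: "sinh (2 * k) = (1 - x\<^sup>2) / (2 * x)" "cosh (2 * k) = (1 + x\<^sup>2) / (2 * x)"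
    using pos unfolding sinh_field_def cosh_field_def x by (simp_all add: field_simps power2_eq_square)
  have "1 - x\<^sup>2 = (1 - x) * (1 + x)" by (simp add: algebra_simps power2_eq_square)
  hence sd: "sinh (2 * kd) = 2 * x / (1 - x\<^sup>2)" "cosh (2 * kd) = (1 + x\<^sup>2) / (1 - x\<^sup>2)"
    using pos unfolding sinh_field_def cosh_field_def x
    by (simp_all add: divide_simps) (simp_all add: algebra_simps power2_eq_square)
  have "x\<^sup>2 < 1" using x by (simp add: abs_square_less_1)
  thus "sinh (2 * k) * sinh (2 * kd) = 1" "sinh (2 * k) * cosh (2 * kd) = cosh (2 * k)"
    using pos unfolding s sd by (simp_all add: divide_simps)
  show "sinh (2 * k) * (1 - exp (- (2 * kd))) = 1 - exp (- (2 * k))"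
    using pos unfolding s x by (simp add: divide_simps) (simp add: algebra_simps power2_eq_square)
qed

text \<open>
  The joint weight of a primal value \<open>n\<close> and a dual value \<open>m\<close> on one edge. The nonzero values carry the
  weights of the two double currents, the dual ones multiplied by \<open>sinh (2 * k)\<close>, and the weight of the
  pair \<open>(0, 0)\<close> is what remains for the even values to sum to one in \<open>pair_weight_sums\<close>.
\<close>

definition pair_weight :: "real \<Rightarrow> real \<Rightarrow> nat \<Rightarrow> nat \<Rightarrow> real" where
  "pair_weight k kd n m =
     (if m = 0 then if n = 0 then 1 - exp (- 2 * k) else (2 * k) ^ n / fact n
      else if n = 0 then sinh (2 * k) * ((2 * kd) ^ m / fact m) else 0)"

lemma pair_weight_dual:
  assumes "dual_couplings k kd"
  shows "pair_weight k kd n m = sinh (2 * k) * pair_weight kd k m n"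
  using dual_couplings_sinh_sinh[OF assms] dual_couplings_one_minus_exp[OF assms]
  by (auto simp: pair_weight_def simp flip: mult.assoc)

lemma pair_weight_nonneg: "dual_couplings k kd \<Longrightarrow> pair_weight k kd n m \<ge> 0"
  by (auto simp: pair_weight_def dual_couplings_def)

text \<open>
  The odd values sum to \<open>sinh (2 * k) * sinh (2 * kd) = 1\<close>; the even ones to
  \<open>sinh (2 * k) * (cosh (2 * kd) - 1) + 1 - exp (- 2 * k)\<close>, where the first product is
  \<open>cosh (2 * k) - sinh (2 * k) = exp (- 2 * k)\<close>. That both parities have the same total is what decouples
  the two sides of an edge on which the primal current vanishes.
\<close>

lemma pair_weight_sums:
  assumes "dual_couplings k kd"
  shows "(\<lambda>m. of_bool (odd m = b) * pair_weight k kd 0 m) sums 1"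
proof (cases b)
  case True
  have "(\<lambda>m. sinh (2 * k) * (if even m then 0 else (2 * kd) ^ m /\<^sub>R fact m)) sums
      (sinh (2 * k) * sinh (2 * kd))"
    by (intro sums_mult sinh_converges)
  moreover have "sinh (2 * k) * (if even m then 0 else (2 * kd) ^ m /\<^sub>R fact m) =
      of_bool (odd m = b) * pair_weight k kd 0 m" for m
    using True by (auto simp: pair_weight_def divide_inverse mult.commute)
  ultimately show ?thesis by (simp add: dual_couplings_sinh_sinh[OF assms])
next
  case False
  have "(\<lambda>m. sinh (2 * k) * (if even m then (2 * kd) ^ m /\<^sub>R fact m else 0)
        + (if m = 0 then 1 - exp (- 2 * k) - sinh (2 * k) else 0)) sums
      (sinh (2 * k) * cosh (2 * kd) + (1 - exp (- 2 * k) - sinh (2 * k)))"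
    by (intro sums_add sums_mult cosh_converges sums_single[of 0 "\<lambda>_. 1 - exp (- 2 * k) - sinh (2 * k)"])
  moreover have "sinh (2 * k) * (if even m then (2 * kd) ^ m /\<^sub>R fact m else 0)
      + (if m = 0 then 1 - exp (- 2 * k) - sinh (2 * k) else 0) =
      of_bool (odd m = b) * pair_weight k kd 0 m" for m
    using False by (auto simp: pair_weight_def divide_inverse mult.commute)
  moreover have "sinh (2 * k) * cosh (2 * kd) + (1 - exp (- 2 * k) - sinh (2 * k)) = 1"
    unfolding dual_couplings_sinh_cosh[OF assms] by (simp add: sinh_field_def cosh_field_def field_simps)
  ultimately show ?thesis by (simp only:)
qed

text \<open>
  The conditional law of the dual current on one edge, given the primal value \<open>n\<close> and whether the primal
  spins differ across the edge (\<open>b\<close>).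
\<close>

definition dual_edge_law :: "real \<Rightarrow> real \<Rightarrow> nat \<Rightarrow> bool \<Rightarrow> nat pmf" where
  "dual_edge_law k kd n b =
     (if n = 0 then embed_pmf (\<lambda>m. of_bool (odd m = b) * pair_weight k kd 0 m) else return_pmf 0)"

lemma pmf_dual_edge_law:
  assumes "dual_couplings k kd" "b \<longrightarrow> n = 0"
  shows "(2 * k) ^ n / fact n * pmf (dual_edge_law k kd n b) m = of_bool (odd m = b) * pair_weight k kd n m"
proof (cases "n = 0")
  case True
  have "pmf (dual_edge_law k kd 0 b) m = of_bool (odd m = b) * pair_weight k kd 0 m"
    unfolding dual_edge_law_def if_P[OF refl]
  proof (rule pmf_embed_pmf)
    have "(\<Sum>m. ennreal (of_bool (odd m = b) * pair_weight k kd 0 m)) = ennreal 1"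
      by (intro suminf_ennreal_eq pair_weight_sums[OF assms(1)])
         (simp add: pair_weight_nonneg[OF assms(1)])
    thus "(\<integral>\<^sup>+m. ennreal (of_bool (odd m = b) * pair_weight k kd 0 m) \<partial>count_space UNIV) = 1"
      by (simp only: nn_integral_count_space_nat ennreal_1)
  qed (simp add: pair_weight_nonneg[OF assms(1)])
  thus ?thesis using True by simp
qed (use assms in \<open>auto simp: dual_edge_law_def pair_weight_def indicator_def\<close>)


section \<open>Dual pairs of graphs\<close>

lemma edge_cut_eq_iff_connected:
  assumes G: "fin_digraph G" "connected G" and "X \<subseteq> verts G" "Y \<subseteq> verts G"
  shows "edge_cut G X = edge_cut G Y \<longleftrightarrow> Y = X \<or> Y = verts G - X"
proof -
  have "edge_cut G X = edge_cut G Y \<longleftrightarrow> edge_cut G (sym_diff X Y) = {}"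
    by (auto simp: edge_cut_sym_diff)
  also have "\<dots> \<longleftrightarrow> sym_diff X Y \<in> {X. X \<subseteq> verts G \<and> edge_cut G X = {}}"
    using assms by auto
  also have "\<dots> \<longleftrightarrow> sym_diff X Y = {} \<or> sym_diff X Y = verts G"
    by (simp add: closed_sets_connected[OF G])
  also have "\<dots> \<longleftrightarrow> Y = X \<or> Y = verts G - X" using assms by auto
  finally show ?thesis .
qed

lemma card_cut_fibre:
  assumes G: "fin_digraph G" "connected G" and X: "X \<subseteq> verts G"
  shows "card {Y. Y \<subseteq> verts G \<and> edge_cut G Y = edge_cut G X} = 2"
proof -
  have "{Y. Y \<subseteq> verts G \<and> edge_cut G Y = edge_cut G X} = {X, verts G - X}"
  proof (intro set_eqI)
    fix Y
    show "Y \<in> {Y. Y \<subseteq> verts G \<and> edge_cut G Y = edge_cut G X} \<longleftrightarrow> Y \<in> {X, verts G - X}"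
      using edge_cut_eq_iff_connected[OF G X, of Y] edge_cut_compl[OF G(1), of X] X
      by (cases "Y \<subseteq> verts G") auto
  qed
  moreover have "X \<noteq> verts G - X" using connected_verts_nonempty[OF G(2)] X by auto
  ultimately show ?thesis by simp
qed

text \<open>
  In a connected graph a cut determines the vertex set up to complement.
\<close>

lemma card_edge_cuts:
  assumes G: "fin_digraph G" "connected G"
  shows "2 * card (edge_cut G ` Pow (verts G)) = 2 ^ card (verts G)"
proof -
  have fin: "finite (verts G)" by (rule fin_digraph.finite_verts[OF G(1)])
  have "2 ^ card (verts G) = (\<Sum>X\<in>Pow (verts G). 1::nat)" using fin by (simp add: card_Pow)
  also have "\<dots> = (\<Sum>A\<in>edge_cut G ` Pow (verts G). \<Sum>X\<in>{X \<in> Pow (verts G). edge_cut G X = A}. 1)"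
    using fin by (intro sum.image_gen) simp
  also have "\<dots> = (\<Sum>A\<in>edge_cut G ` Pow (verts G). 2)"
    using card_cut_fibre[OF G] by (intro sum.cong refl) auto
  finally show ?thesis by simp
qed

text \<open>
  Summing \<open>sum_cut_signs\<close> over all edge sets and exchanging the sums, only the two vertex sets with empty
  cut survive.
\<close>

lemma card_even_sets:
  assumes G: "fin_digraph G" "connected G"
  shows "card {A. A \<subseteq> arcs G \<and> even_set G A} * 2 ^ card (verts G) = 2 * 2 ^ card (arcs G)"
proof -
  interpret fin_digraph G by (rule G)
  \<comment> \<open>toggling an edge of \<open>B\<close> reverses the sign\<close>
  have inner: "(\<Sum>A\<in>Pow (arcs G). (-1) ^ card (A \<inter> B)) = (2 ^ card (arcs G) * of_bool (B = {}) :: real)"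
    if B: "B \<subseteq> arcs G" for B
  proof (cases "B = {}")
    case False
    then obtain b where b: "b \<in> B" by blast
    have "(\<Sum>A\<in>Pow (arcs G). (-1) ^ card (A \<inter> B)) =
        (\<Sum>A\<in>Pow (arcs G). (-1) ^ card (sym_diff A {b} \<inter> B) :: real)"
    proof -
      have *: "sym_diff (sym_diff A {b}) {b} = A" for A by auto
      show ?thesis
        by (rule sum.reindex_bij_witness[of _ "\<lambda>A. sym_diff A {b}" "\<lambda>A. sym_diff A {b}"])
           (use b B in \<open>auto simp only: * Pow_iff\<close>)
    qed
    also have "\<dots> = (\<Sum>A\<in>Pow (arcs G). - ((-1) ^ card (A \<inter> B)))"
    proof (intro sum.cong refl)
      fix A assume A: "A \<in> Pow (arcs G)"
      have "finite A" using A finite_subset[OF _ finite_arcs] by auto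
      moreover have "sym_diff A {b} \<inter> B = sym_diff (A \<inter> B) {b}" using b by auto
      ultimately have "even (card (sym_diff A {b} \<inter> B)) \<longleftrightarrow> odd (card (A \<inter> B))"
        using even_card_sym_diff[of "A \<inter> B" "{b}"] by simp
      thus "(-1) ^ card (sym_diff A {b} \<inter> B) = - ((-1) ^ card (A \<inter> B) :: real)"
        by (cases "even (card (A \<inter> B))") auto
    qed
    finally show ?thesis using False by (simp add: sum_negf)
  qed (simp add: card_Pow)
  have "card {A. A \<subseteq> arcs G \<and> even_set G A} * 2 ^ card (verts G) =
      (\<Sum>A\<in>Pow (arcs G). if even_set G A then 2 ^ card (verts G) else (0::real))"
    by (subst sum.inter_filter[symmetric]) (auto intro!: arg_cong[of _ _ card])
  also have "\<dots> = (\<Sum>A\<in>Pow (arcs G). \<Sum>X\<in>Pow (verts G). (-1) ^ card (A \<inter> edge_cut G X))"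
    by (intro sum.cong refl sum_cut_signs[symmetric] G) (auto intro: finite_subset)
  also have "\<dots> = (\<Sum>X\<in>Pow (verts G). \<Sum>A\<in>Pow (arcs G). (-1) ^ card (A \<inter> edge_cut G X))"
    by (rule sum.swap)
  also have "\<dots> = (\<Sum>X\<in>Pow (verts G). 2 ^ card (arcs G) * of_bool (edge_cut G X = {}))"
    by (intro sum.cong refl inner edge_cut_subset)
  also have "\<dots> = 2 ^ card (arcs G) * card {X. X \<subseteq> verts G \<and> edge_cut G X = {}}"
    by (simp add: Int_def flip: sum_distrib_left)
  also have "card {X. X \<subseteq> verts G \<and> edge_cut G X = {}} = 2"
    using card_cut_fibre[OF G, of "{}"] by simp
  finally have "real (card {A. A \<subseteq> arcs G \<and> even_set G A} * 2 ^ card (verts G)) = real (2 * 2 ^ card (arcs G))"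
    by simp
  thus ?thesis by (simp only: of_nat_eq_iff)
qed

text \<open>
  The algebraic content of planar duality: edge sets are even in the graph iff they are cuts of the
  dual. Connectedness of both graphs fixes the number of spin configurations with a given
  interface, namely two. The notion is symmetric (\<open>dual\<close>) and stable under passing to an induced
  connected subgraph and contracting the dual (\<open>dual_pair_induce_subgraph\<close>).
\<close>

locale dual_pair =
  fixes G :: "('v, 'e) pre_digraph" and Gd :: "('f, 'e) pre_digraph"
  assumes fin_G: "fin_digraph G" and fin_Gd: "fin_digraph Gd"
    and conn_G: "connected G" and conn_Gd: "connected Gd"
    and arcs_Gd: "arcs Gd = arcs G"
    and even_set_iff_cut: "A \<subseteq> arcs G \<Longrightarrow> even_set G A \<longleftrightarrow> (\<exists>Y\<subseteq>verts Gd. A = edge_cut Gd Y)"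
begin

lemma finite_arcs_G: "finite (arcs G)"
  by (rule fin_digraph.finite_arcs[OF fin_G])

text \<open>
  By hypothesis every cut of the dual is even in the graph, hence meets every cut of the graph in an
  even number of edges; this is symmetric in the two cuts.
\<close>

lemma even_set_edge_cut_dual: "even_set Gd (edge_cut G X)"
  unfolding even_set_def
proof (intro allI impI)
  fix Y assume "Y \<subseteq> verts Gd"
  hence "even_set G (edge_cut Gd Y)"
    using even_set_iff_cut[of "edge_cut Gd Y"] edge_cut_subset[of Gd Y] arcs_Gd by auto
  hence "\<forall>X\<subseteq>verts G. even (card (edge_cut Gd Y \<inter> edge_cut G X))"
    by (simp only: even_set_def)
  from this[rule_format, OF Int_lower2[of X]]
  show "even (card (edge_cut G X \<inter> edge_cut Gd Y))"
    by (simp add: edge_cut_Int_verts[OF fin_G] Int_commute)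
qed

text \<open>
  One inclusion is \<open>even_set_edge_cut_dual\<close>. For equality count: the sizes of the four sets of even sets
  and cuts are powers of two determined by the numbers of vertices and edges, and equality for the
  pair \<open>(G, Gd)\<close> forces equality for the pair \<open>(Gd, G)\<close>.
\<close>

lemma dual: "dual_pair Gd G"
proof (rule dual_pair.intro[OF fin_Gd fin_G conn_Gd conn_G arcs_Gd[symmetric]])
  fix A assume A: "A \<subseteq> arcs Gd"
  let ?EG = "{A. A \<subseteq> arcs G \<and> even_set G A}" and ?ED = "{A. A \<subseteq> arcs Gd \<and> even_set Gd A}"
  let ?CG = "edge_cut G ` Pow (verts G)" and ?CD = "edge_cut Gd ` Pow (verts Gd)"
  have "?EG = ?CD"
  proof (intro set_eqI)
    fix B
    have "B \<subseteq> arcs G" if "B \<in> ?CD" using that edge_cut_subset[of Gd] arcs_Gd by auto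
    thus "B \<in> ?EG \<longleftrightarrow> B \<in> ?CD" using even_set_iff_cut[of B] by auto
  qed
  hence 1: "card ?EG = card ?CD" by simp
  have 2: "card ?CD * (2 * card ?CG) = 2 * 2 ^ card (arcs G)"
    using card_even_sets[OF fin_G conn_G] unfolding 1 card_edge_cuts[OF fin_G conn_G] .
  have 3: "card ?ED * (2 * card ?CD) = 2 * 2 ^ card (arcs G)"
    using card_even_sets[OF fin_Gd conn_Gd] unfolding card_edge_cuts[OF fin_Gd conn_Gd] arcs_Gd .
  have "card ?CD > 0" using 3 by (intro Nat.gr0I) auto
  moreover have "card ?CD * (2 * card ?ED) = card ?CD * (2 * card ?CG)"
    using 2 3 by (simp only: mult_ac)
  ultimately have "card ?ED = card ?CG" by simp
  moreover have "?CG \<subseteq> ?ED"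
    using edge_cut_subset[of G] arcs_Gd even_set_edge_cut_dual by auto
  moreover have "finite ?ED" using finite_arcs_G arcs_Gd by simp
  ultimately have eq: "?CG = ?ED" by (metis card_subset_eq)
  have "even_set Gd A \<longleftrightarrow> A \<in> ?ED" using A by simp
  also have "\<dots> \<longleftrightarrow> A \<in> ?CG" by (simp only: eq)
  finally show "even_set Gd A \<longleftrightarrow> (\<exists>X\<subseteq>verts G. A = edge_cut G X)" by auto
qed

end

section \<open>The master coupling\<close>

text \<open>
  The construction is asymmetric: it makes the law of \<open>(n, X)\<close> evident without any summation over the
  dual current. The symmetry between the two sides appears only in the density.
\<close>

definition master_law ::
  "('v, 'e) pre_digraph \<Rightarrow> ('f, 'e) pre_digraph \<Rightarrow> ('e \<Rightarrow> real) \<Rightarrow> ('e \<Rightarrow> real) \<Rightarrow>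
   ((('e \<Rightarrow> nat) \<times> 'v set) \<times> (('e \<Rightarrow> nat) \<times> 'f set)) pmf" where
  "master_law G Gd K Kd =
     do {a \<leftarrow> region_law G K;
         b \<leftarrow> pair_pmf
           (Pi_pmf (arcs G) 0 (\<lambda>e. dual_edge_law (K e) (Kd e) (fst a e) (e \<in> edge_cut G (snd a))))
           (pmf_of_set {Y. Y \<subseteq> verts Gd \<and> edge_cut Gd Y = odd_part G (fst a)});
         return_pmf (a, b)}"

definition master_weight ::
  "('v, 'e) pre_digraph \<Rightarrow> ('f, 'e) pre_digraph \<Rightarrow> ('e \<Rightarrow> real) \<Rightarrow> ('e \<Rightarrow> real) \<Rightarrow>
   ('e \<Rightarrow> nat) \<times> 'v set \<Rightarrow> ('e \<Rightarrow> nat) \<times> 'f set \<Rightarrow> real" where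
  "master_weight G Gd K Kd a b = (case a of (n, X) \<Rightarrow> case b of (nd, Y) \<Rightarrow>
     of_bool (X \<subseteq> verts G \<and> Y \<subseteq> verts Gd \<and> (\<forall>e. e \<notin> arcs G \<longrightarrow> n e = 0 \<and> nd e = 0) \<and>
       odd_part G n = edge_cut Gd Y \<and> odd_part Gd nd = edge_cut G X) *
     (\<Prod>e\<in>arcs G. pair_weight (K e) (Kd e) (n e) (nd e)))"

context dual_pair
begin

text \<open>
  The odd part of a sourceless current is a dual cut, so the choice of \<open>Y\<close> contributes the factor
  \<open>1 / 2\<close>. On every edge the weight \<open>(2 * K e) ^ n e / fact (n e)\<close> and the law of the dual value combine to
  the pair weight. The requirement that \<open>n\<close> vanish on the cut of \<open>X\<close> is implicit in
  the result: on that cut the dual current is odd, hence positive, and the pair weight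
  vanishes unless the primal value is zero.
\<close>

lemma pmf_master_law:
  assumes K: "\<And>e. e \<in> arcs G \<Longrightarrow> dual_couplings (K e) (Kd e)"
  obtains c where "c > 0" "\<And>a b. pmf (master_law G Gd K Kd) (a, b) = c * master_weight G Gd K Kd a b"
proof -
  have Kpos: "K e > 0" if "e \<in> arcs G" for e using K[OF that] by (simp add: dual_couplings_def)
  obtain c where c: "c > 0" "\<And>n X. pmf (region_law G K) (n, X) =
      c * (of_bool (n \<in> sourceless_currents G \<and> X \<in> cluster_regions G n) * double_weight G K n)"
    using pmf_region_law[of G K] fin_G Kpos by metis
  have "pmf (master_law G Gd K Kd) ((n, X), (nd, Y)) = c / 2 * master_weight G Gd K Kd (n, X) (nd, Y)"
    for n X nd Y
  proof -
    let ?P = "Pi_pmf (arcs G) 0 (\<lambda>e. dual_edge_law (K e) (Kd e) (n e) (e \<in> edge_cut G X))"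
    let ?S = "{Y. Y \<subseteq> verts Gd \<and> edge_cut Gd Y = odd_part G n}"
    let ?w = "\<Prod>e\<in>arcs G. pair_weight (K e) (Kd e) (n e) (nd e)"
    have pmf: "pmf (master_law G Gd K Kd) ((n, X), (nd, Y)) =
        pmf (region_law G K) (n, X) * (pmf ?P nd * pmf (pmf_of_set ?S) Y)"
      unfolding master_law_def pmf_bind_Pair by (simp add: pmf_pair)
    show ?thesis
    proof (cases "n \<in> sourceless_currents G \<and> X \<subseteq> verts G \<and> (\<forall>e. e \<notin> arcs G \<longrightarrow> nd e = 0) \<and> Y \<in> ?S")
      case False
      have "n \<in> sourceless_currents G" if "(\<forall>e. e \<notin> arcs G \<longrightarrow> n e = 0) \<and> Y \<in> ?S"
      proof -
        have "odd_part G n \<subseteq> arcs G" by (auto simp: odd_part_def)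
        thus ?thesis using that even_set_iff_cut[of "odd_part G n"] by (auto simp: sourceless_iff_even[OF fin_G])
      qed
      hence "\<not> (X \<subseteq> verts G \<and> Y \<subseteq> verts Gd \<and> (\<forall>e. e \<notin> arcs G \<longrightarrow> n e = 0 \<and> nd e = 0) \<and>
          odd_part G n = edge_cut Gd Y \<and> odd_part Gd nd = edge_cut G X)"
        using False by blast
      hence "master_weight G Gd K Kd (n, X) (nd, Y) = 0"
        by (simp only: master_weight_def prod.case of_bool_eq mult_zero_left)
      moreover have "pmf (master_law G Gd K Kd) ((n, X), (nd, Y)) = 0"
      proof (cases "n \<in> sourceless_currents G \<and> X \<in> cluster_regions G n")
        case True
        hence "even_set G (odd_part G n)" by (simp add: sourceless_iff_even[OF fin_G])
        then obtain Z where "Z \<in> ?S"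
          using even_set_iff_cut[of "odd_part G n"] by (auto simp: odd_part_def)
        hence ne: "?S \<noteq> {}" by blast
        have fin: "finite ?S"
          by (rule finite_subset[of _ "Pow (verts Gd)"]) (auto simp: fin_digraph.finite_verts[OF fin_Gd])
        have "X \<subseteq> verts G" using True by (simp add: cluster_regions_def)
        hence "(\<exists>e. e \<notin> arcs G \<and> nd e \<noteq> 0) \<or> Y \<notin> ?S" using False True by auto
        thus ?thesis
        proof
          assume "\<exists>e. e \<notin> arcs G \<and> nd e \<noteq> 0"
          hence "pmf ?P nd = 0" by (rule pmf_Pi_outside[OF finite_arcs_G])
          thus ?thesis by (simp add: pmf)
        next
          assume "Y \<notin> ?S"
          hence "pmf (pmf_of_set ?S) Y = 0" by (simp only: pmf_of_set[OF ne fin]) simp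
          thus ?thesis by (simp add: pmf)
        qed
      qed (simp add: pmf c)
      ultimately show ?thesis by simp
    next
      case True
      have "?S = {Z. Z \<subseteq> verts Gd \<and> edge_cut Gd Z = edge_cut Gd Y}" using True by auto
      hence cardS: "card ?S = 2" using card_cut_fibre[OF fin_Gd conn_Gd, of Y] True by simp
      have "?S \<noteq> {}" using True by blast
      moreover have "finite ?S" by (rule card_ge_0_finite) (simp only: cardS)
      ultimately have "pmf (pmf_of_set ?S) Y = indicator ?S Y / card ?S" by (rule pmf_of_set)
      hence "pmf (pmf_of_set ?S) Y = 1 / 2" unfolding cardS using True by simp
      moreover have "pmf ?P nd = (\<Prod>e\<in>arcs G. pmf (dual_edge_law (K e) (Kd e) (n e) (e \<in> edge_cut G X)) (nd e))"
        using True by (intro pmf_Pi' finite_arcs_G) auto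
      ultimately have "pmf (master_law G Gd K Kd) ((n, X), (nd, Y)) =
          c / 2 * (of_bool (X \<in> cluster_regions G n) *
            (\<Prod>e\<in>arcs G. (2 * K e) ^ n e / fact (n e) *
              pmf (dual_edge_law (K e) (Kd e) (n e) (e \<in> edge_cut G X)) (nd e)))"
        unfolding pmf c double_weight_def prod.distrib using True by simp
      also have "of_bool (X \<in> cluster_regions G n) *
            (\<Prod>e\<in>arcs G. (2 * K e) ^ n e / fact (n e) *
              pmf (dual_edge_law (K e) (Kd e) (n e) (e \<in> edge_cut G X)) (nd e)) =
          of_bool (odd_part Gd nd = edge_cut G X) * ?w"
      proof (cases "X \<in> cluster_regions G n")
        case reg: True
        have "(\<Prod>e\<in>arcs G. (2 * K e) ^ n e / fact (n e) *
              pmf (dual_edge_law (K e) (Kd e) (n e) (e \<in> edge_cut G X)) (nd e)) =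
            (\<Prod>e\<in>arcs G. of_bool (odd (nd e) = (e \<in> edge_cut G X)) *
              pair_weight (K e) (Kd e) (n e) (nd e))"
          using reg by (intro prod.cong refl pmf_dual_edge_law K) (auto simp: cluster_regions_def)
        also have "\<dots> = of_bool (odd_part Gd nd = edge_cut G X) * ?w"
        proof (cases "odd_part Gd nd = edge_cut G X")
          case True
          hence "odd (nd e) \<longleftrightarrow> e \<in> edge_cut G X" if "e \<in> arcs G" for e
            using that arcs_Gd by (auto simp: odd_part_def)
          thus ?thesis using True by simp
        next
          case False
          then obtain e where "e \<in> arcs G" "odd (nd e) \<noteq> (e \<in> edge_cut G X)"
            using arcs_Gd by (auto simp: odd_part_def edge_cut_def)
          thus ?thesis using False finite_arcs_G by (auto intro!: prod_zero bexI[of _ e])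
        qed
        finally show ?thesis using reg by simp
      next
        case False
        then obtain e where e: "e \<in> edge_cut G X" "n e \<noteq> 0"
          using True by (auto simp: cluster_regions_def)
        show ?thesis
        proof (cases "odd_part Gd nd = edge_cut G X")
          case True
          hence "odd (nd e)" using e by (auto simp: odd_part_def)
          hence "pair_weight (K e) (Kd e) (n e) (nd e) = 0" using e by (auto simp: pair_weight_def)
          hence "?w = 0" using e edge_cut_subset[of G X] by (intro prod_zero finite_arcs_G) auto
          thus ?thesis using False by simp
        qed (use False in simp)
      qed
      also have "of_bool (odd_part Gd nd = edge_cut G X) * ?w = master_weight G Gd K Kd (n, X) (nd, Y)"
        using True by (auto simp: master_weight_def sourceless_currents_def)
      finally show ?thesis .
    qed
  qed
  hence "pmf (master_law G Gd K Kd) (a, b) = c / 2 * master_weight G Gd K Kd a b" for a b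
    by (cases a; cases b) auto
  thus thesis using that[of "c / 2"] c(1) by simp
qed

text \<open>
  Exchanging the roles of the two graphs multiplies the pair weight of every edge by a constant, so
  the two densities are proportional.
\<close>

lemma master_law_dual:
  assumes K: "\<And>e. e \<in> arcs G \<Longrightarrow> dual_couplings (K e) (Kd e)"
  shows "master_law Gd G Kd K = map_pmf prod.swap (master_law G Gd K Kd)"
proof -
  obtain c where c: "c > 0" "\<And>a b. pmf (master_law G Gd K Kd) (a, b) = c * master_weight G Gd K Kd a b"
    using pmf_master_law[of K Kd] K by metis
  obtain d where d: "d > 0" "\<And>a b. pmf (master_law Gd G Kd K) (a, b) = d * master_weight Gd G Kd K a b"
    using dual_pair.pmf_master_law[OF dual, of Kd K] dual_couplings_sym[OF K] arcs_Gd by metis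
  define s where "s = (\<Prod>e\<in>arcs G. sinh (2 * K e))"
  have s: "s > 0"
    unfolding s_def using K by (intro prod_pos) (auto simp: dual_couplings_def)
  have w: "master_weight G Gd K Kd a b = s * master_weight Gd G Kd K b a" for a b
  proof -
    have "(\<Prod>e\<in>arcs G. pair_weight (K e) (Kd e) (n e) (nd e)) =
        s * (\<Prod>e\<in>arcs G. pair_weight (Kd e) (K e) (nd e) (n e))" for n nd
      unfolding s_def prod.distrib[symmetric] by (intro prod.cong refl pair_weight_dual K)
    thus ?thesis
      by (auto simp: master_weight_def arcs_Gd split: prod.splits)
  qed
  have "pmf (map_pmf prod.swap (master_law G Gd K Kd)) x = c * s * master_weight Gd G Kd K (fst x) (snd x)" for x
    using pmf_map_inj'[of prod.swap "master_law G Gd K Kd" "prod.swap x"] c(2)[of "snd x" "fst x"] w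
    by (cases x) (simp add: mult.assoc)
  moreover have "pmf (master_law Gd G Kd K) x = d * master_weight Gd G Kd K (fst x) (snd x)" for x
    using d(2)[of "fst x" "snd x"] by simp
  ultimately show ?thesis using c(1) d(1) s by (intro pmf_eq_if_proportional) auto
qed

lemma map_fst_master_law: "map_pmf fst (master_law G Gd K Kd) = region_law G K"
  by (simp add: master_law_def map_bind_pmf bind_return_pmf')

lemma map_snd_master_law:
  assumes "\<And>e. e \<in> arcs G \<Longrightarrow> dual_couplings (K e) (Kd e)"
  shows "map_pmf snd (master_law G Gd K Kd) = region_law Gd Kd"
  using dual_pair.map_fst_master_law[OF dual, of Kd K]
  by (simp add: master_law_dual[OF assms] pmf.map_comp o_def)

text \<open>
  A vertex set has its cut in the odd part of the opposite current, where the current itself vanishes;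
  this is why it is a union of clusters.
\<close>

lemma master_law_support:
  assumes "\<And>e. e \<in> arcs G \<Longrightarrow> dual_couplings (K e) (Kd e)"
    and "((n, X), (nd, Y)) \<in> set_pmf (master_law G Gd K Kd)"
  shows "X \<subseteq> verts G" "Y \<subseteq> verts Gd" "odd_part G n = edge_cut Gd Y" "odd_part Gd nd = edge_cut G X"
    "\<And>e. n e = 0 \<or> nd e = 0" "X \<in> cluster_regions G n" "Y \<in> cluster_regions Gd nd"
    "n \<in> sourceless_currents G"
proof -
  obtain c where c: "c > 0" "\<And>a b. pmf (master_law G Gd K Kd) (a, b) = c * master_weight G Gd K Kd a b"
    using pmf_master_law[of K Kd] assms(1) by metis
  have w: "master_weight G Gd K Kd (n, X) (nd, Y) \<noteq> 0"
    using assms(2) c by (metis mult_zero_right set_pmf_iff)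
  thus *: "X \<subseteq> verts G" "Y \<subseteq> verts Gd" "odd_part G n = edge_cut Gd Y" "odd_part Gd nd = edge_cut G X"
    by (auto simp: master_weight_def)
  have out: "n e = 0 \<and> nd e = 0" if "e \<notin> arcs G" for e
    using w that by (auto simp: master_weight_def)
  show disj: "n e = 0 \<or> nd e = 0" for e
  proof (cases "e \<in> arcs G")
    case True
    hence "pair_weight (K e) (Kd e) (n e) (nd e) \<noteq> 0"
      using w finite_arcs_G by (auto simp: master_weight_def)
    thus ?thesis by (auto simp: pair_weight_def split: if_splits)
  qed (use out in auto)
  have "n e = 0" if "e \<in> edge_cut G X" for e
  proof -
    have "odd (nd e)" using that *(4) by (auto simp: odd_part_def)
    thus ?thesis using disj[of e] by (metis even_zero)
  qed
  thus "X \<in> cluster_regions G n" using *(1) by (simp add: cluster_regions_def)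
  have "nd e = 0" if "e \<in> edge_cut Gd Y" for e
  proof -
    have "odd (n e)" using that *(3) by (auto simp: odd_part_def)
    thus ?thesis using disj[of e] by (metis even_zero)
  qed
  thus "Y \<in> cluster_regions Gd nd" using *(2) by (simp add: cluster_regions_def)
  show "n \<in> sourceless_currents G"
    using even_set_iff_cut[of "odd_part G n"] *(2,3) out
    by (auto simp: sourceless_iff_even[OF fin_G] odd_part_def)
qed

end

section \<open>Plane graphs are dual pairs\<close>

text \<open>
  Going once around a cycle, a property changes its truth value an even number of times.
\<close>

lemma cyclic_even_changes:
  fixes P :: "'b \<Rightarrow> bool"
  assumes "cyclic_on r S" "finite S" "\<And>d. d \<in> S \<Longrightarrow> l d = l' (r d)"
  shows "even (card {d \<in> S. P (l d) \<noteq> P (l' d)})"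
proof -
  have "S \<subseteq> r ` S"
  proof
    fix s assume s: "s \<in> S"
    hence "s \<in> orbit r s" using assms(1) by (auto simp: cyclic_on_alldef)
    thus "s \<in> r ` S"
    proof cases
      case (step c)
      thus ?thesis using assms(1) s by (auto simp: cyclic_on_alldef)
    qed (use s in auto)
  qed
  moreover have "r ` S \<subseteq> S" using assms(1) by (auto intro: cyclic_on_inI)
  ultimately have "r ` S = S" by blast
  hence "bij_betw r S S" using assms(2) by (simp add: bij_betw_def finite_surj_inj)
  have "(\<Sum>d\<in>S. of_bool (P (l d))) = (\<Sum>d\<in>S. of_bool (P (l' (r d))) :: nat)"
    using assms(3) by (intro sum.cong) auto
  also have "\<dots> = (\<Sum>d\<in>S. of_bool (P (l' d)))"
    by (rule sum.reindex_bij_betw) fact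
  finally have "even (\<Sum>d\<in>S. of_bool (P (l d)) + of_bool (P (l' d)) :: nat)"
    by (simp add: sum.distrib)
  moreover have "{d \<in> S. odd (of_bool (P (l d)) + of_bool (P (l' d)) :: nat)} = {d \<in> S. P (l d) \<noteq> P (l' d)}"
    by auto
  ultimately show ?thesis using assms(2) by (simp add: even_sum_iff)
qed

text \<open>
  If consecutive elements of a cycle share a side and \<open>f\<close> agrees on the two sides of every element, \<open>f\<close>
  is constant along the cycle.
\<close>

lemma cyclic_constant:
  assumes "cyclic_on r S" "\<And>d. d \<in> S \<Longrightarrow> l d = l' (r d)" "\<And>d. d \<in> S \<Longrightarrow> f (l d) = f (l' d)"
    and "a \<in> S" "b \<in> S"
  shows "f (l a) = f (l b)"
proof -
  have S: "orbit r a = S" using assms(1,4) by (rule orbit_cyclic_eq3)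
  have "b \<in> orbit r a" using S assms(5) by simp
  thus ?thesis
  proof (induction rule: orbit.induct)
    case base
    have "r a \<in> S" using S orbit.base[of r a] by simp
    thus ?case using assms(2)[OF assms(4)] assms(3)[of "r a"] by simp
  next
    case (step c)
    hence "c \<in> S" "r c \<in> S" using S orbit.step[of c r a] by auto
    thus ?case using step.IH assms(2)[of c] assms(3)[of "r c"] by simp
  qed
qed

lemma incident_swap: "arcs Gd = arcs G \<Longrightarrow> incident Gd G u v \<longleftrightarrow> incident G Gd v u"
  by (auto simp: incident_def)

context plane_graph
begin

lemma dart_origin_in_verts:
  assumes "d \<in> arcs G \<times> UNIV"
  shows "dart_origin G d \<in> verts G" "dart_origin Gd d \<in> verts Gd"
proof -
  interpret G: fin_digraph G by (rule fin_G)
  interpret D: fin_digraph Gd by (rule fin_Gd)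
  show "dart_origin G d \<in> verts G" "dart_origin Gd d \<in> verts Gd"
    using assms arcs_Gd by (auto simp: dart_origin_def)
qed

lemma dart_rev_in_darts: "d \<in> arcs G \<times> UNIV \<Longrightarrow> dart_rev d \<in> arcs G \<times> UNIV"
  by (auto simp: dart_rev_def)

lemma dart_rev_rev [simp]: "dart_rev (dart_rev d) = d"
  by (simp add: dart_rev_def)

text \<open>
  The sector between consecutive darts around a vertex belongs to a single face: it lies on
  the left of the first dart and on the right of the second.
\<close>

lemma left_eq_right_rot:
  assumes d: "d \<in> arcs G \<times> UNIV"
  shows "dart_origin Gd d = dart_origin Gd (dart_rev (rot d))"
proof -
  let ?x = "dart_rev (rot d)" and ?u = "dart_origin Gd (dart_rev (rot d))"
  let ?S = "{d \<in> arcs G \<times> UNIV. dart_origin Gd d = ?u}"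
  have "rot d \<in> arcs G \<times> UNIV" using d permutes_in_image[OF rot_permutes] by blast
  hence x: "?x \<in> arcs G \<times> UNIV" by (rule dart_rev_in_darts)
  have "cyclic_on (inv rot \<circ> dart_rev) ?S"
    using d dart_origin_in_verts[OF x] by (intro face_cycles) auto
  hence "(inv rot \<circ> dart_rev) ?x \<in> ?S" by (rule cyclic_on_inI) (intro CollectI conjI x refl)
  moreover have "(inv rot \<circ> dart_rev) ?x = d" by (simp add: permutes_inverses(2)[OF rot_permutes])
  ultimately have "d \<in> ?S" by (simp only:)
  thus ?thesis unfolding mem_Collect_eq by (rule conjunct2)
qed

text \<open>
  The same for the face permutation: the walk along a face continues at the vertex at which the last
  dart ended.
\<close>

lemma target_eq_origin_next:
  assumes d: "d \<in> arcs G \<times> UNIV"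
  shows "dart_origin G (dart_rev d) = dart_origin G ((inv rot \<circ> dart_rev) d)"
proof -
  let ?y = "inv rot (dart_rev d)"
  let ?S = "{d \<in> arcs G \<times> UNIV. dart_origin G d = dart_origin G ?y}"
  have y: "?y \<in> arcs G \<times> UNIV"
    by (rule permutes_in_image[OF permutes_inv[OF rot_permutes], THEN iffD2]) (rule dart_rev_in_darts[OF d])
  have "cyclic_on rot ?S"
    using d dart_origin_in_verts[OF y] by (intro vertex_cycles) auto
  hence "rot ?y \<in> ?S" by (rule cyclic_on_inI) (intro CollectI conjI y refl)
  moreover have "rot ?y = dart_rev d" by (simp add: permutes_inverses(1)[OF rot_permutes])
  ultimately have "dart_rev d \<in> ?S" by (simp only:)
  hence "dart_origin G (dart_rev d) = dart_origin G ?y" unfolding mem_Collect_eq by (rule conjunct2)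
  thus ?thesis by (simp only: o_apply)
qed

lemma constant_around_vertex:
  assumes "\<And>e. e \<in> arcs G \<Longrightarrow> v \<in> {tail G e, head G e} \<Longrightarrow> f (tail Gd e) = f (head Gd e)"
    and d: "d \<in> arcs G \<times> UNIV" "dart_origin G d = v" "d' \<in> arcs G \<times> UNIV" "dart_origin G d' = v"
  shows "f (dart_origin Gd d) = f (dart_origin Gd d')"
proof -
  have eq: "f (dart_origin Gd d) = f (dart_origin Gd (dart_rev d))"
    if "d \<in> arcs G \<times> UNIV" "dart_origin G d = v" for d
    using that assms(1)[of "fst d"] by (auto simp: dart_origin_def dart_rev_def split: if_splits)
  show ?thesis
  proof (rule cyclic_constant[where r = rot and S = "{d \<in> arcs G \<times> UNIV. dart_origin G d = v}"
        and l' = "\<lambda>d. dart_origin Gd (dart_rev d)"])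
    show "cyclic_on rot {d \<in> arcs G \<times> UNIV. dart_origin G d = v}"
      using d dart_origin_in_verts(1)[OF d(1)] by (intro vertex_cycles) auto
  qed (use d eq left_eq_right_rot in blast)+
qed

lemma constant_around_face:
  assumes "\<And>e. e \<in> arcs G \<Longrightarrow> u \<in> {tail Gd e, head Gd e} \<Longrightarrow> f (tail G e) = f (head G e)"
    and d: "d \<in> arcs G \<times> UNIV" "dart_origin Gd d = u" "d' \<in> arcs G \<times> UNIV" "dart_origin Gd d' = u"
  shows "f (dart_origin G d) = f (dart_origin G d')"
proof -
  have eq: "f (dart_origin G (dart_rev d)) = f (dart_origin G d)"
    if "d \<in> arcs G \<times> UNIV" "dart_origin Gd d = u" for d
    using that assms(1)[of "fst d"] by (auto simp: dart_origin_def dart_rev_def split: if_splits)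
  have "f (dart_origin G (dart_rev d)) = f (dart_origin G (dart_rev d'))"
  proof (rule cyclic_constant[where r = "inv rot \<circ> dart_rev" and l' = "dart_origin G"
        and l = "\<lambda>d. dart_origin G (dart_rev d)" and S = "{d \<in> arcs G \<times> UNIV. dart_origin Gd d = u}"])
    show "cyclic_on (inv rot \<circ> dart_rev) {d \<in> arcs G \<times> UNIV. dart_origin Gd d = u}"
      using d dart_origin_in_verts(2)[OF d(1)] by (intro face_cycles) auto
  qed (use d eq target_eq_origin_next in auto)
  thus ?thesis using eq d by simp
qed

text \<open>
  Around a vertex the faces change between \<open>Y\<close> and its complement an even number of times. A loop is
  met by two darts and contributes an even number, in accordance with not belonging to the star.
\<close>

lemma even_set_edge_cut_dual: "even_set G (edge_cut Gd Y)"
proof -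
  interpret G: fin_digraph G by (rule fin_G)
  have fin: "finite (edge_cut Gd Y)" by (rule finite_edge_cut[OF fin_Gd])
  have "even (card (edge_cut Gd Y \<inter> edge_cut G {v}))" if v: "v \<in> verts G" for v
  proof (cases "arcs G = {}")
    case False
    let ?S = "{d \<in> arcs G \<times> UNIV. dart_origin G d = v}"
    let ?O = "{e \<in> edge_cut Gd Y. tail G e = v}" and ?I = "{e \<in> edge_cut Gd Y. head G e = v}"
    have S: "finite ?S" by simp
    have "cyclic_on rot ?S" using False v by (rule vertex_cycles)
    hence "even (card {d \<in> ?S. (dart_origin Gd d \<in> Y) \<noteq> (dart_origin Gd (dart_rev d) \<in> Y)})"
      using S by (rule cyclic_even_changes) (use left_eq_right_rot in auto)
    also have "{d \<in> ?S. (dart_origin Gd d \<in> Y) \<noteq> (dart_origin Gd (dart_rev d) \<in> Y)} =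
        (\<lambda>e. (e, True)) ` ?O \<union> (\<lambda>e. (e, False)) ` ?I"
      using arcs_Gd by (auto simp: edge_cut_def dart_origin_def dart_rev_def image_iff split: if_splits)
    also have "card \<dots> = card ?O + card ?I"
      using fin by (subst card_Un_disjoint) (auto simp: card_image inj_on_def)
    finally have "even (card (sym_diff ?O ?I))" using fin by (simp add: even_card_sym_diff)
    moreover have "edge_cut Gd Y \<inter> edge_cut G {v} = sym_diff ?O ?I"
      using edge_cut_subset[of Gd Y] arcs_Gd by (auto simp: edge_cut_def)
    ultimately show ?thesis by simp
  qed (simp add: edge_cut_def)
  thus ?thesis using even_set_iff_stars[OF fin_G fin] by blast
qed

lemma dart_at_face:
  assumes "arcs G \<noteq> {}" "u \<in> verts Gd"
  obtains d where "d \<in> arcs G \<times> UNIV" "dart_origin Gd d = u"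
  using face_cycles[OF assms] by (auto simp: cyclic_on_def)

lemma no_arcs_singletons:
  assumes "arcs G = {}"
  shows "card (verts G) = 1" "card (verts Gd) = 1"
proof -
  obtain v where v: "v \<in> verts G" using connected_verts_nonempty[OF conn_G] by blast
  hence "verts G = {v}"
    using fin_digraph.connected_closed[OF fin_G conn_G, of "{v}"] assms by (auto simp: edge_cut_def)
  thus "card (verts G) = 1" by simp
  thus "card (verts Gd) = 1" using euler assms by simp
qed

text \<open>
  Let \<open>Y\<close> be a set of faces that no edge separates from its complement. The faces around a vertex are all
  in \<open>Y\<close> or all outside, and adjacent vertices behave alike because the two sides of their edge are met
  by both. By connectedness of the graph all vertices behave alike.
\<close>

lemma conn_Gd: "connected Gd"
proof (cases "arcs G = {}")
  case True
  obtain u where "verts Gd = {u}" using no_arcs_singletons(2)[OF True] by (rule card_1_singletonE)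
  thus ?thesis using fin_digraph.connectedI[OF fin_Gd] by auto
next
  case False
  interpret G: fin_digraph G by (rule fin_G)
  interpret D: fin_digraph Gd by (rule fin_Gd)
  show ?thesis
  proof (rule D.connectedI)
    show "verts Gd \<noteq> {}" using False arcs_Gd D.tail_in_verts by fastforce
    fix Y assume Y: "Y \<subseteq> verts Gd" "edge_cut Gd Y = {}" "Y \<noteq> {}"
    have same: "(tail Gd e \<in> Y) = (head Gd e \<in> Y)" if "e \<in> arcs G" for e
      using Y(2) that arcs_Gd by (auto simp: edge_cut_def)
    have around: "(dart_origin Gd d \<in> Y) = (dart_origin Gd d' \<in> Y)"
      if "d \<in> arcs G \<times> UNIV" "d' \<in> arcs G \<times> UNIV" "dart_origin G d = dart_origin G d'" for d d'
      by (rule constant_around_vertex[where f = "\<lambda>u. u \<in> Y" and v = "dart_origin G d"])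
         (use that same in auto)
    \<comment> \<open>the vertices that see a face of \<open>Y\<close>\<close>
    define X where "X = dart_origin G ` {d \<in> arcs G \<times> UNIV. dart_origin Gd d \<in> Y}"
    have X_iff: "dart_origin G d \<in> X \<longleftrightarrow> dart_origin Gd d \<in> Y" if "d \<in> arcs G \<times> UNIV" for d
    proof
      assume "dart_origin G d \<in> X"
      then obtain d' where "d' \<in> arcs G \<times> UNIV" "dart_origin Gd d' \<in> Y" "dart_origin G d = dart_origin G d'"
        unfolding X_def by blast
      thus "dart_origin Gd d \<in> Y" using around[OF that] by simp
    next
      assume "dart_origin Gd d \<in> Y"
      thus "dart_origin G d \<in> X" unfolding X_def using that by blast
    qed
    have "(tail G e \<in> X) = (head G e \<in> X)" if "e \<in> arcs G" for e
      using X_iff[of "(e, True)"] X_iff[of "(e, False)"] same[OF that] that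
      by (simp add: dart_origin_def)
    hence "edge_cut G X = {}" by (auto simp: edge_cut_def)
    moreover have "X \<subseteq> verts G" using dart_origin_in_verts(1) by (auto simp: X_def)
    moreover have "X \<noteq> {}"
    proof -
      obtain u where "u \<in> Y" using Y(3) by blast
      then obtain d where "d \<in> arcs G \<times> UNIV" "dart_origin Gd d = u"
        using dart_at_face[OF False] Y(1) by blast
      thus ?thesis using \<open>u \<in> Y\<close> by (auto simp: X_def)
    qed
    ultimately have X: "X = verts G" using G.connected_closed[OF conn_G] by blast
    have "u \<in> Y" if u: "u \<in> verts Gd" for u
    proof -
      obtain d where d: "d \<in> arcs G \<times> UNIV" "dart_origin Gd d = u"
        using dart_at_face[OF False u] .
      thus ?thesis using X_iff[OF d(1)] dart_origin_in_verts(1)[OF d(1)] X by simp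
    qed
    thus "Y = verts Gd" using Y(1) by blast
  qed
qed

text \<open>
  The cuts of the dual are even, and Euler's formula says that there are as many of them as even sets.
\<close>

lemma dual_pair: "dual_pair G Gd"
proof (rule dual_pair.intro[OF fin_G fin_Gd conn_G conn_Gd arcs_Gd])
  fix A assume A: "A \<subseteq> arcs G"
  let ?E = "{A. A \<subseteq> arcs G \<and> even_set G A}" and ?C = "edge_cut Gd ` Pow (verts Gd)"
  have "card ?C * 2 ^ card (verts G) * 2 = 2 ^ card (verts Gd) * 2 ^ card (verts G)"
    using card_edge_cuts[OF fin_Gd conn_Gd] by simp
  also have "\<dots> = 2 ^ (card (verts G) + card (verts Gd))" by (simp add: power_add)
  also have "\<dots> = card ?E * 2 ^ card (verts G) * 2"
    using card_even_sets[OF fin_G conn_G] by (simp add: euler)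
  finally have "card ?C = card ?E" by simp
  moreover have "?C \<subseteq> ?E"
    using even_set_edge_cut_dual edge_cut_subset[of Gd] arcs_Gd by auto
  moreover have "finite ?E" using fin_digraph.finite_arcs[OF fin_G] by simp
  ultimately have eq: "?C = ?E" by (metis card_subset_eq)
  have "even_set G A \<longleftrightarrow> A \<in> ?E" using A by simp
  also have "\<dots> \<longleftrightarrow> A \<in> ?C" by (simp only: eq)
  finally show "even_set G A \<longleftrightarrow> (\<exists>Y\<subseteq>verts Gd. A = edge_cut Gd Y)" by auto
qed

lemma incident_faces_chain:
  assumes u: "incident G Gd v u" "incident G Gd v u'"
    and f: "\<And>e. e \<in> arcs G \<Longrightarrow> v \<in> {tail G e, head G e} \<Longrightarrow> f (tail Gd e) = f (head Gd e)"
  shows "f u = f u'"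
proof (cases "arcs G = {}")
  case True
  obtain w where "verts Gd = {w}" using no_arcs_singletons(2)[OF True] by (rule card_1_singletonE)
  hence "u = w" "u' = w" using u by (simp_all add: incident_def)
  thus ?thesis by simp
next
  case False
  have "\<exists>d. d \<in> arcs G \<times> UNIV \<and> dart_origin G d = v \<and> f (dart_origin Gd d) = f u" if inc: "incident G Gd v u" for u
  proof -
    obtain e where "e \<in> arcs G" "v \<in> {tail G e, head G e}" "u \<in> {tail Gd e, head Gd e}"
      using inc False by (auto simp: incident_def)
    thus ?thesis
      using f[of e] by (intro exI[of _ "(e, v = tail G e)"]) (auto simp: dart_origin_def)
  qed
  thus ?thesis using u constant_around_vertex[where v = v and f = f, OF f] by metis
qed

lemma incident_vertices_chain:
  assumes v: "incident G Gd v u" "incident G Gd v' u"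
    and f: "\<And>e. e \<in> arcs G \<Longrightarrow> u \<in> {tail Gd e, head Gd e} \<Longrightarrow> f (tail G e) = f (head G e)"
  shows "f v = f v'"
proof (cases "arcs G = {}")
  case True
  obtain w where "verts G = {w}" using no_arcs_singletons(1)[OF True] by (rule card_1_singletonE)
  hence "v = w" "v' = w" using v by (simp_all add: incident_def)
  thus ?thesis by simp
next
  case False
  have "\<exists>d. d \<in> arcs G \<times> UNIV \<and> dart_origin Gd d = u \<and> f (dart_origin G d) = f v" if inc: "incident G Gd v u" for v
  proof -
    obtain e where "e \<in> arcs G" "v \<in> {tail G e, head G e}" "u \<in> {tail Gd e, head Gd e}"
      using inc False by (auto simp: incident_def)
    thus ?thesis
      using f[of e] by (intro exI[of _ "(e, u = tail Gd e)"]) (auto simp: dart_origin_def)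
  qed
  thus ?thesis using v constant_around_face[of u f, OF f] by metis
qed

end

section \<open>Exploring a cluster\<close>

lemma edge_cut_cluster:
  assumes "fin_digraph G" "C \<in> clusters G n" "e \<in> edge_cut G C"
  shows "n e = 0"
proof -
  have "edge_cut G C \<inter> {e. n e > 0} = {}"
    using fin_digraph.edge_cut_component[OF fin_digraph_spanning_subgraph[OF assms(1)]] assms(2)
    unfolding clusters_def edge_cut_spanning_subgraph by blast
  thus ?thesis using assms(3) by auto
qed

text \<open>
  Being a cluster is decided by the current on the edges that touch it. Hence an exploration that
  reveals these edges determines the event that the set is a cluster.
\<close>

lemma cluster_local:
  assumes G: "fin_digraph G" and C: "C \<in> clusters G n"
    and eq: "\<And>e. e \<in> arcs G \<Longrightarrow> tail G e \<in> C \<or> head G e \<in> C \<Longrightarrow> n' e = n e"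
  shows "C \<in> clusters G n'"
proof -
  let ?H = "\<lambda>n. spanning_subgraph G {e. (0::nat) < n e}"
  have fin: "fin_digraph (?H n)" for n by (rule fin_digraph_spanning_subgraph[OF G])
  have cut: "edge_cut (?H n') X = edge_cut (?H n) X" if "X \<subseteq> C" for X
    unfolding edge_cut_spanning_subgraph using that eq by (auto simp: edge_cut_def)
  have C': "C \<in> components (?H n)" using C by (simp add: clusters_def)
  show ?thesis
    unfolding clusters_def
  proof (rule fin_digraph.componentsI[OF fin])
    show "C \<noteq> {}" by (rule fin_digraph.component_nonempty[OF fin C'])
    show "C \<subseteq> verts (?H n')" using fin_digraph.component_subset[OF fin C'] by simp
    show "edge_cut (?H n') C = {}" using fin_digraph.edge_cut_component[OF fin C'] cut by simp
    fix X assume X: "X \<subseteq> C" "X \<noteq> {}" "edge_cut (?H n') X = {}"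
    hence "edge_cut (?H n) X = {}" using cut by simp
    thus "X = C" using fin_digraph.component_subset_closed[OF fin C'] X by blast
  qed
qed

lemma fin_digraph_induce_subgraph:
  assumes "fin_digraph G" and "W \<subseteq> verts G" shows "fin_digraph (G \<restriction> W)"
proof -
  interpret fin_digraph G by (rule assms)
  show ?thesis using finite_subset[OF assms(2)] by unfold_locales auto
qed

lemma edge_cut_induce_subgraph:
  "edge_cut (G \<restriction> W) X = edge_cut G X \<inter> arcs (G \<restriction> W)"
  by (auto simp: edge_cut_def induce_subgraph_def)

lemma edge_cut_induce_subgraph_Int:
  "edge_cut (G \<restriction> W) (X \<inter> W) = edge_cut (G \<restriction> W) X"
  by (auto simp: edge_cut_def induce_subgraph_def)

lemma even_set_induce_subgraph:
  assumes "W \<subseteq> verts G" "A \<subseteq> arcs (G \<restriction> W)"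
  shows "even_set (G \<restriction> W) A \<longleftrightarrow> even_set G A"
proof -
  have eq: "A \<inter> edge_cut (G \<restriction> W) (X \<inter> W) = A \<inter> edge_cut G X" for X
    using assms(2) unfolding edge_cut_induce_subgraph_Int by (auto simp: edge_cut_induce_subgraph)
  show ?thesis
  proof
    assume *: "even_set (G \<restriction> W) A"
    show "even_set G A"
      unfolding even_set_def
    proof (intro allI impI)
      fix X
      have "X \<inter> W \<subseteq> verts (G \<restriction> W)" by simp
      hence "even (card (A \<inter> edge_cut (G \<restriction> W) (X \<inter> W)))" using * unfolding even_set_def by blast
      thus "even (card (A \<inter> edge_cut G X))" by (simp only: eq)
    qed
  next
    assume *: "even_set G A"
    show "even_set (G \<restriction> W) A"
      unfolding even_set_def
    proof (intro allI impI)
      fix X assume X: "X \<subseteq> verts (G \<restriction> W)"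
      hence "X \<inter> W = X" "X \<subseteq> verts G" using assms(1) by auto
      thus "even (card (A \<inter> edge_cut (G \<restriction> W) X))" using * eq[of X] by (simp add: even_set_def)
    qed
  qed
qed

lemma connected_induce_component:
  assumes G: "fin_digraph G" and S: "S \<subseteq> verts G" and W: "W \<in> components (G \<restriction> S)"
  shows "connected (G \<restriction> W)"
proof -
  have fin: "fin_digraph (G \<restriction> S)" by (rule fin_digraph_induce_subgraph[OF G S])
  have sub: "W \<subseteq> S" using fin_digraph.component_subset[OF fin W] by simp
  show ?thesis
  proof (rule fin_digraph.connectedI[OF fin_digraph_induce_subgraph[OF G]])
    show "W \<subseteq> verts G" using sub S by blast
    show "verts (G \<restriction> W) \<noteq> {}" using fin_digraph.component_nonempty[OF fin W] by simp
    fix X assume X: "X \<subseteq> verts (G \<restriction> W)" "edge_cut (G \<restriction> W) X = {}" "X \<noteq> {}"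
    have "edge_cut (G \<restriction> S) X = {}"
    proof (rule ccontr)
      assume "edge_cut (G \<restriction> S) X \<noteq> {}"
      then obtain e where e: "e \<in> edge_cut (G \<restriction> S) X" by blast
      hence "e \<in> arcs (G \<restriction> S)" "tail G e \<in> W \<or> head G e \<in> W"
        using X(1) by (auto simp: edge_cut_def)
      hence "tail G e \<in> W" "head G e \<in> W"
        using fin_digraph.edge_cut_component[OF fin W] by (auto simp: edge_cut_def)
      hence "e \<in> edge_cut (G \<restriction> W) X" using e by (auto simp: edge_cut_def)
      thus False using X(2) by simp
    qed
    hence "W \<subseteq> X" using fin_digraph.component_subset_closed[OF fin W] X by auto
    thus "X = verts (G \<restriction> W)" using X(1) by auto
  qed
qed

lemma (in fin_digraph) component_of_mem_iff:
  assumes "Z \<subseteq> components G" "v \<in> verts G"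
  shows "component_of G v \<in> Z \<longleftrightarrow> v \<in> \<Union>Z"
proof
  assume "v \<in> \<Union>Z"
  then obtain C where "C \<in> Z" "v \<in> C" by blast
  thus "component_of G v \<in> Z" using component_of_eq assms(1) by (metis subsetD)
qed (use component_of_self[OF assms(2)] in blast)

lemma fin_digraph_subgraph_dual:
  assumes "fin_digraph Gd" shows "fin_digraph (subgraph_dual Gd A)"
proof -
  interpret D: fin_digraph Gd by (rule assms)
  interpret R: fin_digraph "spanning_subgraph Gd (- A)" by (rule fin_digraph_spanning_subgraph[OF assms])
  show ?thesis
    by unfold_locales
      (auto simp: subgraph_dual_def Let_def intro: R.component_of_component R.finite_components)
qed

text \<open>
  A set of contracted vertices has no contracted edge in its cut, so contraction turns the cuts of the
  dual that avoid the contracted edges into the cuts of the contracted graph, and conversely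
  (\<open>closed_Union_subgraph_dual\<close>).
\<close>

lemma edge_cut_subgraph_dual:
  assumes Gd: "fin_digraph Gd" and Z: "Z \<subseteq> verts (subgraph_dual Gd A)"
  shows "edge_cut (subgraph_dual Gd A) Z = edge_cut Gd (\<Union>Z)"
proof -
  interpret D: fin_digraph Gd by (rule Gd)
  interpret R: fin_digraph "spanning_subgraph Gd (- A)" by (rule fin_digraph_spanning_subgraph[OF Gd])
  have Z': "Z \<subseteq> components (spanning_subgraph Gd (- A))"
    using Z by (simp add: subgraph_dual_def Let_def)
  have "edge_cut Gd (\<Union>Z) \<subseteq> A"
    using R.edge_cut_Union_components[OF Z'] by (auto simp: edge_cut_spanning_subgraph)
  moreover have "component_of (spanning_subgraph Gd (- A)) v \<in> Z \<longleftrightarrow> v \<in> \<Union>Z" if "v \<in> verts Gd" for v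
    using R.component_of_mem_iff[OF Z', of v] that by simp
  ultimately show ?thesis
    by (auto simp: edge_cut_def subgraph_dual_def Let_def)
qed

lemma closed_Union_subgraph_dual:
  assumes Gd: "fin_digraph Gd" and Y: "Y \<subseteq> verts Gd" "edge_cut Gd Y \<subseteq> A"
  obtains Z where "Z \<subseteq> verts (subgraph_dual Gd A)" "\<Union>Z = Y"
proof
  interpret R: fin_digraph "spanning_subgraph Gd (- A)" by (rule fin_digraph_spanning_subgraph[OF Gd])
  let ?Z = "{C \<in> components (spanning_subgraph Gd (- A)). C \<subseteq> Y}"
  show "?Z \<subseteq> verts (subgraph_dual Gd A)" by (auto simp: subgraph_dual_def Let_def)
  show "\<Union>?Z = Y" using Y by (intro R.closed_eq_Union) (auto simp: edge_cut_spanning_subgraph)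
qed

lemma arcs_subgraph_dual: "arcs (subgraph_dual Gd A) = arcs Gd \<inter> A"
  by (simp add: subgraph_dual_def Let_def)

lemma connected_subgraph_dual:
  assumes Gd: "fin_digraph Gd" "connected Gd"
  shows "connected (subgraph_dual Gd A)"
proof (rule fin_digraph.connectedI[OF fin_digraph_subgraph_dual[OF Gd(1)]])
  interpret R: fin_digraph "spanning_subgraph Gd (- A)" by (rule fin_digraph_spanning_subgraph[OF Gd(1)])
  have V: "verts (subgraph_dual Gd A) = components (spanning_subgraph Gd (- A))"
    by (simp add: subgraph_dual_def Let_def)
  obtain v where "v \<in> verts Gd" using connected_verts_nonempty[OF Gd(2)] by blast
  thus "verts (subgraph_dual Gd A) \<noteq> {}" unfolding V using R.component_of_component[of v] by auto
  fix Z assume Z: "Z \<subseteq> verts (subgraph_dual Gd A)" "edge_cut (subgraph_dual Gd A) Z = {}" "Z \<noteq> {}"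
  have "edge_cut Gd (\<Union>Z) = {}" using Z(2) edge_cut_subgraph_dual[OF Gd(1) Z(1)] by simp
  moreover have "\<Union>Z \<subseteq> verts Gd" using Z(1) R.component_subset unfolding V by auto
  moreover have "\<Union>Z \<noteq> {}" using Z(1,3) R.component_nonempty unfolding V by blast
  ultimately have "\<Union>Z = verts Gd" using fin_digraph.connected_closed[OF Gd] by blast
  hence "C \<in> Z" if "C \<in> components (spanning_subgraph Gd (- A))" for C
    using R.component_subset_Union_iff[of Z C] R.component_subset[OF that] that Z(1) unfolding V by simp
  thus "Z = verts (subgraph_dual Gd A)" using Z(1) unfolding V by blast
qed

text \<open>
  Even sets of an induced subgraph are the even sets contained in it, that is, the dual cuts that avoid
  all deleted edges, that is, the cuts of the contracted dual.
\<close>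

lemma (in dual_pair) dual_pair_induce_subgraph:
  assumes W: "W \<subseteq> verts G" and conn: "connected (G \<restriction> W)"
  shows "dual_pair (G \<restriction> W) (subgraph_dual Gd (arcs (G \<restriction> W)))"
proof (rule dual_pair.intro)
  let ?E = "arcs (G \<restriction> W)" and ?D = "subgraph_dual Gd (arcs (G \<restriction> W))"
  show "fin_digraph (G \<restriction> W)" "fin_digraph ?D" "connected (G \<restriction> W)" "connected ?D"
    by (intro fin_digraph_induce_subgraph fin_digraph_subgraph_dual connected_subgraph_dual
        fin_G fin_Gd conn conn_Gd W)+
  show "arcs ?D = ?E" using arcs_Gd by (auto simp: arcs_subgraph_dual)
  fix A assume A: "A \<subseteq> ?E"
  hence "A \<subseteq> arcs G" by auto
  have "even_set (G \<restriction> W) A \<longleftrightarrow> (\<exists>Y\<subseteq>verts Gd. A = edge_cut Gd Y)"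
    using even_set_induce_subgraph[OF W A] even_set_iff_cut[OF \<open>A \<subseteq> arcs G\<close>] by simp
  also have "\<dots> \<longleftrightarrow> (\<exists>Z\<subseteq>verts ?D. A = edge_cut ?D Z)"
  proof
    assume "\<exists>Y\<subseteq>verts Gd. A = edge_cut Gd Y"
    then obtain Y where Y: "Y \<subseteq> verts Gd" "A = edge_cut Gd Y" by blast
    obtain Z where "Z \<subseteq> verts ?D" "\<Union>Z = Y"
      using closed_Union_subgraph_dual[OF fin_Gd Y(1), of ?E] A Y(2) by auto
    thus "\<exists>Z\<subseteq>verts ?D. A = edge_cut ?D Z"
      using edge_cut_subgraph_dual[OF fin_Gd, of Z ?E] Y(2) by auto
  next
    assume "\<exists>Z\<subseteq>verts ?D. A = edge_cut ?D Z"
    then obtain Z where Z: "Z \<subseteq> verts ?D" "A = edge_cut ?D Z" by blast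
    hence "A = edge_cut Gd (\<Union>Z)" using edge_cut_subgraph_dual[OF fin_Gd] by simp
    hence "A = edge_cut Gd (\<Union>Z \<inter> verts Gd)" by (simp add: edge_cut_Int_verts[OF fin_Gd])
    thus "\<exists>Y\<subseteq>verts Gd. A = edge_cut Gd Y"
      by (intro exI[of _ "\<Union>Z \<inter> verts Gd"] conjI Int_lower2)
  qed
  finally show "even_set (G \<restriction> W) A \<longleftrightarrow> (\<exists>Z\<subseteq>verts ?D. A = edge_cut ?D Z)" .
qed

text \<open>
  If on the conditioning event the density is a product of a function of \<open>y\<close> and a function of a
  complementary coordinate \<open>z\<close>, the conditional law of \<open>y\<close> has density proportional to the first factor.
\<close>

lemma pmf_map_cond_factor:
  fixes R :: "'a pmf" and \<rho> :: "'a \<Rightarrow> 'y" and \<phi> :: "'y \<Rightarrow> 'z \<Rightarrow> 'a"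
  assumes ne: "set_pmf R \<inter> A \<noteq> {}"
    and bij: "\<And>y. y \<in> Y \<Longrightarrow> bij_betw (\<phi> y) Z {x. \<rho> x = y}"
    and \<rho>: "\<And>x. \<rho> x \<in> Y"
    and factor: "\<And>y z. y \<in> Y \<Longrightarrow> z \<in> Z \<Longrightarrow> pmf R (\<phi> y z) * of_bool (\<phi> y z \<in> A) = a y * b z"
    and a: "\<And>y. y \<notin> Y \<Longrightarrow> a y = 0"
  shows "pmf (map_pmf \<rho> (cond_pmf R A)) y = (infsum b Z / measure_pmf.prob R A) * a y"
proof (cases "y \<in> Y")
  case False
  have "y \<notin> set_pmf (map_pmf \<rho> (cond_pmf R A))" using \<rho> False by auto
  hence "pmf (map_pmf \<rho> (cond_pmf R A)) y = 0" by (rule pmf_eq_0_set_pmf[THEN iffD2])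
  thus ?thesis using a[OF False] by simp
next
  case True
  have sum: "measure_pmf.prob p S = infsum (pmf p) S" for p :: "'a pmf" and S
    by (simp add: measure_pmf_conv_infsetsum infsetsum_infsum[OF pmf_abs_summable])
  have c: "pmf (cond_pmf R A) x = pmf R x * of_bool (x \<in> A) / measure_pmf.prob R A" for x
    by (simp add: pmf_cond[OF ne])
  have "pmf (map_pmf \<rho> (cond_pmf R A)) y = infsum (pmf (cond_pmf R A)) {x. \<rho> x = y}"
    by (simp add: pmf_map vimage_def sum)
  also have "\<dots> = infsum (\<lambda>z. pmf (cond_pmf R A) (\<phi> y z)) Z"
    by (rule infsum_reindex_bij_betw[OF bij[OF True], symmetric])
  also have "\<dots> = infsum (\<lambda>z. (a y / measure_pmf.prob R A) * b z) Z"
    by (intro infsum_cong) (simp add: c factor[OF True])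
  also have "\<dots> = (a y / measure_pmf.prob R A) * infsum b Z" by (rule infsum_cmult_right')
  finally show ?thesis by simp
qed

lemma cond_bind_pmf_fst:
  assumes ne: "set_pmf R \<inter> A \<noteq> {}"
  shows "cond_pmf (do {x \<leftarrow> R; y \<leftarrow> k x; return_pmf (x, y)}) {(x, y). x \<in> A} =
    do {x \<leftarrow> cond_pmf R A; y \<leftarrow> k x; return_pmf (x, y)}" (is "cond_pmf ?J ?A = ?R")
proof (rule pmf_eqI)
  fix z :: "'a \<times> 'b"
  obtain x y where z: "z = (x, y)" by (cases z)
  have fst: "map_pmf fst ?J = R" by (simp add: map_bind_pmf bind_return_pmf')
  have "measure_pmf.prob ?J ?A = measure_pmf.prob (map_pmf fst ?J) A"
    unfolding measure_map_pmf by (intro arg_cong[of _ _ "measure_pmf.prob ?J"]) auto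
  hence prob: "measure_pmf.prob ?J ?A = measure_pmf.prob R A" by (simp only: fst)
  obtain x0 where "x0 \<in> set_pmf R" "x0 \<in> A" using ne by blast
  moreover obtain y0 where "y0 \<in> set_pmf (k x0)" using set_pmf_not_empty[of "k x0"] by blast
  ultimately have "(x0, y0) \<in> set_pmf ?J \<inter> ?A" by auto
  hence "set_pmf ?J \<inter> ?A \<noteq> {}" by blast
  hence "pmf (cond_pmf ?J ?A) (x, y) = (if (x, y) \<in> ?A then pmf ?J (x, y) / measure_pmf.prob ?J ?A else 0)"
    by (rule pmf_cond)
  also have "\<dots> = (if x \<in> A then pmf R x * pmf (k x) y / measure_pmf.prob R A else 0)"
    by (simp only: pmf_bind_Pair prob mem_Collect_eq prod.case)
  also have "\<dots> = pmf ?R (x, y)"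
    unfolding pmf_bind_Pair pmf_cond[OF ne] by simp
  finally show "pmf (cond_pmf ?J ?A) z = pmf ?R z" unfolding z .
qed

context dual_pair
begin

text \<open>
  On the conditioning event \<open>n\<close> vanishes on the edges that leave \<open>W\<close>, all of which lead to \<open>C\<close>. Therefore
  the constraints (sourceless, vanishing on the cut of \<open>X\<close>) and the weight split
  into a part inside \<open>W\<close> and a part outside, and the event itself concerns only the outside.
\<close>

lemma region_law_restricted:
  assumes K: "\<And>e. e \<in> arcs G \<Longrightarrow> K e > 0"
    and C: "C \<subseteq> verts G" and W: "W \<in> components (G \<restriction> (verts G - C))"
    and F: "{e \<in> arcs G. tail G e \<in> C \<or> head G e \<in> C} \<subseteq> F" "F \<subseteq> arcs G - arcs (G \<restriction> W)"
    and ne: "set_pmf (region_law G K) \<inter> {a. C \<in> clusters G (fst a) \<and> (\<forall>e\<in>F. fst a e = m e)} \<noteq> {}"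
  shows "map_pmf (\<lambda>a. ((\<lambda>e. if e \<in> arcs (G \<restriction> W) then fst a e else 0), snd a \<inter> W))
      (cond_pmf (region_law G K) {a. C \<in> clusters G (fst a) \<and> (\<forall>e\<in>F. fst a e = m e)}) =
    region_law (G \<restriction> W) K"
proof -
  let ?H = "G \<restriction> W" and ?E = "arcs (G \<restriction> W)" and ?R = "region_law G K"
  let ?A = "{a. C \<in> clusters G (fst a) \<and> (\<forall>e\<in>F. fst a e = m e)}"
  let ?\<rho> = "\<lambda>a :: ('e \<Rightarrow> nat) \<times> 'v set. ((\<lambda>e. if e \<in> ?E then fst a e else 0), snd a \<inter> W)"
  let ?Y = "{(x, s). (\<forall>e. e \<notin> ?E \<longrightarrow> x e = (0::nat)) \<and> s \<subseteq> W}"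
  let ?Z = "{(n', t). (\<forall>e\<in>?E. n' e = (0::nat)) \<and> t \<inter> W = {}}"
  let ?\<phi> = "\<lambda>y z. ((\<lambda>e. if e \<in> ?E then fst y e else fst z e), snd y \<union> snd z)"
  have finS: "fin_digraph (G \<restriction> (verts G - C))" by (rule fin_digraph_induce_subgraph[OF fin_G]) auto
  have WV: "W \<subseteq> verts G - C" using fin_digraph.component_subset[OF finS W] by simp
  hence WG: "W \<subseteq> verts G" by blast
  have finH: "fin_digraph ?H" by (rule fin_digraph_induce_subgraph[OF fin_G WG])
  have EG: "?E \<subseteq> arcs G" by auto
  have HE: "e \<in> ?E \<longleftrightarrow> e \<in> arcs G \<and> tail G e \<in> W \<and> head G e \<in> W" for e by auto
  obtain c where c: "c > 0" "\<And>n X. pmf ?R (n, X) =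
      c * (of_bool (n \<in> sourceless_currents G \<and> X \<in> cluster_regions G n) * double_weight G K n)"
    using pmf_region_law[of G K] fin_G K by metis
  have KH: "K e > 0" if "e \<in> ?E" for e using that K EG by blast
  obtain d where d: "d > 0" "\<And>n X. pmf (region_law ?H K) (n, X) =
      d * (of_bool (n \<in> sourceless_currents ?H \<and> X \<in> cluster_regions ?H n) * double_weight ?H K n)"
    using pmf_region_law[of ?H K] finH KH by metis
  \<comment> \<open>a possible outcome of the exploration; it certifies that any current equal to \<open>m\<close> on \<open>F\<close> has \<open>C\<close> as a cluster\<close>
  obtain n0 where n0: "C \<in> clusters G n0" "\<And>e. e \<in> F \<Longrightarrow> n0 e = m e" using ne by auto
  have m0: "e \<in> F \<and> m e = 0" if "e \<in> arcs G" "e \<notin> ?E" "tail G e \<in> W \<or> head G e \<in> W" for e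
  proof -
    have "tail G e \<in> C \<or> head G e \<in> C"
    proof (rule ccontr)
      assume not: "\<not> (tail G e \<in> C \<or> head G e \<in> C)"
      interpret G: fin_digraph G by (rule fin_G)
      have "e \<in> arcs (G \<restriction> (verts G - C))" using not that(1) by auto
      hence "(tail G e \<in> W) = (head G e \<in> W)"
        using fin_digraph.edge_cut_component[OF finS W] by (auto simp: edge_cut_def)
      thus False using that HE by blast
    qed
    moreover from this have "e \<in> edge_cut G C" using that WV by (auto simp: edge_cut_def)
    ultimately show ?thesis
      using edge_cut_cluster[OF fin_G n0(1)] n0(2) F(1) that(1) by fastforce
  qed
  define a where "a y = (case y of (x, s) \<Rightarrow>
    of_bool (x \<in> sourceless_currents ?H \<and> s \<in> cluster_regions ?H x) * double_weight ?H K x)"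
    for y :: "('e \<Rightarrow> nat) \<times> 'v set"
  define b where "b z = (case z of (n', t) \<Rightarrow>
    c * (of_bool ((\<forall>e\<in>F. n' e = m e) \<and> n' \<in> sourceless_currents G \<and> t \<in> cluster_regions G n') *
      (\<Prod>e\<in>arcs G - ?E. (2 * K e) ^ n' e / fact (n' e))))"
    for z :: "('e \<Rightarrow> nat) \<times> 'v set"
  \<comment> \<open>\<open>y\<close> is the configuration inside \<open>W\<close>, \<open>z\<close> the one outside, and \<open>?\<phi>\<close> glues them\<close>
  have factor: "pmf ?R (?\<phi> y z) * of_bool (?\<phi> y z \<in> ?A) = a y * b z" if y: "y \<in> ?Y" and z: "z \<in> ?Z" for y z
  proof -
    obtain x s where y': "y = (x, s)" "\<And>e. e \<notin> ?E \<Longrightarrow> x e = 0" "s \<subseteq> W" using y by auto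
    obtain n' t where z': "z = (n', t)" "\<And>e. e \<in> ?E \<Longrightarrow> n' e = 0" "t \<inter> W = {}" using z by auto
    define n where "n = (\<lambda>e. if e \<in> ?E then x e else n' e)"
    have \<phi>: "?\<phi> y z = (n, s \<union> t)" unfolding y'(1) z'(1) n_def by (simp only: fst_conv snd_conv)
    have nF: "n e = n' e" if "e \<in> F" for e using that F(2) by (auto simp: n_def)
    show ?thesis
    proof (cases "\<forall>e\<in>F. n' e = m e")
      case False
      thus ?thesis unfolding \<phi> using nF by (auto simp: z' b_def)
    next
      case True
      have "C \<in> clusters G n"
        by (rule cluster_local[OF fin_G n0(1)]) (use True nF n0(2) F(1) in auto)
      hence inA: "of_bool ((n, s \<union> t) \<in> ?A) = (1 :: real)" using True nF by auto
      have out: "n' e = 0" if "e \<in> arcs G" "tail G e \<in> W \<or> head G e \<in> W" for e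
      proof (cases "e \<in> ?E")
        case notE: False
        thus ?thesis using True m0[OF that(1) notE that(2)] by auto
      qed (use z' in auto)
      have sup: "(\<forall>e. e \<notin> arcs G \<longrightarrow> n e = 0) \<longleftrightarrow> (\<forall>e. e \<notin> arcs G \<longrightarrow> n' e = 0)"
        using EG by (auto simp: n_def)
      let ?O = "odd_part G n" and ?Ox = "odd_part ?H x" and ?On = "odd_part G n'"
      have O: "?O = ?Ox \<union> ?On" "?Ox \<inter> ?On = {}"
        using z'(2) y'(2) by (auto simp: odd_part_def n_def)
      have finO: "finite ?Ox" "finite ?On" "finite ?O" using finite_arcs_G by (auto simp: odd_part_def)
      have OxE: "?Ox \<subseteq> ?E" by (auto simp: odd_part_def)
      have even: "even_set G ?O \<longleftrightarrow> even_set ?H ?Ox \<and> even_set G ?On"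
        unfolding even_set_induce_subgraph[OF WG OxE]
      proof
        assume eO: "even_set G ?O"
        have "even (card (?Ox \<inter> edge_cut G X))" if "X \<subseteq> verts G" for X
        proof -
          have "?O \<inter> edge_cut G (X \<inter> W) = ?Ox \<inter> edge_cut G X"
          proof (intro equalityI subsetI)
            fix e assume e: "e \<in> ?O \<inter> edge_cut G (X \<inter> W)"
            hence "e \<in> arcs G" "tail G e \<in> W \<or> head G e \<in> W" by (auto simp: edge_cut_def)
            hence "n' e = 0" by (rule out)
            hence "e \<in> ?Ox" using e O(1) by (auto simp: odd_part_def)
            thus "e \<in> ?Ox \<inter> edge_cut G X" using e OxE HE by (auto simp: edge_cut_def)
          next
            fix e assume "e \<in> ?Ox \<inter> edge_cut G X"
            thus "e \<in> ?O \<inter> edge_cut G (X \<inter> W)" using OxE HE O(1) by (auto simp: edge_cut_def)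
          qed
          moreover have "even (card (?O \<inter> edge_cut G (X \<inter> W)))"
            using eO[unfolded even_set_def, rule_format, of "X \<inter> W"] WG by blast
          ultimately show ?thesis by simp
        qed
        hence x: "even_set G ?Ox" by (auto simp: even_set_def)
        have "?On = sym_diff ?O ?Ox" using O by blast
        thus "even_set G ?Ox \<and> even_set G ?On" using even_set_sym_diff[OF finO(3,1) eO x] x by simp
      next
        assume e: "even_set G ?Ox \<and> even_set G ?On"
        have "even_set G (sym_diff ?Ox ?On)"
          by (rule even_set_sym_diff[OF finO(1,2)]) (use e in blast)+
        moreover have "?O = sym_diff ?Ox ?On" using O by blast
        ultimately show "even_set G ?O" by (simp only:)
      qed
      have xs: "\<forall>e. e \<notin> ?E \<longrightarrow> x e = 0" using y'(2) by blast
      have src: "n \<in> sourceless_currents G \<longleftrightarrow> x \<in> sourceless_currents ?H \<and> n' \<in> sourceless_currents G"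
        unfolding sourceless_iff_even[OF fin_G] sourceless_iff_even[OF finH] sup even using xs by blast
      have reg: "s \<union> t \<in> cluster_regions G n \<longleftrightarrow> s \<in> cluster_regions ?H x \<and> t \<in> cluster_regions G n'"
      proof -
        have V: "s \<union> t \<subseteq> verts G \<longleftrightarrow> s \<subseteq> verts ?H \<and> t \<subseteq> verts G" using y'(3) WG by auto
        have 1: "e \<in> edge_cut G (s \<union> t) \<and> n e \<noteq> 0 \<longleftrightarrow> e \<in> edge_cut ?H s \<and> x e \<noteq> 0" if "e \<in> ?E" for e
          using that z'(3) y'(3) HE by (auto simp: edge_cut_def n_def)
        have 2: "e \<in> edge_cut G (s \<union> t) \<and> n e \<noteq> 0 \<longleftrightarrow> e \<in> edge_cut G t \<and> n' e \<noteq> 0" if "e \<notin> ?E" for e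
        proof (cases "e \<in> arcs G \<and> n' e \<noteq> 0")
          case True
          hence "tail G e \<notin> W" "head G e \<notin> W" using out by auto
          thus ?thesis using that y'(3) by (auto simp: edge_cut_def n_def)
        qed (use that in \<open>auto simp: n_def edge_cut_def\<close>)
        have 3: "e \<in> ?E" if "e \<in> edge_cut ?H s" for e using that edge_cut_subset[of ?H s] by blast
        have "(\<forall>e\<in>edge_cut G (s \<union> t). n e = 0) \<longleftrightarrow>
            (\<forall>e\<in>edge_cut ?H s. x e = 0) \<and> (\<forall>e\<in>edge_cut G t. n' e = 0)"
          using 1 2 3 z'(2) by blast
        thus ?thesis using V unfolding cluster_regions_def mem_Collect_eq by blast
      qed
      have "double_weight G K n = (\<Prod>e\<in>?E. (2 * K e) ^ n e / fact (n e)) *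
          (\<Prod>e\<in>arcs G - ?E. (2 * K e) ^ n e / fact (n e))"
        unfolding double_weight_def using EG finite_arcs_G by (subst prod.subset_diff[of ?E]) (auto simp: mult.commute)
      also have "\<dots> = double_weight ?H K x * (\<Prod>e\<in>arcs G - ?E. (2 * K e) ^ n' e / fact (n' e))"
        unfolding double_weight_def by (intro arg_cong2[of _ _ _ _ "(*)"] prod.cong) (auto simp: n_def)
      finally have dw: "double_weight G K n = \<dots>" .
      show ?thesis
        unfolding \<phi> inA c
        unfolding y'(1) z'(1) a_def b_def prod.case src reg dw using True by (auto simp: mult_ac)
    qed
  qed
  have bij: "bij_betw (?\<phi> y) ?Z {a. ?\<rho> a = y}" if y: "y \<in> ?Y" for y
  proof (rule bij_betw_byWitness[where f' = "\<lambda>a. ((\<lambda>e. if e \<in> ?E then 0 else fst a e), snd a - W)"])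
    show "\<forall>z\<in>?Z. ((\<lambda>e. if e \<in> ?E then 0 else fst (?\<phi> y z) e), snd (?\<phi> y z) - W) = z"
      using y by (auto simp: fun_eq_iff)
    show "\<forall>a\<in>{a. ?\<rho> a = y}. ?\<phi> y ((\<lambda>e. if e \<in> ?E then 0 else fst a e), snd a - W) = a"
      by (auto simp: fun_eq_iff)
    show "?\<phi> y ` ?Z \<subseteq> {a. ?\<rho> a = y}"
      using y by (auto simp: fun_eq_iff)
    show "(\<lambda>a. ((\<lambda>e. if e \<in> ?E then 0 else fst a e), snd a - W)) ` {a. ?\<rho> a = y} \<subseteq> ?Z"
      by auto
  qed
  have \<rho>: "?\<rho> x \<in> ?Y" for x by auto
  have a0: "a y = 0" if "y \<notin> ?Y" for y
    using that by (cases y) (auto simp: a_def sourceless_currents_def cluster_regions_def)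
  show ?thesis
  proof (rule pmf_eq_if_proportional)
    show "pmf (map_pmf ?\<rho> (cond_pmf ?R ?A)) y = infsum b ?Z / measure_pmf.prob ?R ?A * a y" for y
      by (rule pmf_map_cond_factor[OF ne bij \<rho> factor a0])
    show "pmf (region_law ?H K) y = d * a y" for y
      by (cases y) (simp add: d a_def)
  qed
qed

text \<open>
  The dual current inside \<open>W\<close> is sampled edge by edge from \<open>n\<close> and the cut of \<open>X\<close> inside \<open>W\<close>, whose
  conditional law is known by \<open>region_law_restricted\<close>. This is exactly how the coupling of the dual pair
  formed by the induced graph and the contracted dual produces its dual current.
\<close>

lemma wired_in_holes_master_law:
  assumes K: "\<And>e. e \<in> arcs G \<Longrightarrow> dual_couplings (K e) (Kd e)"
  shows "wired_in_holes G Gd B Kd (map_pmf (\<lambda>((n, X), (nd, Y)). (n, nd)) (master_law G Gd K Kd))"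
  unfolding wired_in_holes_def Let_def
proof (intro allI impI)
  fix C W F m
  let ?q = "map_pmf (\<lambda>((n, X), (nd, Y)). (n, nd)) (master_law G Gd K Kd)"
  let ?A = "{(n, nd :: 'e \<Rightarrow> nat). C \<in> clusters G n \<and> (\<forall>e\<in>F. n e = m e)}"
  let ?A' = "{a :: ('e \<Rightarrow> nat) \<times> 'v set. C \<in> clusters G (fst a) \<and> (\<forall>e\<in>F. fst a e = m e)}"
  let ?H = "G \<restriction> W" and ?E = "arcs (G \<restriction> W)"
  let ?P = "\<lambda>a. Pi_pmf (arcs G) 0 (\<lambda>e. dual_edge_law (K e) (Kd e) (fst a e) (e \<in> edge_cut G (snd a)))"
  let ?PH = "\<lambda>a. Pi_pmf ?E 0 (\<lambda>e. dual_edge_law (K e) (Kd e) (fst a e) (e \<in> edge_cut ?H (snd a)))"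
  let ?R = "region_law G K"
  let ?J = "do {a \<leftarrow> ?R; nd \<leftarrow> ?P a; return_pmf (a, nd)}"
  let ?\<rho> = "\<lambda>a :: ('e \<Rightarrow> nat) \<times> 'v set. ((\<lambda>e. if e \<in> ?E then fst a e else 0), snd a \<inter> W)"
  assume W: "W \<in> components (G \<restriction> (verts G - C))"
    and F: "{e \<in> arcs G. tail G e \<in> C \<or> head G e \<in> C} \<subseteq> F" "F \<subseteq> arcs G - ?E"
    and ne: "set_pmf ?q \<inter> ?A \<noteq> {}"
  have Kpos: "K e > 0" if "e \<in> arcs G" for e using K[OF that] by (simp add: dual_couplings_def)
  obtain n0 where n0: "C \<in> clusters G n0" using ne by auto
  have CV: "C \<subseteq> verts G"
    using fin_digraph.component_subset[OF fin_digraph_spanning_subgraph[OF fin_G]] n0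
    by (fastforce simp: clusters_def)
  have WG: "W \<subseteq> verts G"
    using fin_digraph.component_subset[OF fin_digraph_induce_subgraph[OF fin_G] W] by auto
  have conn: "connected ?H" by (rule connected_induce_component[OF fin_G _ W]) auto
  interpret H: dual_pair ?H "subgraph_dual Gd ?E" by (rule dual_pair_induce_subgraph[OF WG conn])
  have q: "?q = map_pmf (\<lambda>(a, nd). (fst a, nd)) ?J"
  proof -
    have "map_pmf (\<lambda>((n, X), (nd, Y)). (n, nd)) (do {b \<leftarrow> pair_pmf (?P a) S; return_pmf (a, b)}) =
        do {nd \<leftarrow> ?P a; return_pmf (fst a, nd)}" for a :: "('e \<Rightarrow> nat) \<times> 'v set" and S :: "'f set pmf"
      by (cases a) (simp add: pair_pmf_def map_bind_pmf bind_assoc_pmf bind_return_pmf)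
    thus ?thesis
      by (simp add: master_law_def map_bind_pmf)
  qed
  have pre: "(\<lambda>(a, nd). (fst a, nd)) -` ?A = {(a, nd). a \<in> ?A'}" by auto
  have neJ: "set_pmf ?J \<inter> {(a, nd). a \<in> ?A'} \<noteq> {}" using ne unfolding q by auto
  hence neR: "set_pmf ?R \<inter> ?A' \<noteq> {}" by auto
  have cond: "cond_pmf ?q ?A = map_pmf (\<lambda>(a, nd). (fst a, nd))
      (do {a \<leftarrow> cond_pmf ?R ?A'; nd \<leftarrow> ?P a; return_pmf (a, nd)})"
    unfolding q by (subst cond_map_pmf) (simp_all only: pre neJ cond_bind_pmf_fst[OF neR] not_False_eq_True)
  have local: "map_pmf (\<lambda>nd e. if e \<in> ?E then nd e else 0) (?P a) = ?PH (?\<rho> a)" for a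
  proof -
    have "map_pmf (\<lambda>nd e. if e \<in> ?E then nd e else 0) (?P a) =
        Pi_pmf ?E 0 (\<lambda>e. dual_edge_law (K e) (Kd e) (fst a e) (e \<in> edge_cut G (snd a)))"
      by (rule Pi_pmf_subset[symmetric]) (use finite_arcs_G in auto)
    also have "\<dots> = ?PH (?\<rho> a)"
    proof (rule Pi_pmf_cong)
      fix e assume e: "e \<in> ?E"
      hence "e \<in> edge_cut ?H (snd a \<inter> W) \<longleftrightarrow> e \<in> edge_cut G (snd a)"
        unfolding edge_cut_induce_subgraph_Int by (auto simp: edge_cut_induce_subgraph)
      thus "dual_edge_law (K e) (Kd e) (fst a e) (e \<in> edge_cut G (snd a)) =
          dual_edge_law (K e) (Kd e) (fst (?\<rho> a) e) (e \<in> edge_cut ?H (snd (?\<rho> a)))"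
        using e by simp
    qed auto
    finally show ?thesis .
  qed
  have KH: "dual_couplings (K e) (Kd e)" if "e \<in> ?E" for e using that K by auto
  have "map_pmf (\<lambda>(n, nd) e. if e \<in> ?E then nd e else 0) (cond_pmf ?q ?A) =
      do {a \<leftarrow> cond_pmf ?R ?A'; map_pmf (\<lambda>nd e. if e \<in> ?E then nd e else 0) (?P a)}"
    unfolding cond by (simp add: map_bind_pmf pmf.map_comp o_def) (simp add: map_pmf_def)
  also have "\<dots> = do {a \<leftarrow> map_pmf ?\<rho> (cond_pmf ?R ?A'); ?PH a}"
    by (simp only: local bind_map_pmf)
  also have "map_pmf ?\<rho> (cond_pmf ?R ?A') = region_law ?H K"
    by (rule region_law_restricted[OF Kpos CV W F neR])
  also have "do {a \<leftarrow> region_law ?H K; ?PH a} =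
      map_pmf (\<lambda>(a, b). fst b) (master_law ?H (subgraph_dual Gd ?E) K Kd)"
    unfolding master_law_def map_bind_pmf
    by (simp add: case_prod_unfold) (simp only: map_pmf_def[symmetric] map_fst_pair_pmf)
  also have "\<dots> = map_pmf fst (map_pmf snd (master_law ?H (subgraph_dual Gd ?E) K Kd))"
    by (simp add: pmf.map_comp o_def case_prod_unfold)
  also have "\<dots> = map_pmf fst (region_law (subgraph_dual Gd ?E) Kd)"
    by (subst H.map_snd_master_law) (use KH in auto)
  also have "\<dots> = double_random_current (subgraph_dual Gd ?E) Kd"
    by (simp add: region_law_def map_bind_pmf bind_return_pmf')
  finally show "map_pmf (\<lambda>(n, nd) e. if e \<in> ?E then nd e else 0) (cond_pmf ?q ?A) =
      double_random_current (subgraph_dual Gd ?E) Kd" .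
qed

end

section \<open>Nesting fields\<close>

definition spin :: "'a set \<Rightarrow> 'a \<Rightarrow> real" where
  "spin X v = (if v \<in> X then -1 else 1)"

lemma spin_square [simp]: "spin X v * spin X v = 1"
  by (simp add: spin_def)

lemma spin_edge:
  assumes "e \<in> arcs G"
  shows "spin X (tail G e) = (if e \<in> edge_cut G X then -1 else 1) * spin X (head G e)"
  using assms by (auto simp: spin_def edge_cut_def)

text \<open>
  By connectedness a cut has only two spin configurations, of which one is +1 at the base point.
\<close>

lemma face_spins_edge_cut:
  fixes G :: "('v, 'e) pre_digraph"
  assumes G: "fin_digraph G" "connected G" and Z: "Z \<subseteq> verts G" "u0 \<in> verts G" "u0 \<notin> Z"
  shows "face_spins G u0 (edge_cut G Z) = restrict (spin Z) (verts G)"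
  unfolding face_spins_def
proof (rule the_equality)
  interpret fin_digraph G by (rule G)
  show "restrict (spin Z) (verts G) \<in> verts G \<rightarrow>\<^sub>E {-1, 1} \<and> restrict (spin Z) (verts G) u0 = 1 \<and>
    (\<forall>e\<in>arcs G. restrict (spin Z) (verts G) (head G e) =
      (if e \<in> edge_cut G Z then - restrict (spin Z) (verts G) (tail G e)
       else restrict (spin Z) (verts G) (tail G e)))"
    using Z by (auto simp: spin_def edge_cut_def)
  fix s :: "'v \<Rightarrow> real"
  assume s: "s \<in> verts G \<rightarrow>\<^sub>E {-1, 1} \<and> s u0 = 1 \<and> (\<forall>e\<in>arcs G. s (head G e) =
      (if e \<in> edge_cut G Z then - s (tail G e) else s (tail G e)))"
  define X where "X = {v \<in> verts G. s v = -1}"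
  have val: "s v = -1 \<or> s v = 1" if "v \<in> verts G" for v using s that by (auto simp: PiE_def Pi_def)
  have "e \<in> edge_cut G X \<longleftrightarrow> e \<in> edge_cut G Z" if e: "e \<in> arcs G" for e
  proof -
    have "e \<in> edge_cut G X \<longleftrightarrow> s (tail G e) \<noteq> s (head G e)"
      using e val[of "tail G e"] val[of "head G e"] by (auto simp: X_def edge_cut_def)
    moreover have "s (head G e) = (if e \<in> edge_cut G Z then - s (tail G e) else s (tail G e))"
      using s e by blast
    ultimately show ?thesis using val[of "tail G e"] e by auto
  qed
  hence "edge_cut G Z = edge_cut G X" using edge_cut_subset[of G] by blast
  moreover have "u0 \<notin> X" using s by (simp add: X_def)
  moreover have "X \<subseteq> verts G" by (auto simp: X_def)
  ultimately have "X = Z" using edge_cut_eq_iff_connected[OF G Z(1)] Z by blast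
  moreover have "s = restrict (spin X) (verts G)"
  proof
    fix v show "s v = restrict (spin X) (verts G) v"
    proof (cases "v \<in> verts G")
      case False
      thus ?thesis using s by (auto simp: PiE_def extensional_def)
    qed (use val[of v] in \<open>auto simp: spin_def X_def\<close>)
  qed
  ultimately show "s = restrict (spin Z) (verts G)" by simp
qed

definition odd_faces ::
  "('v, 'e) pre_digraph \<Rightarrow> ('f, 'e) pre_digraph \<Rightarrow> 'f \<Rightarrow> ('e \<Rightarrow> nat) \<Rightarrow> 'v set \<Rightarrow> 'f set" where
  "odd_faces G Gd u0 n C = {u \<in> verts Gd. odd_around G Gd u0 n C u}"

lemma ends_in_cluster:
  assumes G: "fin_digraph G" and "C \<in> clusters G n" "e \<in> arcs G" "n e > 0"
  shows "tail G e \<in> C \<longleftrightarrow> head G e \<in> C"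
  using edge_cut_cluster[OF G assms(2), of e] assms(3,4) by (auto simp: edge_cut_def)

lemma cluster_of_eq:
  "fin_digraph G \<Longrightarrow> C \<in> clusters G n \<Longrightarrow> v \<in> C \<Longrightarrow> cluster_of G n v = C"
  unfolding clusters_def cluster_of_def
  by (rule fin_digraph.component_of_eq[OF fin_digraph_spanning_subgraph])

lemma cluster_of_in_clusters:
  "fin_digraph G \<Longrightarrow> v \<in> verts G \<Longrightarrow> cluster_of G n v \<in> clusters G n"
  unfolding clusters_def cluster_of_def
  by (rule fin_digraph.component_of_component[OF fin_digraph_spanning_subgraph]) auto

lemma cluster_of_self:
  "fin_digraph G \<Longrightarrow> v \<in> verts G \<Longrightarrow> v \<in> cluster_of G n v"
  unfolding cluster_of_def
  by (rule fin_digraph.component_of_self[OF fin_digraph_spanning_subgraph]) auto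

lemma region_signs_cluster_of:
  assumes G: "fin_digraph G" and X: "X \<in> cluster_regions G n" and v: "v \<in> verts G"
  shows "region_signs G n X (cluster_of G n v) = spin X v"
proof -
  have C: "cluster_of G n v \<in> clusters G n" "v \<in> cluster_of G n v"
    using cluster_of_in_clusters[OF G v] cluster_of_self[OF G v] by auto
  moreover have "cluster_of G n v \<subseteq> X" if "v \<in> X"
    using fin_digraph.component_subset_closed[OF fin_digraph_spanning_subgraph[OF G]] C that X
    unfolding clusters_def cluster_regions_eq by blast
  ultimately show ?thesis by (auto simp: region_signs_def spin_def)
qed

context dual_pair
begin

text \<open>
  The odd edges of a cluster form an even set because no edge of the current leaves the cluster: inside
  the cluster they look like the whole odd part.
\<close>

lemma edge_cut_odd_faces:
  assumes n: "n \<in> sourceless_currents G" and C: "C \<in> clusters G n" and u0: "u0 \<in> verts Gd"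
  shows "edge_cut Gd (odd_faces G Gd u0 n C) = {e \<in> odd_part G n. tail G e \<in> C \<and> head G e \<in> C}"
    and "u0 \<notin> odd_faces G Gd u0 n C" and "odd_faces G Gd u0 n C \<subseteq> verts Gd"
proof -
  let ?A = "{e \<in> odd_part G n. tail G e \<in> C \<and> head G e \<in> C}"
  have A: "?A \<subseteq> arcs G" by (auto simp: odd_part_def)
  have ev: "even_set G (odd_part G n)" using n by (simp add: sourceless_iff_even[OF fin_G])
  have "even_set G ?A"
    unfolding even_set_def
  proof (intro allI impI)
    fix X assume X: "X \<subseteq> verts G"
    have "?A \<inter> edge_cut G X = odd_part G n \<inter> edge_cut G (X \<inter> C)"
    proof -
      have "tail G e \<in> C \<longleftrightarrow> head G e \<in> C" if "e \<in> odd_part G n" for e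
      proof -
        have "e \<in> arcs G" "n e > 0" using that by (auto simp: odd_part_def intro: odd_pos)
        thus ?thesis by (rule ends_in_cluster[OF fin_G C])
      qed
      thus ?thesis by (auto simp: edge_cut_def)
    qed
    moreover have "even (card (odd_part G n \<inter> edge_cut G (X \<inter> C)))"
      using ev[unfolded even_set_def, rule_format, of "X \<inter> C"] X by blast
    ultimately show "even (card (?A \<inter> edge_cut G X))" by (simp only:)
  qed
  then obtain Z where Z: "Z \<subseteq> verts Gd" "?A = edge_cut Gd Z" using even_set_iff_cut[OF A] by blast
  \<comment> \<open>of the two spin configurations take the one that is +1 at \<open>u0\<close>\<close>
  define Z' where "Z' = (if u0 \<in> Z then verts Gd - Z else Z)"
  have Z': "Z' \<subseteq> verts Gd" "?A = edge_cut Gd Z'" "u0 \<notin> Z'"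
    using Z u0 by (auto simp: Z'_def edge_cut_compl[OF fin_Gd])
  have "odd_faces G Gd u0 n C = Z'"
    using face_spins_edge_cut[OF fin_Gd conn_Gd Z'(1) u0 Z'(3)] Z'(1)
    unfolding odd_faces_def odd_around_def Z'(2) by (auto simp: spin_def)
  thus "edge_cut Gd (odd_faces G Gd u0 n C) = ?A" "u0 \<notin> odd_faces G Gd u0 n C"
    "odd_faces G Gd u0 n C \<subseteq> verts Gd"
    using Z' by auto
qed

end

text \<open>
  In addition to the algebraic duality, the faces around a vertex are linked by crossing edges at this
  vertex, and likewise the vertices around a face. It is this local property that
  makes cluster labels and heights well defined. The condition is phrased with real test functions
  because it is applied to products of spins and to height differences.
\<close>

locale plane_pair = dual_pair G Gd
  for G :: "('v, 'e) pre_digraph" and Gd :: "('f, 'e) pre_digraph" +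
  assumes faces_chain: "\<And>v u u' (f :: 'f \<Rightarrow> real). \<lbrakk>incident G Gd v u; incident G Gd v u';
      \<And>e. e \<in> arcs G \<Longrightarrow> v \<in> {tail G e, head G e} \<Longrightarrow> f (tail Gd e) = f (head Gd e)\<rbrakk> \<Longrightarrow> f u = f u'"
    and vertices_chain: "\<And>u v v' (f :: 'v \<Rightarrow> real). \<lbrakk>incident G Gd v u; incident G Gd v' u;
      \<And>e. e \<in> arcs G \<Longrightarrow> u \<in> {tail Gd e, head Gd e} \<Longrightarrow> f (tail G e) = f (head G e)\<rbrakk> \<Longrightarrow> f v = f v'"
begin

lemma dual_plane_pair: "plane_pair Gd G"
proof (intro plane_pair.intro plane_pair_axioms.intro dual)
  note swap = incident_swap[OF arcs_Gd]
  show "f v = f v'" if "incident Gd G u v" "incident Gd G u v'"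
    "\<And>e. e \<in> arcs Gd \<Longrightarrow> u \<in> {tail Gd e, head Gd e} \<Longrightarrow> f (tail G e) = f (head G e)"
    for u v v' and f :: "'v \<Rightarrow> real"
    using that vertices_chain[of v u v' f] unfolding swap arcs_Gd by blast
  show "f u = f u'" if "incident Gd G u v" "incident Gd G u' v"
    "\<And>e. e \<in> arcs Gd \<Longrightarrow> v \<in> {tail G e, head G e} \<Longrightarrow> f (tail Gd e) = f (head Gd e)"
    for v u u' and f :: "'f \<Rightarrow> real"
    using that faces_chain[of v u u' f] unfolding swap arcs_Gd by blast
qed

lemma incident_edge:
  assumes "e \<in> arcs G" "v \<in> {tail G e, head G e}" "u \<in> {tail Gd e, head Gd e}"
  shows "incident G Gd v u"
proof -
  interpret G: fin_digraph G by (rule fin_G)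
  interpret D: fin_digraph Gd by (rule fin_Gd)
  show ?thesis using assms arcs_Gd by (auto simp: incident_def)
qed

text \<open>
  Among the edges at a vertex of \<open>C\<close>, those in the cut of \<open>Y\<close> are the odd ones, and these belong to \<open>C\<close>,
  so they are also those in the cut of the odd faces of \<open>C\<close>. Hence both spins flip together around
  every vertex of \<open>C\<close>. Two vertices joined by an edge of \<open>C\<close> share the faces on the sides of this edge.
\<close>

lemma cluster_parity_constant:
  assumes n: "n \<in> sourceless_currents G" and C: "C \<in> clusters G n" and u0: "u0 \<in> verts Gd"
    and Y: "odd_part G n = edge_cut Gd Y"
    and v: "v \<in> C" "incident G Gd v u" "v' \<in> C" "incident G Gd v' u'"
  shows "spin Y u * spin (odd_faces G Gd u0 n C) u = spin Y u' * spin (odd_faces G Gd u0 n C) u'"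
proof -
  let ?I = "odd_faces G Gd u0 n C"
  let ?f = "\<lambda>u. spin Y u * spin ?I u"
  have cut: "e \<in> edge_cut Gd ?I \<longleftrightarrow> e \<in> edge_cut Gd Y" if "e \<in> arcs G" "w \<in> C" "w \<in> {tail G e, head G e}" for e w
  proof (cases "e \<in> odd_part G n")
    case True
    hence "n e > 0" by (auto simp: odd_part_def intro: odd_pos)
    thus ?thesis
      using that ends_in_cluster[OF fin_G C that(1)] True edge_cut_odd_faces(1)[OF n C u0] Y by auto
  qed (use edge_cut_odd_faces(1)[OF n C u0] Y in auto)
  have same: "?f u1 = ?f u2" if "w \<in> C" "incident G Gd w u1" "incident G Gd w u2" for w u1 u2
  proof (rule faces_chain[where f = ?f, OF that(2,3)])
    fix e assume "e \<in> arcs G" "w \<in> {tail G e, head G e}"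
    thus "?f (tail Gd e) = ?f (head Gd e)"
      using cut[of e w] that(1) spin_edge[of e Gd Y] spin_edge[of e Gd ?I] arcs_Gd by auto
  qed
  define X where "X = {w \<in> C. \<forall>x. incident G Gd w x \<longrightarrow> ?f x = ?f u}"
  have X_iff: "w \<in> X \<longleftrightarrow> ?f x = ?f u" if "w \<in> C" "incident G Gd w x" for w x
  proof
    assume "?f x = ?f u"
    moreover have "?f y = ?f x" if "incident G Gd w y" for y
      by (rule same) fact+
    ultimately show "w \<in> X" unfolding X_def using that(1) by simp
  qed (use that in \<open>simp add: X_def\<close>)
  have "edge_cut (spanning_subgraph G {e. n e > 0}) X = {}"
  proof -
    have "tail G e \<in> X \<longleftrightarrow> head G e \<in> X" if "e \<in> arcs G" "n e > 0" for e
    proof (cases "tail G e \<in> C")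
      case True
      hence "head G e \<in> C" using ends_in_cluster[OF fin_G C that] by simp
      thus ?thesis
        using X_iff[OF True incident_edge[OF that(1), of _ "tail Gd e"]]
          X_iff[OF \<open>head G e \<in> C\<close> incident_edge[OF that(1), of _ "tail Gd e"]] by simp
    next
      case False
      thus ?thesis using ends_in_cluster[OF fin_G C that] by (simp add: X_def)
    qed
    thus ?thesis unfolding edge_cut_spanning_subgraph by (auto simp: edge_cut_def)
  qed
  hence "C \<subseteq> X"
    using fin_digraph.component_subset_closed[OF fin_digraph_spanning_subgraph[OF fin_G]] C v X_iff
    unfolding clusters_def by blast
  hence "v' \<in> X" using v(3) by blast
  thus ?thesis using X_iff[OF v(3,4)] by (simp only:)
qed

definition cluster_parity :: "'f \<Rightarrow> ('e \<Rightarrow> nat) \<Rightarrow> 'f set \<Rightarrow> 'v set \<Rightarrow> real" where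
  "cluster_parity u0 n Y C =
     (let u = SOME u. \<exists>v\<in>C. incident G Gd v u in spin Y u * spin (odd_faces G Gd u0 n C) u)"

lemma cluster_parity_values: "cluster_parity u0 n Y C \<in> {-1, 1}"
  by (auto simp: cluster_parity_def Let_def spin_def)

lemma cluster_parity_eq:
  assumes n: "n \<in> sourceless_currents G" and C: "C \<in> clusters G n" and u0: "u0 \<in> verts Gd"
    and Y: "odd_part G n = edge_cut Gd Y" and v: "v \<in> C" "incident G Gd v u"
  shows "cluster_parity u0 n Y C = spin Y u * spin (odd_faces G Gd u0 n C) u"
proof -
  have "\<exists>v\<in>C. incident G Gd v (SOME u. \<exists>v\<in>C. incident G Gd v u)"
    by (rule someI[of _ u]) (use v in blast)
  then obtain v' where "v' \<in> C" "incident G Gd v' (SOME u. \<exists>v\<in>C. incident G Gd v u)" by blast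
  thus ?thesis
    unfolding cluster_parity_def Let_def using cluster_parity_constant[OF n C u0 Y] v by blast
qed

text \<open>
  The factor \<open>k\<close> is -1 for the faces of the primal graph and 1 for those of the dual. The opposite
  signs correspond to the antisymmetry of the height difference between a face and a vertex.
\<close>

definition nesting_label :: "real \<Rightarrow> 'f \<Rightarrow> ('e \<Rightarrow> nat) \<Rightarrow> 'v set \<Rightarrow> 'f set \<Rightarrow> 'v set \<Rightarrow> real" where
  "nesting_label k u0 n X Y C = k * cluster_parity u0 n Y C * region_signs G n X C"

text \<open>
  Only the cluster containing an odd edge changes its contribution across this edge, by its label times
  its parity spin; the two parity spins cancel, and the dual spin that remains is half the difference
  of its values on the two sides. Across all other edges both sides are zero.
\<close>

lemma nesting_gradient:
  assumes n: "n \<in> sourceless_currents G" and X: "X \<in> cluster_regions G n" and u0: "u0 \<in> verts Gd"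
    and Y: "odd_part G n = edge_cut Gd Y" and e: "e \<in> arcs G" and v: "v \<in> {tail G e, head G e}"
  shows "free_nesting_field G Gd u0 n (nesting_label k u0 n X Y) (head Gd e) -
      free_nesting_field G Gd u0 n (nesting_label k u0 n X Y) (tail Gd e) =
    k * (1 / 2) * spin X v * (spin Y (tail Gd e) - spin Y (head Gd e))"
proof -
  interpret G: fin_digraph G by (rule fin_G)
  interpret D: fin_digraph Gd by (rule fin_Gd)
  let ?a = "tail Gd e" and ?b = "head Gd e" and ?l = "nesting_label k u0 n X Y"
  let ?I = "odd_faces G Gd u0 n"
  define g where "g C = (of_bool (?b \<in> ?I C) - of_bool (?a \<in> ?I C)) * ?l C" for C
  have ab: "?a \<in> verts Gd" "?b \<in> verts Gd" using e arcs_Gd by auto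
  hence "free_nesting_field G Gd u0 n ?l ?b - free_nesting_field G Gd u0 n ?l ?a = (\<Sum>C\<in>clusters G n. g C)"
    by (simp add: free_nesting_field_def g_def odd_faces_def sum_subtractf left_diff_distrib)
  also have "\<dots> = k * (1 / 2) * spin X v * (spin Y ?a - spin Y ?b)"
  proof (cases "e \<in> odd_part G n")
    case False
    have "g C = 0" if C: "C \<in> clusters G n" for C
    proof -
      have "e \<notin> edge_cut Gd (?I C)" using edge_cut_odd_faces(1)[OF n C u0] False by simp
      thus ?thesis using e arcs_Gd by (auto simp: g_def edge_cut_def)
    qed
    moreover have "spin Y ?a = spin Y ?b" using False Y spin_edge[of e Gd Y] e arcs_Gd by simp
    ultimately show ?thesis by simp
  next
    case True
    let ?C = "cluster_of G n v"
    have vG: "v \<in> verts G" using v e by auto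
    have C: "?C \<in> clusters G n" "v \<in> ?C"
      using cluster_of_in_clusters[OF fin_G vG] cluster_of_self[OF fin_G vG] by auto
    have "n e > 0" using True by (auto simp: odd_part_def intro: odd_pos)
    hence ends: "tail G e \<in> ?C" "head G e \<in> ?C" using ends_in_cluster[OF fin_G C(1) e] C(2) v by auto
    have "g D = 0" if D: "D \<in> clusters G n - {?C}" for D
    proof -
      have "e \<notin> edge_cut Gd (?I D)"
      proof
        assume "e \<in> edge_cut Gd (?I D)"
        hence "v \<in> D" using edge_cut_odd_faces(1)[OF n _ u0, of D] D v by auto
        thus False using cluster_of_eq[OF fin_G, of D n v] D by simp
      qed
      thus ?thesis using e arcs_Gd by (auto simp: g_def edge_cut_def)
    qed
    hence "(\<Sum>C\<in>clusters G n. g C) = g ?C"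
      using C(1) by (subst sum.remove[OF finite_clusters[OF fin_G] C(1)]) simp
    moreover have "?l ?C = k * (spin Y ?a * spin (?I ?C) ?a) * spin X v"
      using cluster_parity_eq[OF n C(1) u0 Y C(2) incident_edge[OF e v, of ?a]]
        region_signs_cluster_of[OF fin_G X vG] by (simp add: nesting_label_def)
    moreover have "e \<in> edge_cut Gd (?I ?C)" using edge_cut_odd_faces(1)[OF n C(1) u0] True ends by simp
    hence "of_bool (?b \<in> ?I ?C) - of_bool (?a \<in> ?I ?C) = spin (?I ?C) ?a"
      by (auto simp: edge_cut_def spin_def)
    moreover have "spin Y ?b = - spin Y ?a" using True Y spin_edge[of e Gd Y] e arcs_Gd by simp
    ultimately show ?thesis using spin_square[of "?I ?C" ?a] by (simp add: g_def mult_ac)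
  qed
  finally show ?thesis .
qed

lemma nesting_base:
  assumes n: "n \<in> sourceless_currents G" and u0: "u0 \<in> verts Gd"
  shows "free_nesting_field G Gd u0 n eps u0 = 0"
  unfolding free_nesting_field_def
proof (rule sum.neutral, rule ballI)
  fix C assume "C \<in> clusters G n"
  thus "of_bool (odd_around G Gd u0 n C u0) * eps C = 0"
    using edge_cut_odd_faces(2)[OF n _ u0, of C] u0 by (simp add: odd_faces_def)
qed

end

lemma wired_nesting_field_eq:
  assumes "fin_digraph G" "g \<in> verts G"
  shows "wired_nesting_field G Gd g u0 n eps u =
    free_nesting_field G Gd u0 n eps u - 1 / 2 * eps (cluster_of G n g)"
  unfolding wired_nesting_field_def free_nesting_field_def Let_def
  by (subst sum.remove[OF finite_clusters[OF assms(1)] cluster_of_in_clusters[OF assms]])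
     (simp add: left_diff_distrib)

lemma map_cluster_signs_flip:
  assumes G: "fin_digraph G" and k: "\<And>C. k C \<in> {-1, 1}"
  shows "map_pmf (\<lambda>s C. k C * s C) (cluster_signs G n) = cluster_signs G n"
  unfolding cluster_signs_eq[OF G]
proof (rule map_pmf_of_set_bij_betw)
  let ?S = "PiE_dflt (clusters G n) 0 (\<lambda>_. {-1, 1 :: real})"
  have kk: "k C * k C = 1" "k C = -1 \<or> k C = 1" for C using k[of C] by auto
  have "(\<lambda>C. k C * s C) \<in> ?S" if "s \<in> ?S" for s
  proof -
    have "k C * s C = -1 \<or> k C * s C = 1" if "s C = -1 \<or> s C = 1" for C using kk(2)[of C] that by auto
    thus ?thesis using that by (auto simp: PiE_dflt_def)
  qed
  thus "bij_betw (\<lambda>s C. k C * s C) ?S ?S"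
    by (intro bij_betw_byWitness[where f' = "\<lambda>s C. k C * s C"]) (auto simp: kk simp flip: mult.assoc)
  show "?S \<noteq> {}" by auto
  show "finite ?S" by (intro finite_PiE_dflt finite_clusters G) auto
qed

text \<open>
  Given \<open>n\<close>, the dual spins are independent of the cluster spins, and multiplying independent fair signs
  by signs that depend on \<open>n\<close> and the dual spins leaves their law unchanged.
\<close>

lemma relabelled_master_law:
  assumes G: "fin_digraph G" and k: "\<And>n Y C. k n Y C \<in> {-1, 1}"
  shows "map_pmf (\<lambda>((n, X), (nd, Y)). (n, \<lambda>C. k n Y C * region_signs G n X C)) (master_law G Gd K Kd) =
    signed_double_random_current G K"
proof -
  let ?T = "\<lambda>n. pmf_of_set {Y. Y \<subseteq> verts Gd \<and> edge_cut Gd Y = odd_part G n}"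
  let ?c = "\<lambda>n. pmf_of_set (cluster_regions G n)"
  have inner: "map_pmf (\<lambda>((n, X), (nd, Y)). (n, \<lambda>C. k n Y C * region_signs G n X C))
      (do {b \<leftarrow> pair_pmf P (?T n); return_pmf ((n, X), b)}) =
      do {Y \<leftarrow> ?T n; return_pmf (n, \<lambda>C. k n Y C * region_signs G n X C)}" for n X and P :: "('b \<Rightarrow> nat) pmf"
    by (simp add: pair_pmf_def map_bind_pmf bind_assoc_pmf bind_return_pmf)
  have "map_pmf (\<lambda>((n, X), (nd, Y)). (n, \<lambda>C. k n Y C * region_signs G n X C)) (master_law G Gd K Kd) =
      do {n \<leftarrow> double_random_current G K; X \<leftarrow> ?c n; Y \<leftarrow> ?T n;
          return_pmf (n, \<lambda>C. k n Y C * region_signs G n X C)}"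
    unfolding master_law_def region_law_def map_bind_pmf[of _ "bind_pmf _ _"] bind_assoc_pmf bind_return_pmf
      map_bind_pmf[of _ "double_random_current G K"] map_bind_pmf[of _ "?c _"]
    by (simp add: inner)
  also have "\<dots> = do {n \<leftarrow> double_random_current G K; Y \<leftarrow> ?T n; X \<leftarrow> ?c n;
          return_pmf (n, \<lambda>C. k n Y C * region_signs G n X C)}"
    by (subst bind_commute_pmf) (rule refl)
  also have "\<dots> = do {n \<leftarrow> double_random_current G K; Y \<leftarrow> ?T n; s \<leftarrow> cluster_signs G n; return_pmf (n, s)}"
  proof -
    have "do {X \<leftarrow> ?c n; return_pmf (n, \<lambda>C. k n Y C * region_signs G n X C)} =
        do {s \<leftarrow> cluster_signs G n; return_pmf (n, s)}" for n Y
    proof -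
      have "do {X \<leftarrow> ?c n; return_pmf (n, \<lambda>C. k n Y C * region_signs G n X C)} =
          map_pmf (Pair n) (map_pmf (\<lambda>s C. k n Y C * s C) (map_pmf (region_signs G n) (?c n)))"
        by (simp add: pmf.map_comp o_def) (simp add: map_pmf_def)
      also have "\<dots> = map_pmf (Pair n) (cluster_signs G n)"
        by (simp only: map_region_signs[OF G] map_cluster_signs_flip[OF G k])
      finally show ?thesis by (simp add: map_pmf_def)
    qed
    thus ?thesis by simp
  qed
  also have "\<dots> = signed_double_random_current G K"
    by (simp add: signed_double_random_current_def)
  finally show ?thesis .
qed

section \<open>The height function\<close>

lemma (in plane_graph) plane_pair: "plane_pair G Gd"
  by (intro plane_pair.intro plane_pair_axioms.intro)
     (fact dual_pair incident_faces_chain incident_vertices_chain)+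

context plane_pair
begin

definition face_height :: "'f \<Rightarrow> ('e \<Rightarrow> nat) \<Rightarrow> 'v set \<Rightarrow> 'f set \<Rightarrow> 'f \<Rightarrow> real" where
  "face_height g n X Y = free_nesting_field G Gd g n (nesting_label (- 1) g n X Y)"

text \<open>
  The heights are defined on the faces as a nesting field and extended to a vertex from an arbitrary
  incident face; \<open>height_difference\<close> shows that the choice is immaterial.
\<close>

definition height :: "'f \<Rightarrow> ('e \<Rightarrow> nat) \<Rightarrow> 'v set \<Rightarrow> 'f set \<Rightarrow> 'v + 'f \<Rightarrow> real" where
  "height g n X Y x = (case x of
     Inl v \<Rightarrow> let u = SOME u. incident G Gd v u in face_height g n X Y u - 1 / 2 * spin Y u * spin X v
   | Inr u \<Rightarrow> face_height g n X Y u)"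

context
  fixes g :: 'f and n nd :: "'e \<Rightarrow> nat" and X :: "'v set" and Y :: "'f set"
  assumes g: "g \<in> verts Gd"
    and n: "n \<in> sourceless_currents G" "odd_part G n = edge_cut Gd Y" "X \<in> cluster_regions G n"
    and nd: "nd \<in> sourceless_currents Gd" "odd_part Gd nd = edge_cut G X" "Y \<in> cluster_regions Gd nd"
begin

text \<open>
  Across an edge at \<open>v\<close> the face heights change by the gradient of half the product of the dual spin
  with the spin of \<open>v\<close>, so the chosen incident face may be replaced by any other.
\<close>

lemma height_difference:
  assumes "incident G Gd v u"
  shows "height g n X Y (Inr u) - height g n X Y (Inl v) = 1 / 2 * spin Y u * spin X v"
proof -
  let ?f = "\<lambda>u. face_height g n X Y u - 1 / 2 * spin Y u * spin X v"
  let ?w = "SOME u. incident G Gd v u"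
  have "incident G Gd v ?w" using assms by (rule someI)
  hence "?f ?w = ?f u"
  proof (rule faces_chain[OF _ assms])
    fix e assume e: "e \<in> arcs G" "v \<in> {tail G e, head G e}"
    show "?f (tail Gd e) = ?f (head Gd e)"
      using nesting_gradient[OF n(1,3) g n(2) e, of "- 1"]
      by (simp add: face_height_def algebra_simps)
  qed
  thus ?thesis by (simp add: height_def Let_def)
qed

text \<open>
  Both sides have the same gradient along the edges of the graph. At \<open>v0\<close> all parity spins are +1, so the
  wired field is minus half the label of the cluster of \<open>g\<close>, that is \<open>- 1/2 * taud_g * tau_v0\<close>, and this is
  the height at \<open>v0\<close> since the height at \<open>g\<close> is zero.
\<close>

lemma height_vertices_eq_wired_nesting_field:
  assumes v0: "incident G Gd v0 g" and v: "v \<in> verts G"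
  shows "height g n X Y (Inl v) =
    wired_nesting_field Gd G g v0 nd (plane_pair.nesting_label Gd G 1 v0 nd Y X) v"
proof -
  interpret D: plane_pair Gd G by (rule dual_plane_pair)
  interpret G: fin_digraph G by (rule fin_G)
  let ?l = "D.nesting_label 1 v0 nd Y X"
  let ?W = "wired_nesting_field Gd G g v0 nd ?l"
  let ?h = "\<lambda>v. height g n X Y (Inl v)"
  have W: "?W v = free_nesting_field Gd G v0 nd ?l v - 1 / 2 * ?l (cluster_of Gd nd g)" for v
    by (rule wired_nesting_field_eq[OF fin_Gd g])
  have v0G: "v0 \<in> verts G" using v0 by (simp add: incident_def)
  have edge: "?h (tail G e) - ?W (tail G e) = ?h (head G e) - ?W (head G e)" if e: "e \<in> arcs G" for e
  proof -
    have e': "e \<in> arcs Gd" using e arcs_Gd by simp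
    have "?W (head G e) - ?W (tail G e) =
        1 / 2 * spin Y (tail Gd e) * (spin X (tail G e) - spin X (head G e))"
      using D.nesting_gradient[OF nd(1,3) v0G nd(2) e', of "tail Gd e" 1] by (simp add: W)
    moreover have "height g n X Y (Inr (tail Gd e)) - ?h (tail G e) = 1 / 2 * spin Y (tail Gd e) * spin X (tail G e)"
      "height g n X Y (Inr (tail Gd e)) - ?h (head G e) = 1 / 2 * spin Y (tail Gd e) * spin X (head G e)"
      by (intro height_difference incident_edge[OF e]; simp)+
    ultimately show ?thesis by (simp add: algebra_simps)
  qed
  have base: "?h v0 = ?W v0"
  proof -
    have "height g n X Y (Inr g) = 0"
      using nesting_base[OF n(1) g] by (simp add: height_def face_height_def)
    hence "?h v0 = - (1 / 2) * spin Y g * spin X v0" using height_difference[OF v0] by simp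
    moreover have "?l (cluster_of Gd nd g) = spin Y g * spin X v0"
    proof -
      have C: "cluster_of Gd nd g \<in> clusters Gd nd" "g \<in> cluster_of Gd nd g"
        using cluster_of_in_clusters[OF fin_Gd g] cluster_of_self[OF fin_Gd g] by auto
      have "incident Gd G g v0" using v0 incident_swap[OF arcs_Gd] by simp
      hence "D.cluster_parity v0 nd X (cluster_of Gd nd g) =
          spin X v0 * spin (odd_faces Gd G v0 nd (cluster_of Gd nd g)) v0"
        by (rule D.cluster_parity_eq[OF nd(1) C(1) v0G nd(2) C(2)])
      moreover have "v0 \<notin> odd_faces Gd G v0 nd (cluster_of Gd nd g)"
        by (rule D.edge_cut_odd_faces(2)[OF nd(1) C(1) v0G])
      ultimately show ?thesis
        unfolding D.nesting_label_def region_signs_cluster_of[OF fin_Gd nd(3) g] by (simp add: spin_def)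
    qed
    ultimately show ?thesis unfolding W D.nesting_base[OF nd(1) v0G] by simp
  qed
  \<comment> \<open>the set where the two functions agree has empty cut\<close>
  define S where "S = {v \<in> verts G. ?h v = ?W v}"
  have "tail G e \<in> S \<longleftrightarrow> head G e \<in> S" if e: "e \<in> arcs G" for e
    using edge[OF e] e by (auto simp: S_def)
  hence "edge_cut G S = {}" by (auto simp: edge_cut_def)
  moreover have "S \<subseteq> verts G" "v0 \<in> S" using base v0G by (auto simp: S_def)
  ultimately have "S = verts G" using G.connected_closed[OF conn_G] by blast
  thus ?thesis using v by (auto simp: S_def)
qed

end

end

theorem theorem3p1:
  fixes G :: "('v, 'e) pre_digraph"
    and Gd :: "('f, 'e) pre_digraph"
    and rot :: "'e \<times> bool \<Rightarrow> 'e \<times> bool"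
    and g :: 'f
    and \<beta> \<beta>d :: real
    and J Jd :: "'e \<Rightarrow> real"
  assumes plane: "plane_graph G Gd rot"
    and unbounded_face: "g \<in> verts Gd"
    and beta: "\<beta> > 0"
    and coupling: "\<And>e. e \<in> arcs G \<Longrightarrow> J e > 0"
    and dual_params: "\<And>e. e \<in> arcs G \<Longrightarrow> exp (- 2 * (\<beta>d * Jd e)) = tanh (\<beta> * J e)"
  shows "\<exists>p :: (('e \<Rightarrow> nat) \<times> ('v set \<Rightarrow> real) \<times> ('e \<Rightarrow> nat) \<times> ('f set \<Rightarrow> real) \<times> ('v + 'f \<Rightarrow> real)) pmf.
    map_pmf (\<lambda>(n, \<tau>, nd, \<tau>d, H). (n, \<tau>)) p = signed_double_random_current G (\<lambda>e. \<beta> * J e) \<and>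
    map_pmf (\<lambda>(n, \<tau>, nd, \<tau>d, H). (nd, \<tau>d)) p = signed_double_random_current Gd (\<lambda>e. \<beta>d * Jd e) \<and>
    (\<forall>(n, \<tau>, nd, \<tau>d, H) \<in> set_pmf p.
       (\<forall>e\<in>arcs G. (n e > 0 \<longrightarrow> nd e = 0) \<and> (nd e > 0 \<longrightarrow> n e = 0)) \<and>
       odd_part G n = interfaces Gd nd \<tau>d \<and>
       odd_part Gd nd = interfaces G n \<tau> \<and>
       (\<forall>u v. incident G Gd v u \<longrightarrow>
          H (Inr u) - H (Inl v) = 1/2 * \<tau>d (cluster_of Gd nd u) * \<tau> (cluster_of G n v))) \<and>
    map_pmf (\<lambda>(n, \<tau>, nd, \<tau>d, H). restrict (\<lambda>u. H (Inr u)) (verts Gd)) p =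
      free_nesting_law G Gd g (\<lambda>e. \<beta> * J e) \<and>
    (\<forall>v0. incident G Gd v0 g \<longrightarrow>
      map_pmf (\<lambda>(n, \<tau>, nd, \<tau>d, H). restrict (\<lambda>v. H (Inl v)) (verts G)) p =
        wired_nesting_law Gd G g v0 (\<lambda>e. \<beta>d * Jd e)) \<and>
    wired_in_holes G Gd {v. incident G Gd v g} (\<lambda>e. \<beta>d * Jd e)
      (map_pmf (\<lambda>(n, \<tau>, nd, \<tau>d, H). (n, nd)) p) \<and>
    wired_in_holes Gd G {g} (\<lambda>e. \<beta> * J e)
      (map_pmf (\<lambda>(n, \<tau>, nd, \<tau>d, H). (nd, n)) p)"
proof -
  interpret plane_pair G Gd by (rule plane_graph.plane_pair[OF plane])
  interpret D: plane_pair Gd G by (rule dual_plane_pair)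
  define K where "K = (\<lambda>e. \<beta> * J e)"
  define Kd where "Kd = (\<lambda>e. \<beta>d * Jd e)"
  have couplings: "dual_couplings (K e) (Kd e)" if e: "e \<in> arcs G" for e
  proof -
    have k: "K e > 0" using beta coupling[OF e] by (simp add: K_def)
    have t: "exp (- 2 * Kd e) = tanh (K e)" using dual_params[OF e] by (simp add: K_def Kd_def)
    have "exp (- 2 * Kd e) < 1" unfolding t by (rule tanh_real_lt_1)
    hence "Kd e > 0" by simp
    with k t show ?thesis by (simp add: dual_couplings_def)
  qed
  have couplings': "dual_couplings (Kd e) (K e)" if "e \<in> arcs Gd" for e
    using couplings dual_couplings_sym that arcs_Gd by auto
  define \<mu> where "\<mu> = master_law G Gd K Kd"
  have \<mu>_dual: "master_law Gd G Kd K = map_pmf prod.swap \<mu>"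
    unfolding \<mu>_def by (rule master_law_dual[OF couplings])
  define F where "F = (\<lambda>((n, X), (nd, Y)).
    (n, region_signs G n X, nd, region_signs Gd nd Y, height g n X Y))"
  define p where "p = map_pmf F \<mu>"
  have supp: "n \<in> sourceless_currents G" "odd_part G n = edge_cut Gd Y" "X \<in> cluster_regions G n"
      "nd \<in> sourceless_currents Gd" "odd_part Gd nd = edge_cut G X" "Y \<in> cluster_regions Gd nd"
      "\<And>e. n e = 0 \<or> nd e = 0"
    if w: "((n, X), (nd, Y)) \<in> set_pmf \<mu>" for n X nd Y
  proof -
    note 1 = master_law_support[OF couplings w[unfolded \<mu>_def]]
    have "((nd, Y), (n, X)) \<in> set_pmf (master_law Gd G Kd K)" using w by (force simp: \<mu>_dual)
    note 2 = D.master_law_support[OF couplings' this]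
    show "n \<in> sourceless_currents G" by (rule 1)
    show "odd_part G n = edge_cut Gd Y" by (rule 1)
    show "X \<in> cluster_regions G n" by (rule 1)
    show "nd \<in> sourceless_currents Gd" by (rule 2)
    show "odd_part Gd nd = edge_cut G X" by (rule 1)
    show "Y \<in> cluster_regions Gd nd" by (rule 1)
    show "n e = 0 \<or> nd e = 0" for e by (rule 1)
  qed
  have primal: "map_pmf (\<lambda>(n, \<tau>, nd, \<tau>d, H). (n, \<tau>)) p = signed_double_random_current G K"
  proof -
    have "map_pmf (\<lambda>(n, \<tau>, nd, \<tau>d, H). (n, \<tau>)) p =
        map_pmf (\<lambda>(n, X). (n, region_signs G n X)) (map_pmf fst \<mu>)"
      unfolding p_def F_def pmf.map_comp by (intro map_pmf_cong) auto
    thus ?thesis by (simp only: \<mu>_def map_fst_master_law signed_double_random_current_eq[OF fin_G])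
  qed
  have dual: "map_pmf (\<lambda>(n, \<tau>, nd, \<tau>d, H). (nd, \<tau>d)) p = signed_double_random_current Gd Kd"
  proof -
    have "map_pmf (\<lambda>(n, \<tau>, nd, \<tau>d, H). (nd, \<tau>d)) p =
        map_pmf (\<lambda>(n, X). (n, region_signs Gd n X)) (map_pmf snd \<mu>)"
      unfolding p_def F_def pmf.map_comp by (intro map_pmf_cong) auto
    thus ?thesis
      by (simp only: \<mu>_def map_snd_master_law[OF couplings] signed_double_random_current_eq[OF fin_Gd])
  qed
  have pointwise: "\<forall>(n, \<tau>, nd, \<tau>d, H) \<in> set_pmf p.
       (\<forall>e\<in>arcs G. (n e > 0 \<longrightarrow> nd e = 0) \<and> (nd e > 0 \<longrightarrow> n e = 0)) \<and>
       odd_part G n = interfaces Gd nd \<tau>d \<and>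
       odd_part Gd nd = interfaces G n \<tau> \<and>
       (\<forall>u v. incident G Gd v u \<longrightarrow>
          H (Inr u) - H (Inl v) = 1/2 * \<tau>d (cluster_of Gd nd u) * \<tau> (cluster_of G n v))"
  proof -
    have interfaces: "interfaces \<Gamma> m (region_signs \<Gamma> m Z) = edge_cut \<Gamma> Z"
      if "fin_digraph \<Gamma>" "Z \<in> cluster_regions \<Gamma> m" for \<Gamma> :: "('a, 'e) pre_digraph" and m Z
    proof -
      interpret fin_digraph \<Gamma> by (rule that)
      show ?thesis
        using region_signs_cluster_of[OF that] by (auto simp: interfaces_def edge_cut_def spin_def split: if_splits)
    qed
    have "(\<forall>e\<in>arcs G. (n e > 0 \<longrightarrow> nd e = 0) \<and> (nd e > 0 \<longrightarrow> n e = 0)) \<and>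
       odd_part G n = interfaces Gd nd (region_signs Gd nd Y) \<and>
       odd_part Gd nd = interfaces G n (region_signs G n X) \<and>
       (\<forall>u v. incident G Gd v u \<longrightarrow> height g n X Y (Inr u) - height g n X Y (Inl v) =
          1/2 * region_signs Gd nd Y (cluster_of Gd nd u) * region_signs G n X (cluster_of G n v))"
      if w: "((n, X), (nd, Y)) \<in> set_pmf \<mu>" for n X nd Y
    proof (intro conjI allI impI ballI)
      note s = supp[OF w]
      show "nd e = 0" if "n e > 0" for e using s(7)[of e] that by simp
      show "n e = 0" if "nd e > 0" for e using s(7)[of e] that by simp
      show "odd_part G n = interfaces Gd nd (region_signs Gd nd Y)"
        by (simp only: interfaces[OF fin_Gd s(6)] s(2))
      show "odd_part Gd nd = interfaces G n (region_signs G n X)"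
        by (simp only: interfaces[OF fin_G s(3)] s(5))
      fix u v assume uv: "incident G Gd v u"
      hence "v \<in> verts G" "u \<in> verts Gd" by (auto simp: incident_def)
      thus "height g n X Y (Inr u) - height g n X Y (Inl v) =
          1/2 * region_signs Gd nd Y (cluster_of Gd nd u) * region_signs G n X (cluster_of G n v)"
        using height_difference[OF unbounded_face s(1,2,3,4,5,6) uv]
        by (simp add: region_signs_cluster_of[OF fin_Gd s(6)] region_signs_cluster_of[OF fin_G s(3)])
    qed
    thus ?thesis unfolding p_def F_def by auto
  qed
  have faces: "map_pmf (\<lambda>(n, \<tau>, nd, \<tau>d, H). restrict (\<lambda>u. H (Inr u)) (verts Gd)) p =
      free_nesting_law G Gd g K"
  proof -
    have "map_pmf (\<lambda>(n, \<tau>, nd, \<tau>d, H). restrict (\<lambda>u. H (Inr u)) (verts Gd)) p =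
        map_pmf (\<lambda>(n, eps). restrict (free_nesting_field G Gd g n eps) (verts Gd))
          (map_pmf (\<lambda>((n, X), (nd, Y)). (n, nesting_label (- 1) g n X Y)) \<mu>)"
      unfolding p_def F_def pmf.map_comp
      by (intro map_pmf_cong) (auto simp: height_def face_height_def)
    also have "map_pmf (\<lambda>((n, X), (nd, Y)). (n, nesting_label (- 1) g n X Y)) \<mu> =
        signed_double_random_current G K"
      unfolding \<mu>_def nesting_label_def
      by (rule relabelled_master_law[OF fin_G, where k = "\<lambda>n Y C. - 1 * cluster_parity g n Y C"])
         (use cluster_parity_values in force)
    finally show ?thesis by (simp only: free_nesting_law_def)
  qed
  have vertices: "map_pmf (\<lambda>(n, \<tau>, nd, \<tau>d, H). restrict (\<lambda>v. H (Inl v)) (verts G)) p =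
        wired_nesting_law Gd G g v0 Kd" if v0: "incident G Gd v0 g" for v0
  proof -
    have "map_pmf (\<lambda>(n, \<tau>, nd, \<tau>d, H). restrict (\<lambda>v. H (Inl v)) (verts G)) p =
        map_pmf (\<lambda>(n, eps). restrict (wired_nesting_field Gd G g v0 n eps) (verts G))
          (map_pmf (\<lambda>((nd, Y), (n, X)). (nd, D.nesting_label 1 v0 nd Y X)) (map_pmf prod.swap \<mu>))"
      unfolding p_def F_def pmf.map_comp
    proof (intro map_pmf_cong refl)
      fix w assume w: "w \<in> set_pmf \<mu>"
      obtain n X nd Y where w': "w = ((n, X), (nd, Y))" by (metis prod.exhaust)
      show "((\<lambda>(n, \<tau>, nd, \<tau>d, H). restrict (\<lambda>v. H (Inl v)) (verts G)) \<circ>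
          (\<lambda>((n, X), (nd, Y)). (n, region_signs G n X, nd, region_signs Gd nd Y, height g n X Y))) w =
        ((\<lambda>(n, eps). restrict (wired_nesting_field Gd G g v0 n eps) (verts G)) \<circ>
          ((\<lambda>((nd, Y), (n, X)). (nd, D.nesting_label 1 v0 nd Y X)) \<circ> prod.swap)) w"
        using height_vertices_eq_wired_nesting_field[OF unbounded_face supp(1-6)[OF w[unfolded w']] v0]
        by (auto simp: w' intro!: restrict_ext)
    qed
    also have "map_pmf (\<lambda>((nd, Y), (n, X)). (nd, D.nesting_label 1 v0 nd Y X)) (map_pmf prod.swap \<mu>) =
        signed_double_random_current Gd Kd"
      unfolding \<mu>_dual[symmetric] D.nesting_label_def
      by (rule relabelled_master_law[OF fin_Gd, where k = "\<lambda>n Y C. 1 * D.cluster_parity v0 n Y C"])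
         (use D.cluster_parity_values in force)
    finally show ?thesis by (simp only: wired_nesting_law_def)
  qed
  have holes: "wired_in_holes G Gd {v. incident G Gd v g} Kd
      (map_pmf (\<lambda>(n, \<tau>, nd, \<tau>d, H). (n, nd)) p)"
  proof -
    have "map_pmf (\<lambda>(n, \<tau>, nd, \<tau>d, H). (n, nd)) p = map_pmf (\<lambda>((n, X), (nd, Y)). (n, nd)) \<mu>"
      unfolding p_def F_def pmf.map_comp by (intro map_pmf_cong) auto
    thus ?thesis using wired_in_holes_master_law[OF couplings] by (simp only: \<mu>_def)
  qed
  have dual_holes: "wired_in_holes Gd G {g} K (map_pmf (\<lambda>(n, \<tau>, nd, \<tau>d, H). (nd, n)) p)"
  proof -
    have "map_pmf (\<lambda>(n, \<tau>, nd, \<tau>d, H). (nd, n)) p =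
        map_pmf (\<lambda>((nd, Y), (n, X)). (nd, n)) (map_pmf prod.swap \<mu>)"
      unfolding p_def F_def pmf.map_comp by (intro map_pmf_cong) auto
    thus ?thesis using D.wired_in_holes_master_law[OF couplings'] by (simp only: \<mu>_dual[symmetric])
  qed
  show ?thesis
    using primal dual pointwise faces vertices holes dual_holes
    unfolding K_def Kd_def by (intro exI[of _ p] conjI allI impI)
qed

end
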